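(* Let $S$ be a strictly positive continuous price process with $$S_t=S_0+\int_0^tr(s)S_s\,ds+\int_0^tS_s\delta_s\,dW_s,$$ as described in the context, and let $t_0\ge0$. Assume: (A) $\lim_{t\downarrow t_0}\mathbb{E}[|\delta_t-\delta_{t_0}|^2\,|\,\mathcal{F}_{t_0}]=0$; (I) there exists $T>t_0$ such that $\mathbb{E}\left[\exp\left(\frac12\int_{t_0}^T\delta_s^2\,ds\right)\Big|\mathcal{F}_{t_0}\right]<\infty$; (N) there exists $\epsilon>0$ such that $\mathbb{P}\left(\forall t\in[t_0,T],\ \delta_t\ge\epsilon\right)=1$. Then $$\frac{1}{\sqrt{t-t_0}}\,C_{t_0}(t,S_{t_0})\underset{t\to t_0^+}{\longrightarrow}\frac{S_{t_0}}{\sqrt{2\pi}}\,\delta_{t_0}.$$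
   Context: All processes are defined on a filtered probability space $(\Omega,\mathcal{F},(\mathcal{F}_t)_{t\ge0},\mathbb{P})$. $W$ is a standard real Brownian motion; $r$ is a deterministic, positive, bounded continuous function on $\mathbb{R}^+$ (the discount rate); $\delta$ is an adapted real-valued process (the volatility). For $t>t_0$ and $K>0$, the call price is $$C_{t_0}(t,K)=e^{-\int_{t_0}^tr(s)\,ds}\,\mathbb{E}\left[\max(S_t-K,0)\,|\,\mathcal{F}_{t_0}\right];$$ in $C_{t_0}(t,S_{t_0})$ the strike is $K=S_{t_0}$. Statements about conditional expectations given $\mathcal{F}_{t_0}$ are understood almost surely, i.e. under the conditional measure $\mathbb{P}_{|\mathcal{F}_{t_0}}$. *)

theory Defs
  imports "HOL-Probability.Probability"
begin

section \<open>Processes on a filtered probability space\<close>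

text \<open>Time is a real number, and only times \<open>t \<ge> 0\<close> are constrained. No completeness or right
  continuity of the filtration is assumed.\<close>

locale filtered_prob_space = prob_space M for M :: "'a measure" +
  fixes F :: "real \<Rightarrow> 'a measure"
  assumes subalgebra_F: "\<And>t. 0 \<le> t \<Longrightarrow> subalgebra M (F t)"
    and F_mono: "\<And>s t. 0 \<le> s \<Longrightarrow> s \<le> t \<Longrightarrow> sets (F s) \<subseteq> sets (F t)"

definition adapted :: "(real \<Rightarrow> 'a measure) \<Rightarrow> (real \<Rightarrow> 'a \<Rightarrow> real) \<Rightarrow> bool" where
  "adapted F X \<longleftrightarrow> (\<forall>t\<ge>0. X t \<in> borel_measurable (F t))"

definition progressively_measurable ::
    "(real \<Rightarrow> 'a measure) \<Rightarrow> (real \<Rightarrow> 'a \<Rightarrow> real) \<Rightarrow> bool" where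
  "progressively_measurable F X \<longleftrightarrow>
     (\<forall>t\<ge>0. (\<lambda>(s, \<omega>). X s \<omega>) \<in> borel_measurable (restrict_space borel {0..t} \<Otimes>\<^sub>M F t))"

text \<open>A standard Brownian motion relative to the filtration \<open>F\<close>: its increments after time \<open>s\<close>
  are independent of \<open>F s\<close>, not merely of the past of \<open>W\<close>.\<close>

locale standard_brownian_motion = filtered_prob_space M F
  for M :: "'a measure" and F :: "real \<Rightarrow> 'a measure" +
  fixes W :: "real \<Rightarrow> 'a \<Rightarrow> real"
  assumes adapted_W: "adapted F W"
    and W_0: "AE \<omega> in M. W 0 \<omega> = 0"
    and continuous_W: "AE \<omega> in M. continuous_on {0..} (\<lambda>t. W t \<omega>)"
    and normal_increments: "\<And>s t. 0 \<le> s \<Longrightarrow> s < t \<Longrightarrow>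
          distributed M lborel (\<lambda>\<omega>. W t \<omega> - W s \<omega>) (normal_density 0 (sqrt (t - s)))"
    and indep_increments: "\<And>s t. 0 \<le> s \<Longrightarrow> s < t \<Longrightarrow>
          indep_set (sets (F s)) {(\<lambda>\<omega>. W t \<omega> - W s \<omega>) -` B \<inter> space M | B. B \<in> sets borel}"


section \<open>The Ito integral\<close>

text \<open>The data \<open>n\<close>, \<open>p\<close>, \<open>\<xi>\<close> stand for the bounded simple integrand that equals \<open>\<xi> i\<close> on the
  time interval from \<open>p i\<close> (excluded) to \<open>p (Suc i)\<close> (included), for \<open>i < n\<close>, and vanishes
  elsewhere.\<close>

definition simple_integrand ::
    "'a measure \<Rightarrow> (real \<Rightarrow> 'a measure) \<Rightarrow> nat \<Rightarrow> (nat \<Rightarrow> real) \<Rightarrow> (nat \<Rightarrow> 'a \<Rightarrow> real) \<Rightarrow> bool" where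
  "simple_integrand M F n p \<xi> \<longleftrightarrow>
     0 \<le> p 0 \<and> (\<forall>i<n. p i < p (Suc i)) \<and>
     (\<forall>i<n. \<xi> i \<in> borel_measurable (F (p i)) \<and> (\<exists>B. \<forall>\<omega>\<in>space M. \<bar>\<xi> i \<omega>\<bar> \<le> B))"

definition simple_process ::
    "nat \<Rightarrow> (nat \<Rightarrow> real) \<Rightarrow> (nat \<Rightarrow> 'a \<Rightarrow> real) \<Rightarrow> real \<Rightarrow> 'a \<Rightarrow> real" where
  "simple_process n p \<xi> s \<omega> = (\<Sum>i<n. \<xi> i \<omega> * indicator {p i<..p (Suc i)} s)"

definition simple_ito_integral ::
    "(real \<Rightarrow> 'a \<Rightarrow> real) \<Rightarrow> nat \<Rightarrow> (nat \<Rightarrow> real) \<Rightarrow> (nat \<Rightarrow> 'a \<Rightarrow> real) \<Rightarrow> real \<Rightarrow> 'a \<Rightarrow> real" where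
  "simple_ito_integral W n p \<xi> t \<omega> =
     (\<Sum>i<n. \<xi> i \<omega> * (W (min t (p (Suc i))) \<omega> - W (min t (p i)) \<omega>))"

definition tendsto_in_probability ::
    "'a measure \<Rightarrow> (nat \<Rightarrow> 'a \<Rightarrow> real) \<Rightarrow> ('a \<Rightarrow> real) \<Rightarrow> bool" where
  "tendsto_in_probability M X Y \<longleftrightarrow>
     (\<forall>k. X k \<in> borel_measurable M) \<and> Y \<in> borel_measurable M \<and>
     (\<forall>e>0. (\<lambda>k. measure M {\<omega> \<in> space M. e < \<bar>X k \<omega> - Y \<omega>\<bar>}) \<longlonglongrightarrow> 0)"

text \<open>\<open>has_ito_integral M F W H t Y\<close> says that \<open>Y\<close> is (a version of) the Ito integral of \<open>H\<close>
  against \<open>W\<close> over \<open>{0..t}\<close>, for a progressively measurable \<open>H\<close> whose paths are almost surely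
  square integrable on \<open>{0..t}\<close>. This is the usual definition for integrands that need not have
  any finite moment: \<open>Y\<close> is the limit in probability of the integrals of simple integrands
  approximating \<open>H\<close> in probability in the pathwise \<open>L\<^sup>2\<close> norm. The limit depends on the choice of
  the approximating sequence only up to a null set.\<close>

definition has_ito_integral ::
    "'a measure \<Rightarrow> (real \<Rightarrow> 'a measure) \<Rightarrow> (real \<Rightarrow> 'a \<Rightarrow> real) \<Rightarrow> (real \<Rightarrow> 'a \<Rightarrow> real) \<Rightarrow>
      real \<Rightarrow> ('a \<Rightarrow> real) \<Rightarrow> bool" where
  "has_ito_integral M F W H t Y \<longleftrightarrow>
     progressively_measurable F H \<and>
     (AE \<omega> in M. set_integrable lborel {0..t} (\<lambda>s. (H s \<omega>)\<^sup>2)) \<and>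
     (\<exists>n p \<xi>.
        (\<forall>k. simple_integrand M F (n k) (p k) (\<xi> k)) \<and>
        tendsto_in_probability M
          (\<lambda>k \<omega>. LBINT s:{0..t}. (simple_process (n k) (p k) (\<xi> k) s \<omega> - H s \<omega>)\<^sup>2) (\<lambda>_. 0) \<and>
        tendsto_in_probability M (\<lambda>k. simple_ito_integral W (n k) (p k) (\<xi> k) t) Y)"


section \<open>Call prices and almost sure limits\<close>

text \<open>The strike \<open>K\<close> is a random variable, in order to allow a strike known only at time \<open>t0\<close>;
  a deterministic strike is a constant function. On the set where the conditional expectation of
  the payoff is infinite, \<open>real_cond_exp\<close> returns \<open>0\<close>.\<close>

definition call_price ::
    "'a measure \<Rightarrow> (real \<Rightarrow> 'a measure) \<Rightarrow> (real \<Rightarrow> real) \<Rightarrow> (real \<Rightarrow> 'a \<Rightarrow> real) \<Rightarrow>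
      real \<Rightarrow> real \<Rightarrow> ('a \<Rightarrow> real) \<Rightarrow> 'a \<Rightarrow> real" where
  "call_price M F r S t0 t K \<omega> =
     exp (- (LBINT s:{t0..t}. r s)) * real_cond_exp M (F t0) (\<lambda>\<omega>. max (S t \<omega> - K \<omega>) 0) \<omega>"

text \<open>Almost sure convergence of \<open>f t\<close> to \<open>l\<close> as \<open>t\<close> decreases to \<open>t0\<close>, where each \<open>f t\<close> is, like
  a conditional expectation, only determined up to a null set that depends on \<open>t\<close>. As \<open>t\<close> ranges
  over an uncountable set, the limit has to be taken along a suitable choice of versions \<open>g t\<close>.
  Equivalently, for every fixed sequence \<open>\<tau>\<close> decreasing to \<open>t0\<close>, \<open>f (\<tau> n)\<close> converges to \<open>l\<close>
  almost surely, for any choice of versions.\<close>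

definition as_tendsto_at_right ::
    "'a measure \<Rightarrow> (real \<Rightarrow> 'a \<Rightarrow> 'b::topological_space) \<Rightarrow> ('a \<Rightarrow> 'b) \<Rightarrow> real \<Rightarrow> bool" where
  "as_tendsto_at_right M f l t0 \<longleftrightarrow>
     (\<exists>g. (\<forall>t>t0. AE \<omega> in M. g t \<omega> = f t \<omega>) \<and>
          (AE \<omega> in M. ((\<lambda>t. g t \<omega>) \<longlongrightarrow> l \<omega>) (at_right t0)))"

end

theory Submission
  imports Defs
begin

text \<open>Let \<open>X\<close> be the discounted price divided by \<open>S\<close> at time \<open>t0\<close>, and \<open>B\<close> the increment of \<open>W\<close>
  over \<open>[t0, t]\<close>. No general Ito formula is needed: along uniform grids \<open>ln X\<close> is a sum of relative
  increments, up to their squares, and a second-moment inequality for simple integrands, truncated at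
  a bound on the energy, gives \<open>E \<bar>ln X - \<delta> B\<bar> = o(sqrt (t - t0))\<close> conditionally. Replacing
  \<open>(X - 1)\<^sup>+\<close> by \<open>(\<delta> B)\<^sup>+\<close> from below uses \<open>ln X \<le> X - 1\<close>; from above it
  uses in addition \<open>E X \<le> 1\<close>, the supermartingale property, obtained from the concave utilities
  \<open>m ln (1 + x / m)\<close> increasing to \<open>x\<close>. The Gaussian mean of \<open>(\<delta> B)\<^sup>+\<close> is
  \<open>\<delta> sqrt ((t - t0) / (2 \<pi>))\<close>.

  The hypothesis on \<open>\<delta>\<close> controls a family of conditional expectations that are only determined almost
  surely, uncountably many at once; essential suprema over \<open>(t0, t0 + 1/n]\<close> turn it into
  majorants that tend to \<open>0\<close>.\<close>

text \<open>Only conditional second moments of \<open>\<delta>\<close> near \<open>t0\<close> are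
  given, so every estimate is an inequality between nonnegative integrals over sets of
  \<open>F t0\<close>, and limits are taken by Fatou, which keeps upper bounds only. A bound on a
  square \<open>(w + J)^2\<close> still yields what is needed. With \<open>w = 0\<close> it controls
  \<open>\<bar>J\<bar> \<le> l + J^2 / l\<close>; taking \<open>l\<close> near
  \<open>sqrt (t - t0)\<close> times the conditional L2 deviation of \<open>\<delta>\<close> gives
  the order \<open>o (sqrt (t - t0))\<close>. With \<open>w = l\<close> constant,
  \<open>(l + J)^2 \<ge> l^2 + 2 l J\<close>, and \<open>l\<close> tending to infinity leaves a
  bound on the mean of \<open>J\<close>: this is how second moments give the supermartingale
  property. The obstacle in the upper estimate is that \<open>X - 1 - ln X\<close> is nonnegative
  without a direct upper bound. It is avoided by passing to the put:
  \<open>(X - 1)^+ = (X - 1) + (1 - X)^+\<close>, where the first term has mean at most 0 and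
  \<open>(1 - X)^+ \<le> (- ln X)^+\<close>. Since \<open>B\<close> is symmetric,
  \<open>(- \<delta> B)^+\<close> and \<open>(\<delta> B)^+\<close> have the same conditional mean,
  so the two estimates meet.\<close>

lemma ennreal_inverse_antimono: "x \<le> y \<Longrightarrow> inverse y \<le> inverse (x :: ennreal)"
  by (cases x rule: ennreal_cases; cases y rule: ennreal_cases; cases "x = 0"; cases "y = 0")
     (auto simp: inverse_ennreal ennreal_le_iff2 top_unique intro!: le_imp_inverse_le)

lemma ennreal_inverse_inject: "inverse x = inverse (y :: ennreal) \<Longrightarrow> x = y"
  by (cases x rule: ennreal_cases; cases y rule: ennreal_cases; cases "x = 0"; cases "y = 0")
     (auto simp: inverse_ennreal dest!: sym[of 0] sym[of top])

text \<open>The countable subfamily minimises the integral of a bounded decreasing function of its supremum.\<close>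

lemma ess_sup_family:
  fixes Y :: "'i \<Rightarrow> 'a \<Rightarrow> ennreal"
  assumes "prob_space M" and Y: "\<And>s. s \<in> I \<Longrightarrow> Y s \<in> borel_measurable M"
  shows "\<exists>D. countable D \<and> D \<subseteq> I \<and> (\<forall>s\<in>I. AE \<omega> in M. Y s \<omega> \<le> (SUP d\<in>D. Y d \<omega>))"
proof -
  interpret prob_space M by fact
  \<comment> \<open>The map from \<open>x\<close> to \<open>1 / (1 + x)\<close> is strictly
    decreasing on all of \<open>ennreal\<close>, with value 0 at \<open>top\<close>. So
    \<open>J D\<close> is finite without any integrability of \<open>Y\<close>, and equality of
    values can be undone even where the supremum is infinite.\<close>
  define J where "J D = (\<integral>\<^sup>+\<omega>. inverse (1 + (SUP d\<in>D. Y d \<omega>)) \<partial>M)" for D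
  let ?C = "{D. countable D \<and> D \<subseteq> I}"
  have J_anti: "J D' \<le> J D" if "D \<subseteq> D'" for D D'
    unfolding J_def by (intro nn_integral_mono ennreal_inverse_antimono add_left_mono SUP_subset_mono that order_refl)
  obtain f :: "nat \<Rightarrow> ennreal" where f: "range f \<subseteq> J ` ?C" "Inf (J ` ?C) = (INF i. f i)"
    using ennreal_Inf_countable_INF[of "J ` ?C"] by blast
  then have "\<forall>i. \<exists>D\<in>?C. f i = J D" by auto
  then obtain D where D: "\<And>i. D i \<in> ?C" "\<And>i. f i = J (D i)" by metis
  define E where "E = (\<Union>i. D i)"
  have E: "countable E" "E \<subseteq> I" using D(1) by (auto simp: E_def)
  have E_min: "J E \<le> J D'" if "D' \<in> ?C" for D'
  proof -
    have "J E \<le> (INF i. f i)" by (auto simp: D(2) E_def intro!: INF_greatest J_anti)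
    also have "\<dots> \<le> J D'" unfolding f(2)[symmetric] using that by (intro INF_lower) auto
    finally show ?thesis .
  qed
  have "AE \<omega> in M. Y s \<omega> \<le> (SUP d\<in>E. Y d \<omega>)" if s: "s \<in> I" for s
  proof -
    let ?E = "insert s E"
    let ?u = "\<lambda>D \<omega>. inverse (1 + (SUP d\<in>D. Y d \<omega>))"
    have meas: "?u D \<in> borel_measurable M" if "countable D" "D \<subseteq> I" for D
    proof -
      have "(\<lambda>\<omega>. SUP d\<in>D. Y d \<omega>) \<in> borel_measurable M"
        using that Y by (intro borel_measurable_SUP) auto
      then show ?thesis by measurable
    qed
    have m: "?u E \<in> borel_measurable M" "?u ?E \<in> borel_measurable M"
      using E s by (blast intro: meas countable_insert)+
    have le1: "?u D \<omega> \<le> 1" for D \<omega>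
      using ennreal_inverse_antimono[of 1 "1 + (SUP d\<in>D. Y d \<omega>)"] by simp
    have fin: "J E \<le> 1"
      unfolding J_def using nn_integral_mono[of M "?u E" "\<lambda>_. 1", OF le1] by (simp add: emeasure_space_1)
    have le: "?u ?E \<omega> \<le> ?u E \<omega>" for \<omega>
      by (intro ennreal_inverse_antimono add_left_mono SUP_subset_mono) auto
    have fin2: "(\<integral>\<^sup>+\<omega>. ?u ?E \<omega> \<partial>M) \<noteq> \<infinity>"
    proof -
      have "J ?E \<le> 1" using J_anti[of E ?E] fin by (blast intro: order_trans)
      then have "J ?E < top" by (rule le_less_trans) simp
      then show ?thesis unfolding J_def infinity_ennreal_def by (rule less_imp_neq)
    qed
    have "(\<integral>\<^sup>+\<omega>. ?u E \<omega> - ?u ?E \<omega> \<partial>M) = J E - J ?E"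
      unfolding J_def using fin2 le m by (intro nn_integral_diff) auto
    \<comment> \<open>Minimality of \<open>E\<close> means that adding \<open>s\<close> cannot lower
      the integral; ordered integrands with equal finite integrals agree almost surely.\<close>
    also have "\<dots> = 0" using E_min[of ?E] E s le_less_trans[OF fin, of top] by (simp add: diff_eq_0_iff_ennreal)
    finally have "AE \<omega> in M. ?u E \<omega> - ?u ?E \<omega> = 0"
      using m by (subst (asm) nn_integral_0_iff_AE) auto
    then show ?thesis
    proof eventually_elim
      case (elim \<omega>)
      have "?u E \<omega> = ?u ?E \<omega>" by (intro antisym[OF ennreal_minus_eq_0[OF elim] le[of \<omega>]])
      then have "1 + (SUP d\<in>E. Y d \<omega>) = 1 + (SUP d\<in>?E. Y d \<omega>)"
        by (rule ennreal_inverse_inject)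
      then have "(SUP d\<in>E. Y d \<omega>) = (SUP d\<in>?E. Y d \<omega>)" by (simp add: ennreal_add_left_cancel)
      then show ?case using SUP_upper[of s ?E "\<lambda>d. Y d \<omega>"] by simp
    qed
  qed
  then show ?thesis using E by blast
qed

section \<open>Gaussian moments\<close>

lemma normal_nn_second_moment:
  assumes "0 < \<sigma>"
  shows "(\<integral>\<^sup>+x. ennreal ((z + y * x)\<^sup>2) * ennreal (normal_density 0 \<sigma> x) \<partial>lborel) = ennreal (z\<^sup>2 + y\<^sup>2 * \<sigma>\<^sup>2)"
proof -
  have 0: "has_bochner_integral lborel (\<lambda>x. normal_density 0 \<sigma> x) 1"
    using assms by (simp add: has_bochner_integral_iff)
  have 1: "has_bochner_integral lborel (\<lambda>x. normal_density 0 \<sigma> x * x) 0"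
    using normal_moment_nz_1[OF assms, of 0] by simp
  have 2: "has_bochner_integral lborel (\<lambda>x. normal_density 0 \<sigma> x * x\<^sup>2) (\<sigma>\<^sup>2)"
    using normal_moment_even[OF assms, of 0 1] by (simp add: fact_numeral)
  have "has_bochner_integral lborel (\<lambda>x. z\<^sup>2 * normal_density 0 \<sigma> x + (2 * z * y) * (normal_density 0 \<sigma> x * x) + y\<^sup>2 * (normal_density 0 \<sigma> x * x\<^sup>2)) (z\<^sup>2 * 1 + (2 * z * y) * 0 + y\<^sup>2 * \<sigma>\<^sup>2)"
    by (intro has_bochner_integral_add has_bochner_integral_mult_right 0 1 2)
  then have "has_bochner_integral lborel (\<lambda>x. (z + y * x)\<^sup>2 * normal_density 0 \<sigma> x) (z\<^sup>2 + y\<^sup>2 * \<sigma>\<^sup>2)"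
    by (simp add: power2_sum algebra_simps power_mult_distrib)
  then have "(\<integral>\<^sup>+x. ennreal ((z + y * x)\<^sup>2 * normal_density 0 \<sigma> x) \<partial>lborel) = ennreal (z\<^sup>2 + y\<^sup>2 * \<sigma>\<^sup>2)"
    by (subst nn_integral_eq_integral) (auto simp: has_bochner_integral_iff)
  then show ?thesis by (simp add: ennreal_mult)
qed

text \<open>The positive part is half the sum of a linear term, of mean 0, and of an absolute value,
  of mean \<open>\<bar>y\<bar> * \<sigma> * sqrt (2 / pi)\<close>. Here the factor
  \<open>1 / sqrt (2 * pi)\<close> of the theorem arises; the result depends on
  \<open>\<bar>y\<bar>\<close> alone, so calls and puts get the same value.\<close>

lemma normal_nn_pos_part:
  assumes "0 < \<sigma>"
  shows "(\<integral>\<^sup>+x. ennreal (max (y * x) 0) * ennreal (normal_density 0 \<sigma> x) \<partial>lborel) = ennreal (\<bar>y\<bar> * \<sigma> / sqrt (2 * pi))"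
proof -
  have 1: "has_bochner_integral lborel (\<lambda>x. normal_density 0 \<sigma> x * x) 0"
    using normal_moment_nz_1[OF assms, of 0] by simp
  have 2: "has_bochner_integral lborel (\<lambda>x. normal_density 0 \<sigma> x * \<bar>x\<bar>) (\<sigma> * sqrt (2 / pi))"
    using normal_moment_abs_odd[OF assms, of 0 0] by (simp add: fact_numeral)
  have "has_bochner_integral lborel (\<lambda>x. (y / 2) * (normal_density 0 \<sigma> x * x) + (\<bar>y\<bar> / 2) * (normal_density 0 \<sigma> x * \<bar>x\<bar>)) ((y/2) * 0 + (\<bar>y\<bar> / 2) * (\<sigma> * sqrt (2 / pi)))"
    by (intro has_bochner_integral_add has_bochner_integral_mult_right 1 2)
  moreover have "(y / 2) * (normal_density 0 \<sigma> x * x) + (\<bar>y\<bar> / 2) * (normal_density 0 \<sigma> x * \<bar>x\<bar>)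
      = max (y * x) 0 * normal_density 0 \<sigma> x" for x
  proof -
    have "max (y * x) 0 = (y * x + \<bar>y\<bar> * \<bar>x\<bar>) / 2" by (simp flip: abs_mult)
    then have "2 * max (y * x) 0 = y * x + \<bar>y\<bar> * \<bar>x\<bar>" by simp
    then have "2 * max (y * x) 0 * normal_density 0 \<sigma> x = (y * x + \<bar>y\<bar> * \<bar>x\<bar>) * normal_density 0 \<sigma> x" by simp
    then show ?thesis by (simp add: algebra_simps)
  qed
  moreover have "(\<bar>y\<bar> / 2) * (\<sigma> * sqrt (2 / pi)) = \<bar>y\<bar> * \<sigma> / sqrt (2 * pi)"
    by (simp add: real_sqrt_mult real_sqrt_divide field_simps)
  ultimately have "has_bochner_integral lborel (\<lambda>x. max (y * x) 0 * normal_density 0 \<sigma> x) (\<bar>y\<bar> * \<sigma> / sqrt (2 * pi))"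
    by simp
  then have "(\<integral>\<^sup>+x. ennreal (max (y * x) 0 * normal_density 0 \<sigma> x) \<partial>lborel) = ennreal (\<bar>y\<bar> * \<sigma> / sqrt (2 * pi))"
    by (subst nn_integral_eq_integral) (auto simp: has_bochner_integral_iff)
  then show ?thesis by (simp add: ennreal_mult)
qed

section \<open>Increments of the Brownian motion\<close>

context standard_brownian_motion
begin

lemma F_imp_M: "0 \<le> t \<Longrightarrow> f \<in> F t \<rightarrow>\<^sub>M N \<Longrightarrow> f \<in> M \<rightarrow>\<^sub>M N"
  using measurable_from_subalg[OF subalgebra_F] .

lemma F_imp_F: "0 \<le> s \<Longrightarrow> s \<le> t \<Longrightarrow> f \<in> F s \<rightarrow>\<^sub>M N \<Longrightarrow> f \<in> F t \<rightarrow>\<^sub>M N"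
  using subalgebra_F[of s] subalgebra_F[of t] F_mono[of s t]
  by (auto simp: measurable_def subalgebra_def)

lemma W_F: "0 \<le> t \<Longrightarrow> W t \<in> borel_measurable (F t)"
  using adapted_W by (simp add: adapted_def)

lemma W_M [measurable]: "0 \<le> t \<Longrightarrow> W t \<in> borel_measurable M"
  using F_imp_M[OF _ W_F] .

text \<open>The identity, seen as a random variable with values in \<open>F s\<close>, is independent of the increment;
  thus every \<open>F s\<close>-measurable quantity can be frozen.\<close>

lemma nn_integral_increment:
  assumes "0 \<le> s" "s < t" and f: "f \<in> borel_measurable (F s \<Otimes>\<^sub>M borel)"
  shows "(\<integral>\<^sup>+\<omega>. f (\<omega>, W t \<omega> - W s \<omega>) \<partial>M) =
         (\<integral>\<^sup>+\<omega>. (\<integral>\<^sup>+x. f (\<omega>, x) * ennreal (normal_density 0 (sqrt (t - s)) x) \<partial>lborel) \<partial>M)"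
proof -
  let ?B = "\<lambda>\<omega>. W t \<omega> - W s \<omega>"
  have id: "(\<lambda>\<omega>. \<omega>) \<in> M \<rightarrow>\<^sub>M F s" by (rule F_imp_M[OF assms(1) measurable_ident_sets]) simp
  have B: "?B \<in> borel_measurable M" using assms by (intro borel_measurable_diff W_M) auto
  have sp: "space (F s) = space M"
    using subalgebra_F[OF assms(1)] by (auto simp: subalgebra_def)
  have d: "distr M lborel ?B = density lborel (normal_density 0 (sqrt (t - s)))"
    using normal_increments[OF assms(1,2)] by (simp add: distributed_def)
  have d': "distr M borel ?B = density lborel (normal_density 0 (sqrt (t - s)))"
    unfolding d[symmetric] by (rule distr_cong) auto
  interpret D1: prob_space "distr M (F s) (\<lambda>\<omega>. \<omega>)" by (rule prob_space_distr[OF id])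
  interpret D2: prob_space "distr M borel ?B" by (rule prob_space_distr[OF B])
  have pr: "(\<lambda>x. (x, ?B x)) \<in> M \<rightarrow>\<^sub>M (F s \<Otimes>\<^sub>M borel)" using id B by measurable
  have eq: "distr M (F s) (\<lambda>\<omega>. \<omega>) \<Otimes>\<^sub>M distr M borel ?B = distr M (F s \<Otimes>\<^sub>M borel) (\<lambda>x. (x, ?B x))"
  proof (rule pair_measure_eqI)
    fix A B assume "A \<in> sets (distr M (F s) (\<lambda>\<omega>. \<omega>))" "B \<in> sets (distr M borel ?B)"
    then have AB: "A \<in> sets (F s)" "B \<in> sets borel" by auto
    then have "A \<subseteq> space M" using sets.sets_into_space[of A "F s"] sp by simp
    then have "(\<lambda>\<omega>. \<omega>) -` A \<inter> space M = A"
      and "(\<lambda>x. (x, ?B x)) -` (A \<times> B) \<inter> space M = A \<inter> (?B -` B \<inter> space M)" by auto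
    moreover have "prob (A \<inter> (?B -` B \<inter> space M)) = prob A * prob (?B -` B \<inter> space M)"
      using AB by (intro indep_setD[OF indep_increments[OF assms(1,2)]]) auto
    ultimately show "emeasure (distr M (F s) (\<lambda>\<omega>. \<omega>)) A * emeasure (distr M borel ?B) B
        = emeasure (distr M (F s \<Otimes>\<^sub>M borel) (\<lambda>x. (x, ?B x))) (A \<times> B)"
      using AB by (simp add: emeasure_distr[OF id] emeasure_distr[OF B] emeasure_distr[OF pr] emeasure_eq_measure ennreal_mult)
  qed (auto simp: D1.sigma_finite_measure_axioms D2.sigma_finite_measure_axioms cong: sets_pair_measure_cong)
  have f': "f \<in> borel_measurable (distr M (F s) (\<lambda>\<omega>. \<omega>) \<Otimes>\<^sub>M distr M borel ?B)"
    using f by (simp cong: measurable_cong_sets)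
  have "(\<integral>\<^sup>+\<omega>. f (\<omega>, ?B \<omega>) \<partial>M) = (\<integral>\<^sup>+z. f z \<partial>distr M (F s \<Otimes>\<^sub>M borel) (\<lambda>x. (x, ?B x)))"
    using f by (subst nn_integral_distr[OF pr]) auto
  also have "\<dots> = (\<integral>\<^sup>+\<omega>. (\<integral>\<^sup>+x. f (\<omega>, x) \<partial>distr M borel ?B) \<partial>distr M (F s) (\<lambda>\<omega>. \<omega>))"
    unfolding eq[symmetric] using f' by (subst D2.nn_integral_fst[symmetric]) (simp_all)
  also have "\<dots> = (\<integral>\<^sup>+\<omega>. (\<integral>\<^sup>+x. f (\<omega>, x) \<partial>distr M borel ?B) \<partial>M)"
    using f' by (intro nn_integral_distr[OF id] D2.borel_measurable_nn_integral_fst)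
  also have "\<dots> = (\<integral>\<^sup>+\<omega>. (\<integral>\<^sup>+x. f (\<omega>, x) * ennreal (normal_density 0 (sqrt (t - s)) x) \<partial>lborel) \<partial>M)"
  proof (rule nn_integral_cong)
    fix \<omega> assume "\<omega> \<in> space M"
    then have [measurable]: "(\<lambda>x. f (\<omega>, x)) \<in> borel_measurable borel"
      using measurable_compose[OF measurable_Pair1' f] sp by simp
    show "(\<integral>\<^sup>+x. f (\<omega>, x) \<partial>distr M borel ?B) = (\<integral>\<^sup>+x. f (\<omega>, x) * ennreal (normal_density 0 (sqrt (t - s)) x) \<partial>lborel)"
      unfolding d' by (subst nn_integral_density) (auto simp: mult.commute)
  qed
  finally show ?thesis .
qed

text \<open>The cross term is integrated away against the Gaussian density while \<open>Z\<close>
  and \<open>Y\<close> are frozen, so both sides may be infinite. The case \<open>s = t\<close> is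
  included for grids with repeated points.\<close>

lemma nn_integral_add_increment:
  assumes "0 \<le> s" "s \<le> t" and Z: "Z \<in> borel_measurable (F s)" and Y: "Y \<in> borel_measurable (F s)"
  shows "(\<integral>\<^sup>+\<omega>. ennreal ((Z \<omega> + Y \<omega> * (W t \<omega> - W s \<omega>))\<^sup>2) \<partial>M) =
    (\<integral>\<^sup>+\<omega>. ennreal ((Z \<omega>)\<^sup>2) \<partial>M) + (\<integral>\<^sup>+\<omega>. ennreal ((Y \<omega>)\<^sup>2 * (t - s)) \<partial>M)"
proof (cases "s = t")
  case True then show ?thesis by simp
next
  case False
  then have "s < t" using assms by simp
  have [measurable]: "Z \<in> borel_measurable M" "Y \<in> borel_measurable M"
    using F_imp_M assms by auto
  have "(\<integral>\<^sup>+\<omega>. ennreal ((Z \<omega> + Y \<omega> * (W t \<omega> - W s \<omega>))\<^sup>2) \<partial>M) =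
     (\<integral>\<^sup>+\<omega>. (\<integral>\<^sup>+x. ennreal ((Z \<omega> + Y \<omega> * x)\<^sup>2) * ennreal (normal_density 0 (sqrt (t - s)) x) \<partial>lborel) \<partial>M)"
    using nn_integral_increment[OF assms(1) \<open>s < t\<close>, of "\<lambda>(\<omega>, x). ennreal ((Z \<omega> + Y \<omega> * x)\<^sup>2)"] Z Y by simp
  also have "\<dots> = (\<integral>\<^sup>+\<omega>. ennreal ((Z \<omega>)\<^sup>2) + ennreal ((Y \<omega>)\<^sup>2 * (t - s)) \<partial>M)"
    using \<open>s < t\<close> by (subst normal_nn_second_moment) auto
  also have "\<dots> = (\<integral>\<^sup>+\<omega>. ennreal ((Z \<omega>)\<^sup>2) \<partial>M) + (\<integral>\<^sup>+\<omega>. ennreal ((Y \<omega>)\<^sup>2 * (t - s)) \<partial>M)"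
    by (intro nn_integral_add) auto
  finally show ?thesis .
qed

text \<open>Tested against an arbitrary \<open>A\<close> of the past, the identity determines a
  conditional expectation given \<open>F s\<close>.\<close>

lemma nn_integral_pos_part_increment:
  assumes "0 \<le> s" "s < t" and Y: "Y \<in> borel_measurable (F s)" and A: "A \<in> sets (F s)"
  shows "(\<integral>\<^sup>+\<omega>. ennreal (max (Y \<omega> * (W t \<omega> - W s \<omega>)) 0) * indicator A \<omega> \<partial>M) =
    (\<integral>\<^sup>+\<omega>. ennreal (\<bar>Y \<omega>\<bar> * sqrt (t - s) / sqrt (2 * pi)) * indicator A \<omega> \<partial>M)"
proof -
  have [measurable]: "Y \<in> borel_measurable (F s)" "A \<in> sets (F s)" by fact+
  have "(\<integral>\<^sup>+\<omega>. ennreal (max (Y \<omega> * (W t \<omega> - W s \<omega>)) 0) * indicator A \<omega> \<partial>M) =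
     (\<integral>\<^sup>+\<omega>. (\<integral>\<^sup>+x. (ennreal (max (Y \<omega> * x) 0) * indicator A \<omega>) * ennreal (normal_density 0 (sqrt (t - s)) x) \<partial>lborel) \<partial>M)"
    using nn_integral_increment[OF assms(1,2), of "\<lambda>(\<omega>, x). ennreal (max (Y \<omega> * x) 0) * indicator A \<omega>"] by simp
  also have "\<dots> = (\<integral>\<^sup>+\<omega>. (\<integral>\<^sup>+x. ennreal (max (Y \<omega> * x) 0) * ennreal (normal_density 0 (sqrt (t - s)) x) \<partial>lborel) * indicator A \<omega> \<partial>M)"
    by (subst nn_integral_multc[symmetric]) (auto intro!: nn_integral_cong simp: mult_ac)
  also have "\<dots> = (\<integral>\<^sup>+\<omega>. ennreal (\<bar>Y \<omega>\<bar> * sqrt (t - s) / sqrt (2 * pi)) * indicator A \<omega> \<partial>M)"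
    using assms by (subst normal_nn_pos_part) auto
  finally show ?thesis .
qed

end

section \<open>Step functions and limits under truncation\<close>

lemma nn_integral_step:
  assumes "\<And>j. j < n \<Longrightarrow> p j \<le> p (Suc j)"
    and "\<And>j r. j < n \<Longrightarrow> p j < r \<Longrightarrow> r \<le> p (Suc j) \<Longrightarrow> f r = c j"
  shows "(\<integral>\<^sup>+r\<in>{p 0<..p n}. f r \<partial>lborel) = (\<Sum>j<n. c j * ennreal (p (Suc j) - p j))"
    and "(\<lambda>r. f r * indicator {p 0<..p n} r) \<in> borel_measurable borel"
    and "p 0 \<le> p n"
  \<comment> \<open>The three claims are proved together: \<open>f\<close> is constrained only on
    the cells, so its measurability there has to be carried along for the additivity of the
    integral, and the order of the end points for the splitting of the interval.\<close>
  using assms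
proof (induction n)
  case 0
  { case 1 then show ?case by simp }
  { case 2 then show ?case by simp }
  { case 3 then show ?case by simp }
next
  case (Suc n)
  { case 1
    note IH = Suc.IH[OF 1]
    have le: "p 0 \<le> p n" "p n \<le> p (Suc n)" using IH 1 by auto
    have m: "(\<lambda>r. f r * indicator {p 0<..p n} r) \<in> borel_measurable borel" using IH 1 by simp
    have i: "indicator {p 0<..p (Suc n)} r = (indicator {p 0<..p n} r + indicator {p n<..p (Suc n)} r :: ennreal)" for r
      using le by (auto simp: indicator_def)
    have e: "f r * indicator {p 0<..p (Suc n)} r = f r * indicator {p 0<..p n} r + c n * indicator {p n<..p (Suc n)} r" for r
      using 1(2)[of n r] unfolding i by (auto simp: indicator_def)
    show ?case unfolding e using m le IH(1) 1 by (subst nn_integral_add) (simp_all add: nn_integral_cmult_indicator) }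
  { case 2
    note IH = Suc.IH[OF 2]
    have le: "p 0 \<le> p n" "p n \<le> p (Suc n)" using IH 2 by auto
    have m: "(\<lambda>r. f r * indicator {p 0<..p n} r) \<in> borel_measurable borel" using IH 2 by simp
    have i: "indicator {p 0<..p (Suc n)} r = (indicator {p 0<..p n} r + indicator {p n<..p (Suc n)} r :: ennreal)" for r
      using le by (auto simp: indicator_def)
    have e: "f r * indicator {p 0<..p (Suc n)} r = f r * indicator {p 0<..p n} r + c n * indicator {p n<..p (Suc n)} r" for r
      using 2(2)[of n r] unfolding i by (auto simp: indicator_def)
    show ?case unfolding e using m by measurable }
  { case 3
    then show ?case using Suc.IH(3) by (meson less_Suc_eq order_trans) }
qed

lemma min_add_le_ennreal: "min (x + y) b \<le> min x b + min y (b :: ennreal)"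
proof -
  consider "x \<le> b" "y \<le> b" | "b \<le> x" | "b \<le> y" by (meson linear)
  then show ?thesis
  proof cases
    case 1 then show ?thesis by (simp add: min.absorb1)
  next
    case 2 then have "min (x + y) b \<le> min x b" by (simp add: min.absorb2)
    then show ?thesis by (rule order_trans) simp
  next
    case 3 then have "min (x + y) b \<le> min y b" by (simp add: min.absorb2)
    then show ?thesis by (rule order_trans) simp
  qed
qed

text \<open>\<open>Vk\<close> need not converge; it is bounded by \<open>V\<close> up to a vanishing
  excess. On the left, \<open>V < b\<close> is a strict inequality, so the cut-off is eventually
  inactive where it matters and Fatou applies. On the right, the excess is capped by
  \<open>b\<close> and vanishes by dominated convergence.\<close>

lemma Fatou_truncated_bound:
  fixes Z V :: "'a \<Rightarrow> ennreal" and C K b :: ennreal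
  assumes "prob_space M"
    and Zk: "\<And>k. Zk k \<in> borel_measurable M" and Vk: "\<And>k. Vk k \<in> borel_measurable M"
    and V: "V \<in> borel_measurable M"
    and "b < top" "K < top"
    and bound: "\<And>k. (\<integral>\<^sup>+\<omega>. (if Vk k \<omega> < b then Zk k \<omega> else 0) \<partial>M) \<le> C + K * (\<integral>\<^sup>+\<omega>. min (Vk k \<omega>) b \<partial>M)"
    and le_V: "AE \<omega> in M. \<exists>d. d \<longlonglongrightarrow> 0 \<and> (\<forall>\<^sub>F k in sequentially. Vk k \<omega> \<le> V \<omega> + d k)"
    and le_Z: "AE \<omega> in M. Z \<omega> \<le> liminf (\<lambda>k. Zk k \<omega>)"
  shows "(\<integral>\<^sup>+\<omega>. (if V \<omega> < b then Z \<omega> else 0) \<partial>M) \<le> C + K * (\<integral>\<^sup>+\<omega>. min (V \<omega>) b \<partial>M)"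
proof -
  interpret prob_space M by fact
  \<comment> \<open>\<open>top - top\<close> is \<open>top\<close> in \<open>ennreal\<close>, hence
    the separate case; where \<open>V\<close> is infinite, \<open>min (V \<omega>) b\<close> is
    already \<open>b\<close> and no correction is due.\<close>
  define G where "G k \<omega> = (if V \<omega> = top then 0 else min (Vk k \<omega> - V \<omega>) b)" for k \<omega>
  have G_meas [measurable]: "G k \<in> borel_measurable M" for k
  proof -
    have [measurable]: "Vk k \<in> borel_measurable M" "V \<in> borel_measurable M" using Vk V by auto
    show ?thesis unfolding G_def by measurable
  qed
  have G_le: "G k \<omega> \<le> b" for k \<omega> by (simp add: G_def)
  have "(\<lambda>k. \<integral>\<^sup>+\<omega>. G k \<omega> \<partial>M) \<longlonglongrightarrow> (\<integral>\<^sup>+\<omega>. 0 \<partial>M)"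
  proof (rule nn_integral_dominated_convergence[where w = "\<lambda>_. b"])
    show "(\<integral>\<^sup>+ \<omega>. b \<partial>M) < \<infinity>" using \<open>b < top\<close> by (simp add: emeasure_space_1)
    show "AE \<omega> in M. (\<lambda>k. G k \<omega>) \<longlonglongrightarrow> 0" using le_V
    proof eventually_elim
      case (elim \<omega>)
      then obtain d where d: "d \<longlonglongrightarrow> 0" "\<forall>\<^sub>F k in sequentially. Vk k \<omega> \<le> V \<omega> + d k" by blast
      show ?case
      proof (rule tendsto_sandwich[OF _ _ tendsto_const d(1)])
        show "\<forall>\<^sub>F k in sequentially. G k \<omega> \<le> d k"
          using d(2)
        proof eventually_elim
          case (elim k)
          then have "Vk k \<omega> - V \<omega> \<le> d k" if "V \<omega> \<noteq> top" using that by (simp add: ennreal_minus_le_iff)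
          then show ?case unfolding G_def by (auto intro: min.coboundedI1)
        qed
      qed auto
    qed
  qed (use V in \<open>auto simp: G_le intro: G_meas\<close>)
  then have G_lim: "(\<lambda>k. \<integral>\<^sup>+\<omega>. G k \<omega> \<partial>M) \<longlonglongrightarrow> 0" by simp
  have "(\<integral>\<^sup>+\<omega>. (if V \<omega> < b then Z \<omega> else 0) \<partial>M) \<le> (\<integral>\<^sup>+\<omega>. liminf (\<lambda>k. if Vk k \<omega> < b then Zk k \<omega> else 0) \<partial>M)"
  proof (rule nn_integral_mono_AE)
    show "AE \<omega> in M. (if V \<omega> < b then Z \<omega> else 0) \<le> liminf (\<lambda>k. if Vk k \<omega> < b then Zk k \<omega> else 0)"
      using le_V le_Z
    proof eventually_elim
      case (elim \<omega>)
      then obtain d where d: "d \<longlonglongrightarrow> 0" "\<forall>\<^sub>F k in sequentially. Vk k \<omega> \<le> V \<omega> + d k" by blast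
      show ?case
      proof (cases "V \<omega> < b")
        case True
        have "(\<lambda>k. V \<omega> + d k) \<longlonglongrightarrow> V \<omega> + 0" by (intro tendsto_add tendsto_const d(1))
        then have "\<forall>\<^sub>F k in sequentially. V \<omega> + d k < b" using True by (simp add: order_tendstoD)
        then have "\<forall>\<^sub>F k in sequentially. (if Vk k \<omega> < b then Zk k \<omega> else 0) = Zk k \<omega>"
          using d(2) by eventually_elim auto
        then have "liminf (\<lambda>k. if Vk k \<omega> < b then Zk k \<omega> else 0) = liminf (\<lambda>k. Zk k \<omega>)"
          by (rule Liminf_eq)
        then show ?thesis using elim(2) True by simp
      qed simp
    qed
  qed
  also have "\<dots> \<le> liminf (\<lambda>k. \<integral>\<^sup>+\<omega>. (if Vk k \<omega> < b then Zk k \<omega> else 0) \<partial>M)"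
  proof (intro nn_integral_liminf)
    fix k
    have [measurable]: "Vk k \<in> borel_measurable M" "Zk k \<in> borel_measurable M" using Vk Zk by auto
    show "(\<lambda>\<omega>. if Vk k \<omega> < b then Zk k \<omega> else 0) \<in> borel_measurable M" by measurable
  qed
  also have "\<dots> \<le> liminf (\<lambda>k. C + K * ((\<integral>\<^sup>+\<omega>. min (V \<omega>) b \<partial>M) + (\<integral>\<^sup>+\<omega>. G k \<omega> \<partial>M)))"
  proof (intro Liminf_mono always_eventually allI)
    fix k
    have "min (Vk k \<omega>) b \<le> min (V \<omega>) b + G k \<omega>" for \<omega>
    proof (cases "Vk k \<omega> \<le> V \<omega>")
      case True
      then have "min (Vk k \<omega>) b \<le> min (V \<omega>) b" by (rule min.mono) simp
      then show ?thesis by (rule order_trans) simp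
    next
      case False
      then have "Vk k \<omega> = V \<omega> + (Vk k \<omega> - V \<omega>)" by (simp add: add_diff_inverse_ennreal)
      moreover have "V \<omega> \<noteq> top" using False by auto
      ultimately obtain y where y: "Vk k \<omega> = V \<omega> + y" "G k \<omega> = min y b" unfolding G_def by metis
      show ?thesis unfolding y by (rule min_add_le_ennreal)
    qed
    then have "(\<integral>\<^sup>+\<omega>. min (Vk k \<omega>) b \<partial>M) \<le> (\<integral>\<^sup>+\<omega>. min (V \<omega>) b + G k \<omega> \<partial>M)"
      by (intro nn_integral_mono)
    also have "\<dots> = (\<integral>\<^sup>+\<omega>. min (V \<omega>) b \<partial>M) + (\<integral>\<^sup>+\<omega>. G k \<omega> \<partial>M)"
      using V by (intro nn_integral_add) auto
    finally show "(\<integral>\<^sup>+\<omega>. (if Vk k \<omega> < b then Zk k \<omega> else 0) \<partial>M) \<le> C + K * ((\<integral>\<^sup>+\<omega>. min (V \<omega>) b \<partial>M) + (\<integral>\<^sup>+\<omega>. G k \<omega> \<partial>M))"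
      by (intro order_trans[OF bound[of k]] add_left_mono mult_left_mono) auto
  qed
  also have "\<dots> = C + K * ((\<integral>\<^sup>+\<omega>. min (V \<omega>) b \<partial>M) + 0)"
    by (rule lim_imp_Liminf[OF trivial_limit_sequentially])
       (rule tendsto_add[OF tendsto_const ennreal_tendsto_cmult[OF \<open>K < top\<close> tendsto_add[OF tendsto_const G_lim]]])
  finally show ?thesis by simp
qed

section \<open>Simple integrands\<close>

text \<open>An element \<open>(s, u, \<xi>)\<close> stands for the integrand \<open>\<xi>\<close> on
  the interval from \<open>s\<close> (excluded) to \<open>u\<close> (included). Intervals in a list
  may overlap, so that addition is concatenation and a common refinement is needed only when second
  moments are computed.\<close>

type_synonym 'a elem = "real \<times> real \<times> ('a \<Rightarrow> real)"

definition elem_proc :: "'a elem list \<Rightarrow> real \<Rightarrow> 'a \<Rightarrow> real" where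
  "elem_proc xs r \<omega> = (\<Sum>(s, u, \<xi>)\<leftarrow>xs. \<xi> \<omega> * indicator {s<..u} r)"

definition elem_int :: "(real \<Rightarrow> 'a \<Rightarrow> real) \<Rightarrow> 'a elem list \<Rightarrow> 'a \<Rightarrow> real" where
  "elem_int W xs \<omega> = (\<Sum>(s, u, \<xi>)\<leftarrow>xs. \<xi> \<omega> * (W u \<omega> - W s \<omega>))"

text \<open>In contrast to \<open>simple_integrand\<close>, coefficients may be unbounded and
  \<open>s = u\<close> is allowed. This keeps the class stable under scaling by
  \<open>F a\<close>-measurable variables and under cutting at a time.\<close>

definition elem_adm :: "(real \<Rightarrow> 'a measure) \<Rightarrow> real \<Rightarrow> real \<Rightarrow> 'a elem list \<Rightarrow> bool" where
  "elem_adm F a t xs \<longleftrightarrow> (\<forall>(s, u, \<xi>)\<in>set xs. a \<le> s \<and> s \<le> u \<and> u \<le> t \<and> \<xi> \<in> borel_measurable (F s))"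

lemma elem_simps [simp]:
  "elem_proc [] r \<omega> = 0" "elem_int W [] \<omega> = 0" "elem_adm F a t []"
  "elem_proc ((s, u, \<xi>) # xs) r \<omega> = \<xi> \<omega> * indicator {s<..u} r + elem_proc xs r \<omega>"
  "elem_int W ((s, u, \<xi>) # xs) \<omega> = \<xi> \<omega> * (W u \<omega> - W s \<omega>) + elem_int W xs \<omega>"
  "elem_adm F a t ((s, u, \<xi>) # xs) \<longleftrightarrow> a \<le> s \<and> s \<le> u \<and> u \<le> t \<and> \<xi> \<in> borel_measurable (F s) \<and> elem_adm F a t xs"
  "elem_proc (xs @ ys) r \<omega> = elem_proc xs r \<omega> + elem_proc ys r \<omega>"
  "elem_int W (xs @ ys) \<omega> = elem_int W xs \<omega> + elem_int W ys \<omega>"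
  "elem_adm F a t (xs @ ys) \<longleftrightarrow> elem_adm F a t xs \<and> elem_adm F a t ys"
  by (simp_all add: elem_proc_def elem_int_def elem_adm_def ball_Un)

lemma elem_fun_simps:
  "elem_proc [] r = (\<lambda>_. 0)" "elem_int W [] = (\<lambda>_. 0)"
  "elem_proc ((s, u, \<xi>) # xs) r = (\<lambda>\<omega>. \<xi> \<omega> * indicator {s<..u} r + elem_proc xs r \<omega>)"
  "elem_int W ((s, u, \<xi>) # xs) = (\<lambda>\<omega>. \<xi> \<omega> * (W u \<omega> - W s \<omega>) + elem_int W xs \<omega>)"
  by (simp_all add: fun_eq_iff)

lemma elem_induct [case_names Nil Cons]:
  assumes "P []" "\<And>s u \<xi> xs. P xs \<Longrightarrow> P ((s, u, \<xi>) # xs)"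
  shows "P xs"
  using assms(1) by (induction xs) (auto intro: assms(2))

lemma elem_proc_borel [measurable]: "(\<lambda>r. elem_proc xs r \<omega>) \<in> borel_measurable borel"
  by (induction xs rule: elem_induct) auto

text \<open>A finite grid containing all endpoints turns overlapping summands into consecutive ones.\<close>

lemma finite_grid:
  fixes E :: "real set"
  assumes "finite E" "a \<in> E" "t \<in> E" "E \<subseteq> {a..t}"
  obtains p n where "E = p ` {..n}" "p 0 = a" "p n = t" "strict_mono_on {..n::nat} p"
proof -
  define L where "L = sorted_list_of_set E"
  have L: "sorted_wrt (<) L" "set L = E" using assms(1) by (auto simp: L_def)
  define n where "n = length L - 1"
  have len: "length L = Suc n" using L(2) assms(2) by (cases L) (auto simp: n_def)
  define p where "p = (!) L"
  have p: "strict_mono_on {..n} p"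
    using sorted_wrt_nth_less[OF L(1)] len by (auto simp: strict_mono_on_def p_def)
  have im: "E = p ` {..n}"
    unfolding L(2)[symmetric] p_def set_conv_nth len by (auto simp: less_Suc_eq_le)
  have mono: "p i \<le> p j" if "i \<le> j" "j \<le> n" for i j
    using that strict_mono_onD[OF p, of i j] by (cases "i = j") auto
  have "p 0 = a"
  proof -
    obtain k where "a = p k" "k \<le> n" using assms(2) im by auto
    then have "p 0 \<le> a" using mono[of 0 k] by simp
    moreover have "a \<le> p 0" using assms(4) im by auto
    ultimately show ?thesis by simp
  qed
  moreover have "p n = t"
  proof -
    obtain k where "t = p k" "k \<le> n" using assms(3) im by auto
    then have "t \<le> p n" using mono[of k n] by simp
    moreover have "p n \<le> t" using assms(4) im by auto
    ultimately show ?thesis by simp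
  qed
  ultimately show ?thesis using that im p by blast
qed

text \<open>Each cell lies entirely inside or entirely outside the interval from \<open>p k\<close>
  to \<open>p l\<close>, and its right end decides which, since intervals are open on the left and
  closed on the right.\<close>

lemma grid_telescope:
  fixes p :: "nat \<Rightarrow> real" and f :: "real \<Rightarrow> real"
  assumes p: "strict_mono_on {..n::nat} p" and "k \<le> l" "l \<le> n"
  shows "f (p l) - f (p k) = (\<Sum>j<n. indicator {p k<..p l} (p (Suc j)) * (f (p (Suc j)) - f (p j)))"
proof -
  have "indicator {p k<..p l} (p (Suc j)) = (if j \<in> {k..<l} then 1 else 0 :: real)" if "j < n" for j
  proof -
    have "p k < p (Suc j) \<longleftrightarrow> k < Suc j" "p (Suc j) \<le> p l \<longleftrightarrow> Suc j \<le> l"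
      using p assms that by (auto simp: strict_mono_on_less strict_mono_on_less_eq)
    then show ?thesis by (auto simp: indicator_def)
  qed
  then have "(\<Sum>j<n. indicator {p k<..p l} (p (Suc j)) * (f (p (Suc j)) - f (p j))) =
      (\<Sum>j<n. if j \<in> {k..<l} then f (p (Suc j)) - f (p j) else 0)"
    by (intro sum.cong) auto
  also have "\<dots> = (\<Sum>j\<in>{..<n} \<inter> {k..<l}. f (p (Suc j)) - f (p j))"
    by (simp add: sum.inter_restrict)
  also have "{..<n} \<inter> {k..<l} = {k..<l}" using assms by auto
  also have "(\<Sum>j\<in>{k..<l}. f (p (Suc j)) - f (p j)) = f (p l) - f (p k)"
    using sum_Suc_diff'[of k l "\<lambda>j. f (p j)"] assms by simp
  finally show ?thesis ..
qed

text \<open>The coefficient of a cell is read off at its right end, because the left end belongs to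
  the preceding cell.\<close>

lemma elem_on_grid:
  fixes p :: "nat \<Rightarrow> real"
  assumes p: "strict_mono_on {..n::nat} p" and E: "E = p ` {..n}"
    and "elem_adm F a t xs" "\<forall>(s, u, \<xi>)\<in>set xs. s \<in> E \<and> u \<in> E"
  shows "elem_int W xs \<omega> = (\<Sum>j<n. elem_proc xs (p (Suc j)) \<omega> * (W (p (Suc j)) \<omega> - W (p j) \<omega>))"
    and "\<And>j r. j < n \<Longrightarrow> p j < r \<Longrightarrow> r \<le> p (Suc j) \<Longrightarrow> elem_proc xs r \<omega> = elem_proc xs (p (Suc j)) \<omega>"
  using assms(3,4)
proof (induction xs rule: elem_induct)
  case Nil
  { case 1 then show ?case by simp }
  { case 2 then show ?case by simp }
next
  case (Cons s u \<xi> xs)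
  { case 1
    then have "s \<in> E" "u \<in> E" "s \<le> u" by auto
    then obtain k l where kl: "s = p k" "u = p l" "k \<le> n" "l \<le> n" using E by auto
    then have "k \<le> l" using \<open>s \<le> u\<close> p by (simp add: strict_mono_on_less_eq)
    have "W u \<omega> - W s \<omega> = (\<Sum>j<n. indicator {s<..u} (p (Suc j)) * (W (p (Suc j)) \<omega> - W (p j) \<omega>))"
      using grid_telescope[OF p \<open>k \<le> l\<close> \<open>l \<le> n\<close>, of "\<lambda>r. W r \<omega>"] kl by simp
    moreover have "elem_int W xs \<omega> = (\<Sum>j<n. elem_proc xs (p (Suc j)) \<omega> * (W (p (Suc j)) \<omega> - W (p j) \<omega>))"
      using Cons 1 by auto
    ultimately show ?case
      by (simp add: sum_distrib_left sum.distrib[symmetric] algebra_simps) }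
  { case 2
    then have "s \<in> E" "u \<in> E" "s \<le> u" by auto
    then obtain k l where kl: "s = p k" "u = p l" "k \<le> n" "l \<le> n" using E by auto
    have "p k < r \<longleftrightarrow> p k < p (Suc j)"
    proof -
      have "p k \<le> p j" if "p k < p (Suc j)"
        using that p kl 2 by (simp add: strict_mono_on_less strict_mono_on_less_eq less_Suc_eq_le)
      then show ?thesis using 2 by auto
    qed
    moreover have "r \<le> p l \<longleftrightarrow> p (Suc j) \<le> p l"
    proof -
      have "p (Suc j) \<le> p l" if "p j < p l"
        using that p kl 2 by (simp add: strict_mono_on_less strict_mono_on_less_eq)
      then show ?thesis using 2 by auto
    qed
    ultimately have "(indicator {s<..u} r :: real) = indicator {s<..u} (p (Suc j))"
      using kl by (simp add: indicator_def)
    moreover have "elem_proc xs r \<omega> = elem_proc xs (p (Suc j)) \<omega>"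
      by (rule Cons.IH(2)[OF 2(1-3)]) (use 2(4,5) in auto)
    ultimately show ?case by simp }
qed

section \<open>Truncated second moments of simple integrals\<close>

context standard_brownian_motion
begin

text \<open>The initial value \<open>w\<close> is known at \<open>p 0\<close> and orthogonal to all
  later increments, so it contributes exactly its own second moment. With \<open>w = 0\<close> the
  sum itself is bounded; a constant \<open>w\<close> makes the mean of the sum accessible through a
  square.\<close>

lemma grid_second_moment:
  fixes p :: "nat \<Rightarrow> real"
  assumes p: "0 \<le> p 0" "\<And>j. j < n \<Longrightarrow> p j \<le> p (Suc j)"
    and \<zeta>: "\<And>j. j < n \<Longrightarrow> \<zeta> j \<in> borel_measurable (F (p j))"
    and w: "w \<in> borel_measurable (F (p 0))" and "0 \<le> b"
  defines "V \<equiv> \<lambda>m \<omega>. \<Sum>j<m. (\<zeta> j \<omega>)\<^sup>2 * (p (Suc j) - p j)"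
  shows "(\<integral>\<^sup>+\<omega>. (if V n \<omega> < b then ennreal ((w \<omega> + (\<Sum>j<n. \<zeta> j \<omega> * (W (p (Suc j)) \<omega> - W (p j) \<omega>)))\<^sup>2) else 0) \<partial>M)
    \<le> (\<integral>\<^sup>+\<omega>. ennreal ((w \<omega>)\<^sup>2) \<partial>M) + (\<integral>\<^sup>+\<omega>. ennreal (min (V n \<omega>) b) \<partial>M)"
proof -
  \<comment> \<open>The integrand is switched off before its energy exceeds \<open>b\<close>; where \<open>V n < b\<close> nothing changes.\<close>
  define T where "T j \<omega> = (if V (Suc j) \<omega> \<le> b then \<zeta> j \<omega> else 0)" for j \<omega>
  define I where "I m \<omega> = w \<omega> + (\<Sum>j<m. T j \<omega> * (W (p (Suc j)) \<omega> - W (p j) \<omega>))" for m \<omega>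
  have pmono: "p i \<le> p j" if "i \<le> j" "j \<le> n" for i j
    using that(1,2) by (induction j rule: dec_induct) (use p(2) in \<open>auto intro: order_trans\<close>)
  have p0: "0 \<le> p j" if "j \<le> n" for j using pmono[of 0 j] that p(1) by simp
  have \<zeta>': "\<zeta> i \<in> borel_measurable (F (p j))" if "i \<le> j" "j < n" for i j
    using that p0 pmono by (intro F_imp_F[OF _ _ \<zeta>]) auto
  have w': "w \<in> borel_measurable (F (p j))" if "j \<le> n" for j
    using that pmono p(1) by (intro F_imp_F[OF _ _ w]) auto
  \<comment> \<open>The energy including cell \<open>j\<close> is already known at the left end
    \<open>p j\<close> of that cell, so the cut-off coefficient \<open>T j\<close> is still
    admissible. This does the work of a stopping time.\<close>
  have V': "V (Suc j) \<in> borel_measurable (F (p j))" if "j < n" for j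
    unfolding V_def using that by (intro borel_measurable_sum borel_measurable_times borel_measurable_power \<zeta>') auto
  have T': "T j \<in> borel_measurable (F (p j))" if "j < n" for j
  proof -
    have [measurable]: "V (Suc j) \<in> borel_measurable (F (p j))" "\<zeta> j \<in> borel_measurable (F (p j))"
      using V' \<zeta> that by auto
    show ?thesis unfolding T_def by measurable
  qed
  have TW: "(\<lambda>\<omega>. T j \<omega> * (W (p (Suc j)) \<omega> - W (p j) \<omega>)) \<in> borel_measurable (F (p i))" if "j < i" "i \<le> n" for i j
    using that p0 pmono
    by (intro borel_measurable_times borel_measurable_diff F_imp_F[OF _ _ T'] F_imp_F[OF _ _ W_F]) auto
  have I': "I m \<in> borel_measurable (F (p m))" if "m \<le> n" for m
    unfolding I_def using that by (intro borel_measurable_add borel_measurable_sum w' TW) auto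
  have second: "(\<integral>\<^sup>+\<omega>. ennreal ((I m \<omega>)\<^sup>2) \<partial>M) =
      (\<integral>\<^sup>+\<omega>. ennreal ((w \<omega>)\<^sup>2) \<partial>M) + (\<integral>\<^sup>+\<omega>. ennreal (\<Sum>j<m. (T j \<omega>)\<^sup>2 * (p (Suc j) - p j)) \<partial>M)"
    if "m \<le> n" for m
    using that
  proof (induction m)
    case 0 then show ?case by (simp add: I_def)
  next
    case (Suc m)
    then have m: "m < n" by simp
    have TM [measurable]: "T j \<in> borel_measurable M" if "j \<le> m" for j
      using F_imp_M[OF p0 T', of j] that m by auto
    have pos: "0 \<le> (\<Sum>j<m. (T j \<omega>)\<^sup>2 * (p (Suc j) - p j))" for \<omega>
      using p(2) m by (intro sum_nonneg mult_nonneg_nonneg) (auto simp: diff_ge_0_iff_ge)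
    have "(\<integral>\<^sup>+\<omega>. ennreal ((I (Suc m) \<omega>)\<^sup>2) \<partial>M) =
        (\<integral>\<^sup>+\<omega>. ennreal ((I m \<omega> + T m \<omega> * (W (p (Suc m)) \<omega> - W (p m) \<omega>))\<^sup>2) \<partial>M)"
      by (simp add: I_def add.assoc)
    also have "\<dots> = (\<integral>\<^sup>+\<omega>. ennreal ((I m \<omega>)\<^sup>2) \<partial>M) + (\<integral>\<^sup>+\<omega>. ennreal ((T m \<omega>)\<^sup>2 * (p (Suc m) - p m)) \<partial>M)"
      using m p0 p(2) I' T' by (intro nn_integral_add_increment) auto
    also have "\<dots> = (\<integral>\<^sup>+\<omega>. ennreal ((w \<omega>)\<^sup>2) \<partial>M) + ((\<integral>\<^sup>+\<omega>. ennreal (\<Sum>j<m. (T j \<omega>)\<^sup>2 * (p (Suc j) - p j)) \<partial>M)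
        + (\<integral>\<^sup>+\<omega>. ennreal ((T m \<omega>)\<^sup>2 * (p (Suc m) - p m)) \<partial>M))"
      using Suc by (simp add: add.assoc)
    also have "(\<integral>\<^sup>+\<omega>. ennreal (\<Sum>j<m. (T j \<omega>)\<^sup>2 * (p (Suc j) - p j)) \<partial>M)
        + (\<integral>\<^sup>+\<omega>. ennreal ((T m \<omega>)\<^sup>2 * (p (Suc m) - p m)) \<partial>M) =
        (\<integral>\<^sup>+\<omega>. ennreal (\<Sum>j<m. (T j \<omega>)\<^sup>2 * (p (Suc j) - p j)) + ennreal ((T m \<omega>)\<^sup>2 * (p (Suc m) - p m)) \<partial>M)"
      using TM by (intro nn_integral_add[symmetric] measurable_compose[OF _ measurable_ennreal] borel_measurable_sum
          borel_measurable_times borel_measurable_power) auto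
    also have "\<dots> = (\<integral>\<^sup>+\<omega>. ennreal (\<Sum>j<Suc m. (T j \<omega>)\<^sup>2 * (p (Suc j) - p j)) \<partial>M)"
      using p(2)[OF m] pos by (intro nn_integral_cong) (simp flip: ennreal_plus)
    finally show ?case .
  qed
  have sum_le: "(\<Sum>j<m. (T j \<omega>)\<^sup>2 * (p (Suc j) - p j)) \<le> min (V m \<omega>) b" if "m \<le> n" for m \<omega>
    using that
  proof (induction m)
    case 0 then show ?case using \<open>0 \<le> b\<close> by (simp add: V_def)
  next
    case (Suc m)
    have "V m \<omega> \<le> V (Suc m) \<omega>" using p(2)[of m] Suc(2) by (simp add: V_def)
    moreover have "V (Suc m) \<omega> = V m \<omega> + (\<zeta> m \<omega>)\<^sup>2 * (p (Suc m) - p m)" by (simp add: V_def)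
    ultimately show ?case using Suc by (auto simp: T_def min_def split: if_splits)
  qed
  have "T j \<omega> = \<zeta> j \<omega>" if "V n \<omega> < b" "j < n" for j \<omega>
  proof -
    have "V (Suc j) \<omega> \<le> V n \<omega>"
      unfolding V_def using that p(2) by (intro sum_mono2) (auto intro!: mult_nonneg_nonneg)
    then show ?thesis using that by (simp add: T_def)
  qed
  then have "(\<integral>\<^sup>+\<omega>. (if V n \<omega> < b then ennreal ((w \<omega> + (\<Sum>j<n. \<zeta> j \<omega> * (W (p (Suc j)) \<omega> - W (p j) \<omega>)))\<^sup>2) else 0) \<partial>M)
      \<le> (\<integral>\<^sup>+\<omega>. ennreal ((I n \<omega>)\<^sup>2) \<partial>M)"
    by (intro nn_integral_mono) (simp add: I_def)
  also have "\<dots> \<le> (\<integral>\<^sup>+\<omega>. ennreal ((w \<omega>)\<^sup>2) \<partial>M) + (\<integral>\<^sup>+\<omega>. ennreal (min (V n \<omega>) b) \<partial>M)"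
    unfolding second[OF order_refl] using sum_le by (intro add_left_mono nn_integral_mono ennreal_leI) auto
  finally show ?thesis .
qed

lemma elem_int_measurable:
  "0 \<le> a \<Longrightarrow> elem_adm F a t xs \<Longrightarrow> elem_int W xs \<in> borel_measurable M"
proof (induction xs rule: elem_induct)
  case (Cons s u \<xi> xs)
  then have "\<xi> \<in> borel_measurable M" "W u \<in> borel_measurable M" "W s \<in> borel_measurable M"
    using F_imp_M[of s \<xi> borel] by (auto intro!: W_M)
  then show ?case using Cons unfolding elem_fun_simps by (intro borel_measurable_add borel_measurable_times borel_measurable_diff) auto
qed (simp add: elem_fun_simps)

lemma elem_proc_measurable:
  assumes "0 \<le> a" "elem_adm F a t xs"
  shows "(\<lambda>(\<omega>, r). elem_proc xs r \<omega>) \<in> borel_measurable (M \<Otimes>\<^sub>M borel)"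
  using assms(2)
proof (induction xs rule: elem_induct)
  case (Cons s u \<xi> xs)
  then have [measurable]: "\<xi> \<in> borel_measurable M" using F_imp_M[of s \<xi> borel] assms by auto
  have [measurable]: "(\<lambda>(\<omega>, r). elem_proc xs r \<omega>) \<in> borel_measurable (M \<Otimes>\<^sub>M borel)" using Cons by simp
  have "(\<lambda>(\<omega>, r). \<xi> \<omega> * indicator {s<..u} r + elem_proc xs r \<omega>) \<in> borel_measurable (M \<Otimes>\<^sub>M borel)"
    unfolding indicator_def greaterThanAtMost_iff by measurable
  then show ?case by simp
qed simp

lemma elem_energy_measurable:
  assumes "0 \<le> a" "elem_adm F a t xs"
  shows "(\<lambda>\<omega>. \<integral>\<^sup>+r\<in>{a<..t}. ennreal ((elem_proc xs r \<omega>)\<^sup>2) \<partial>lborel) \<in> borel_measurable M"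
proof -
  have [measurable]: "(\<lambda>(\<omega>, r). elem_proc xs r \<omega>) \<in> borel_measurable (M \<Otimes>\<^sub>M borel)"
    using elem_proc_measurable[OF assms] .
  have "(\<lambda>(\<omega>, r). ennreal ((elem_proc xs r \<omega>)\<^sup>2) * indicator {a<..t} r) \<in> borel_measurable (M \<Otimes>\<^sub>M lborel)"
    by measurable
  from lborel.borel_measurable_nn_integral[OF this] show ?thesis by simp
qed

text \<open>On the grid of all end points the energy is a finite sum, which carries the inequality
  for consecutive cells over to overlapping elements.\<close>

lemma elem_second_moment:
  assumes "0 \<le> a" "a \<le> t" and xs: "elem_adm F a t xs" and w: "w \<in> borel_measurable (F a)" and "0 \<le> b"
  defines "V \<equiv> \<lambda>\<omega>. \<integral>\<^sup>+r\<in>{a<..t}. ennreal ((elem_proc xs r \<omega>)\<^sup>2) \<partial>lborel"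
  shows "(\<integral>\<^sup>+\<omega>. (if V \<omega> < ennreal b then ennreal ((w \<omega> + elem_int W xs \<omega>)\<^sup>2) else 0) \<partial>M)
    \<le> (\<integral>\<^sup>+\<omega>. ennreal ((w \<omega>)\<^sup>2) \<partial>M) + (\<integral>\<^sup>+\<omega>. min (V \<omega>) (ennreal b) \<partial>M)"
proof -
  define E where "E = insert a (insert t (fst ` set xs \<union> (fst \<circ> snd) ` set xs))"
  have E: "finite E" "a \<in> E" "t \<in> E" "E \<subseteq> {a..t}"
    using assms(2) xs by (force simp: E_def elem_adm_def)+
  then obtain p and n :: nat where p: "E = p ` {..n}" "p 0 = a" "p n = t" "strict_mono_on {..n} p"
    by (rule finite_grid)
  have mono: "p j \<le> p (Suc j)" if "j < n" for j
    using strict_mono_onD[OF p(4), of j "Suc j"] that by auto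
  have "\<forall>(s, u, \<xi>)\<in>set xs. s \<in> E \<and> u \<in> E" by (force simp: E_def)
  note grid = elem_on_grid[OF p(4,1) xs this]
  \<comment> \<open>An element that is active at \<open>p (Suc j)\<close> starts at a grid point
    before \<open>p (Suc j)\<close>, hence at or before \<open>p j\<close>; its coefficient is
    therefore known at \<open>p j\<close>.\<close>
  have \<zeta>: "elem_proc xs (p (Suc j)) \<in> borel_measurable (F (p j))" if j: "j < n" for j
  proof -
    have "\<forall>(s, u, \<xi>)\<in>set xs. s \<in> E" by (force simp: E_def)
    with xs show ?thesis
    proof (induction xs rule: elem_induct)
      case (Cons s u \<xi> xs)
      then obtain k where k: "s = p k" "k \<le> n" using p(1) by auto
      have "(\<lambda>\<omega>. \<xi> \<omega> * indicator {s<..u} (p (Suc j))) \<in> borel_measurable (F (p j))"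
      proof (cases "s < p (Suc j)")
        case True
        then have "s \<le> p j"
          using k p(4) j by (simp add: strict_mono_on_less strict_mono_on_less_eq less_Suc_eq_le)
        then show ?thesis using Cons assms(1) by (intro borel_measurable_times F_imp_F[of s "p j" \<xi>]) auto
      qed simp
      then show ?case using Cons unfolding elem_fun_simps by (intro borel_measurable_add) auto
    qed (simp add: elem_fun_simps)
  qed
  have V: "V \<omega> = ennreal (\<Sum>j<n. (elem_proc xs (p (Suc j)) \<omega>)\<^sup>2 * (p (Suc j) - p j))" for \<omega>
  proof -
    have "V \<omega> = (\<Sum>j<n. ennreal ((elem_proc xs (p (Suc j)) \<omega>)\<^sup>2) * ennreal (p (Suc j) - p j))"
      unfolding V_def p(2)[symmetric] p(3)[symmetric]
    proof (rule nn_integral_step(1))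
      fix j r assume "j < n" "p j < r" "r \<le> p (Suc j)"
      then show "ennreal ((elem_proc xs r \<omega>)\<^sup>2) = ennreal ((elem_proc xs (p (Suc j)) \<omega>)\<^sup>2)"
        by (subst grid(2)[of j r]) auto
    qed (rule mono)
    also have "\<dots> = (\<Sum>j<n. ennreal ((elem_proc xs (p (Suc j)) \<omega>)\<^sup>2 * (p (Suc j) - p j)))"
      by (intro sum.cong) (auto simp: ennreal_mult' mono)
    also have "\<dots> = ennreal (\<Sum>j<n. (elem_proc xs (p (Suc j)) \<omega>)\<^sup>2 * (p (Suc j) - p j))"
      using mono by (intro sum_ennreal) (auto intro!: mult_nonneg_nonneg)
    finally show ?thesis .
  qed
  have lt: "V \<omega> < ennreal b \<longleftrightarrow> (\<Sum>j<n. (elem_proc xs (p (Suc j)) \<omega>)\<^sup>2 * (p (Suc j) - p j)) < b" for \<omega>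
    unfolding V using mono by (intro ennreal_less_iff sum_nonneg mult_nonneg_nonneg) auto
  have mn: "min (V \<omega>) (ennreal b) = ennreal (min (\<Sum>j<n. (elem_proc xs (p (Suc j)) \<omega>)\<^sup>2 * (p (Suc j) - p j)) b)" for \<omega>
    unfolding V by (intro min_of_mono monoI ennreal_leI)
  show ?thesis
    unfolding lt mn grid(1)
    using p(2) assms(1,5) w mono \<zeta> by (intro grid_second_moment) auto
qed

end

lemma ennreal_tendsto_0_le:
  fixes f g :: "nat \<Rightarrow> ennreal"
  assumes "g \<longlonglongrightarrow> 0" "\<And>k. f k \<le> g k"
  shows "f \<longlonglongrightarrow> 0"
  using assms(2) by (intro tendsto_sandwich[OF _ _ tendsto_const assms(1)]) auto

section \<open>Pairs of an integrand and its integral\<close>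

text \<open>Valued in \<open>ennreal\<close>, so that no square integrability is presupposed; the
  left end is excluded to match the intervals of the elements.\<close>

definition energy :: "real \<Rightarrow> real \<Rightarrow> (real \<Rightarrow> real) \<Rightarrow> ennreal" where
  "energy a t f = (\<integral>\<^sup>+r\<in>{a<..t}. ennreal ((f r)\<^sup>2) \<partial>lborel)"

lemma energy_cong: "(\<And>r. a < r \<Longrightarrow> r \<le> t \<Longrightarrow> (f r)\<^sup>2 = (g r)\<^sup>2) \<Longrightarrow> energy a t f = energy a t g"
  unfolding energy_def by (intro nn_integral_cong) (auto simp: indicator_def)

lemma energy_mono: "(\<And>r. a < r \<Longrightarrow> r \<le> t \<Longrightarrow> (f r)\<^sup>2 \<le> (g r)\<^sup>2) \<Longrightarrow> energy a t f \<le> energy a t g"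
  unfolding energy_def by (intro nn_integral_mono) (auto simp: indicator_def intro: ennreal_leI)

lemma energy_interval_mono: "a \<le> s \<Longrightarrow> u \<le> t \<Longrightarrow> energy s u f \<le> energy a t f"
  unfolding energy_def by (intro nn_integral_mono) (auto simp: indicator_def)

lemma energy_scale: "f \<in> borel_measurable borel \<Longrightarrow> energy a t (\<lambda>r. c * f r) = ennreal (c\<^sup>2) * energy a t f"
  unfolding energy_def by (subst nn_integral_cmult[symmetric])
    (auto simp: power_mult_distrib ennreal_mult' mult.assoc intro!: nn_integral_cong)

text \<open>Stands in for the triangle inequality in L2; the factors 2 and 4 in front of later
  energies come from here.\<close>

lemma energy_le_sum:
  assumes [measurable]: "f \<in> borel_measurable borel" "g \<in> borel_measurable borel"
    and "\<And>r. a < r \<Longrightarrow> r \<le> t \<Longrightarrow> (h r)\<^sup>2 \<le> 2 * (f r)\<^sup>2 + 2 * (g r)\<^sup>2"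
  shows "energy a t h \<le> 2 * energy a t f + 2 * energy a t g"
proof -
  have "energy a t h \<le> (\<integral>\<^sup>+r. 2 * (ennreal ((f r)\<^sup>2) * indicator {a<..t} r) + 2 * (ennreal ((g r)\<^sup>2) * indicator {a<..t} r) \<partial>lborel)"
    unfolding energy_def
  proof (intro nn_integral_mono)
    fix r
    have "ennreal ((h r)\<^sup>2) \<le> 2 * ennreal ((f r)\<^sup>2) + 2 * ennreal ((g r)\<^sup>2)" if "a < r" "r \<le> t"
    proof -
      have "ennreal ((h r)\<^sup>2) \<le> ennreal (2 * (f r)\<^sup>2 + 2 * (g r)\<^sup>2)"
        using assms(3) that by (intro ennreal_leI) auto
      then show ?thesis by (simp add: ennreal_plus ennreal_mult')
    qed
    then show "ennreal ((h r)\<^sup>2) * indicator {a<..t} r \<le> 2 * (ennreal ((f r)\<^sup>2) * indicator {a<..t} r) + 2 * (ennreal ((g r)\<^sup>2) * indicator {a<..t} r)"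
      by (auto simp: indicator_def)
  qed
  also have "\<dots> = 2 * energy a t f + 2 * energy a t g"
    unfolding energy_def by (simp add: nn_integral_add nn_integral_cmult)
  finally show ?thesis .
qed

lemma power2_add_le: "(x + y)\<^sup>2 \<le> 2 * x\<^sup>2 + 2 * (y :: real)\<^sup>2"
  using zero_le_power2[of "x - y"] unfolding power2_sum power2_diff by linarith

text \<open>The approximants converge almost surely, in energy and in integral, rather than in
  probability: this is the form to which Fatou applies. The interval starts at an arbitrary
  \<open>a\<close>, so that coefficients known at \<open>a\<close> can be pulled out.\<close>

definition ito_pair ::
    "'a measure \<Rightarrow> (real \<Rightarrow> 'a measure) \<Rightarrow> (real \<Rightarrow> 'a \<Rightarrow> real) \<Rightarrow> real \<Rightarrow> real \<Rightarrow>
      (real \<Rightarrow> 'a \<Rightarrow> real) \<Rightarrow> ('a \<Rightarrow> real) \<Rightarrow> bool" where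
  "ito_pair M F W a t D J \<longleftrightarrow>
     (\<forall>\<omega>\<in>space M. (\<lambda>r. D r \<omega>) \<in> borel_measurable borel) \<and>
     (\<exists>xs. (\<forall>k. elem_adm F a t (xs k)) \<and>
       (AE \<omega> in M. (\<lambda>k. energy a t (\<lambda>r. elem_proc (xs k) r \<omega> - D r \<omega>)) \<longlonglongrightarrow> 0 \<and>
          (\<lambda>k. elem_int W (xs k) \<omega>) \<longlonglongrightarrow> J \<omega>))"

lemma ito_pairI:
  assumes "\<And>\<omega>. \<omega> \<in> space M \<Longrightarrow> (\<lambda>r. D r \<omega>) \<in> borel_measurable borel" "\<And>k. elem_adm F a t (xs k)"
    and "AE \<omega> in M. (\<lambda>k. energy a t (\<lambda>r. elem_proc (xs k) r \<omega> - D r \<omega>)) \<longlonglongrightarrow> 0 \<and>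
          (\<lambda>k. elem_int W (xs k) \<omega>) \<longlonglongrightarrow> J \<omega>"
  shows "ito_pair M F W a t D J"
  using assms unfolding ito_pair_def by blast

definition elem_scale :: "('a \<Rightarrow> real) \<Rightarrow> 'a elem list \<Rightarrow> 'a elem list" where
  "elem_scale c = map (\<lambda>(s, u, \<xi>). (s, u, \<lambda>\<omega>. c \<omega> * \<xi> \<omega>))"

text \<open>An element that starts at or after \<open>v\<close> collapses to the point
  \<open>v\<close>. Its coefficient is replaced by 0 because it need not be measurable with respect
  to \<open>F v\<close>.\<close>

definition elem_before :: "real \<Rightarrow> 'a elem list \<Rightarrow> 'a elem list" where
  "elem_before v = map (\<lambda>(s, u, \<xi>). (min v s, min v u, if s < v then \<xi> else (\<lambda>_. 0)))"

definition elem_after :: "real \<Rightarrow> 'a elem list \<Rightarrow> 'a elem list" where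
  "elem_after v = map (\<lambda>(s, u, \<xi>). (max v s, max v u, \<xi>))"

lemma elem_op_simps [simp]:
  "elem_scale c [] = []" "elem_before v [] = []" "elem_after v [] = []"
  "elem_scale c ((s, u, \<xi>) # xs) = (s, u, \<lambda>\<omega>. c \<omega> * \<xi> \<omega>) # elem_scale c xs"
  "elem_before v ((s, u, \<xi>) # xs) = (min v s, min v u, if s < v then \<xi> else (\<lambda>_. 0)) # elem_before v xs"
  "elem_after v ((s, u, \<xi>) # xs) = (max v s, max v u, \<xi>) # elem_after v xs"
  by (simp_all add: elem_scale_def elem_before_def elem_after_def)

lemma elem_scale_proc: "elem_proc (elem_scale c xs) r \<omega> = c \<omega> * elem_proc xs r \<omega>"
  by (induction xs rule: elem_induct) (auto simp: algebra_simps)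

lemma elem_scale_int: "elem_int W (elem_scale c xs) \<omega> = c \<omega> * elem_int W xs \<omega>"
  by (induction xs rule: elem_induct) (auto simp: algebra_simps)

lemma elem_before_proc: "r \<le> v \<Longrightarrow> elem_proc (elem_before v xs) r \<omega> = elem_proc xs r \<omega>"
  by (induction xs rule: elem_induct) (auto simp: indicator_def)

lemma elem_after_proc: "v < r \<Longrightarrow> elem_proc (elem_after v xs) r \<omega> = elem_proc xs r \<omega>"
  by (induction xs rule: elem_induct) (auto simp: indicator_def)

lemma elem_before_after_int:
  assumes "elem_adm F a t xs"
  shows "elem_int W (elem_before v xs) \<omega> + elem_int W (elem_after v xs) \<omega> = elem_int W xs \<omega>"
  using assms by (induction xs rule: elem_induct) (auto simp: algebra_simps min_def max_def)

lemma elem_proc_outside: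
  assumes "elem_adm F a t xs" "r \<le> a \<or> t < r"
  shows "elem_proc xs r \<omega> = 0"
  using assms by (induction xs rule: elem_induct) (auto simp: indicator_def)

lemma tendsto_in_probability_subseq:
  assumes "tendsto_in_probability M X Y" "strict_mono \<rho>"
  shows "tendsto_in_probability M (\<lambda>k. X (\<rho> k)) Y"
  using assms(1) LIMSEQ_subseq_LIMSEQ[OF _ assms(2)] unfolding tendsto_in_probability_def o_def by blast

section \<open>Almost surely convergent subsequences\<close>

context prob_space
begin

text \<open>The distance capped at 1 is bounded, so convergence in probability becomes convergence
  in L1, which has an almost surely convergent subsequence; once the capped distance is below 1, the
  cap is inactive.\<close>

lemma tendsto_in_probability_AE_subseq:
  assumes "tendsto_in_probability M X Y"
  shows "\<exists>\<rho>. strict_mono \<rho> \<and> (AE \<omega> in M. (\<lambda>k. X (\<rho> k) \<omega>) \<longlonglongrightarrow> Y \<omega>)"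
proof -
  have [measurable]: "X k \<in> borel_measurable M" "Y \<in> borel_measurable M" for k
    using assms by (auto simp: tendsto_in_probability_def)
  define u where "u k \<omega> = min \<bar>X k \<omega> - Y \<omega>\<bar> 1" for k \<omega>
  have [measurable]: "u k \<in> borel_measurable M" for k unfolding u_def by measurable
  have u: "0 \<le> u k \<omega>" "u k \<omega> \<le> 1" for k \<omega> by (auto simp: u_def)
  have int: "integrable M (u k)" for k
    by (rule integrable_const_bound[where B = 1]) (auto simp: u)
  have "(\<lambda>k. \<integral>\<omega>. norm (u k \<omega>) \<partial>M) \<longlonglongrightarrow> 0"
  proof (rule LIMSEQ_I)
    fix \<epsilon> :: real assume "0 < \<epsilon>"
    let ?A = "\<lambda>k. {\<omega> \<in> space M. \<epsilon> / 2 < \<bar>X k \<omega> - Y \<omega>\<bar>}"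
    have "(\<lambda>k. prob (?A k)) \<longlonglongrightarrow> 0"
      using assms \<open>0 < \<epsilon>\<close> half_gt_zero unfolding tendsto_in_probability_def by blast
    from LIMSEQ_D[OF this half_gt_zero[OF \<open>0 < \<epsilon>\<close>]]
    obtain N where "\<forall>k\<ge>N. norm (prob (?A k) - 0) < \<epsilon> / 2" by blast
    then have N: "\<And>k. k \<ge> N \<Longrightarrow> prob (?A k) < \<epsilon> / 2" by auto
    have "norm ((\<integral>\<omega>. norm (u k \<omega>) \<partial>M) - 0) < \<epsilon>" if "k \<ge> N" for k
    proof -
      have "(\<integral>\<omega>. u k \<omega> \<partial>M) \<le> (\<integral>\<omega>. \<epsilon> / 2 + indicator (?A k) \<omega> \<partial>M)"
      proof (rule integral_mono[OF int])
        show "integrable M (\<lambda>\<omega>. \<epsilon> / 2 + indicator (?A k) \<omega>)"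
          by (intro Bochner_Integration.integrable_add integrable_const integrable_real_indicator) (auto simp: emeasure_eq_measure)
        show "u k \<omega> \<le> \<epsilon> / 2 + indicator (?A k) \<omega>" if "\<omega> \<in> space M" for \<omega>
          using that u(2)[of k \<omega>] \<open>0 < \<epsilon>\<close> by (cases "\<omega> \<in> ?A k") (auto simp: u_def min_def)
      qed
      also have "\<dots> = \<epsilon> / 2 + prob (?A k)"
        by (subst Bochner_Integration.integral_add) (simp_all add: prob_space emeasure_eq_measure)
      finally have "(\<integral>\<omega>. u k \<omega> \<partial>M) < \<epsilon>" using N[OF that] by simp
      moreover have "0 \<le> (\<integral>\<omega>. u k \<omega> \<partial>M)" using u by (intro Bochner_Integration.integral_nonneg) auto
      ultimately show ?thesis using u by simp
    qed
    then show "\<exists>no. \<forall>k\<ge>no. norm ((\<integral>\<omega>. norm (u k \<omega>) \<partial>M) - 0) < \<epsilon>" by blast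
  qed
  then obtain \<rho> where \<rho>: "strict_mono \<rho>" "AE \<omega> in M. (\<lambda>k. u (\<rho> k) \<omega>) \<longlonglongrightarrow> 0"
    using tendsto_L1_AE_subseq[of M u, OF int] by blast
  have "AE \<omega> in M. (\<lambda>k. X (\<rho> k) \<omega>) \<longlonglongrightarrow> Y \<omega>" using \<rho>(2)
  proof eventually_elim
    case (elim \<omega>)
    have "\<forall>\<^sub>F k in sequentially. u (\<rho> k) \<omega> < 1" using order_tendstoD(2)[OF elim] by simp
    then have "\<forall>\<^sub>F k in sequentially. u (\<rho> k) \<omega> = \<bar>X (\<rho> k) \<omega> - Y \<omega>\<bar>"
      by eventually_elim (auto simp: u_def min_def split: if_splits)
    then have "(\<lambda>k. \<bar>X (\<rho> k) \<omega> - Y \<omega>\<bar>) \<longlonglongrightarrow> 0" using elim by (simp add: tendsto_cong)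
    then show ?case by (simp add: tendsto_rabs_zero_iff LIM_zero_iff)
  qed
  then show ?thesis using \<rho>(1) by blast
qed

end

section \<open>Calculus of integrand-integral pairs\<close>

context standard_brownian_motion
begin

lemma elem_scale_adm:
  assumes "0 \<le> a" "elem_adm F a t xs" "c \<in> borel_measurable (F a)"
  shows "elem_adm F a t (elem_scale c xs)"
  using assms(2)
proof (induction xs rule: elem_induct)
  case (Cons s u \<xi> xs)
  then show ?case using F_imp_F[of a s c borel] assms by auto
qed simp

lemma elem_before_adm: "a \<le> v \<Longrightarrow> elem_adm F a t xs \<Longrightarrow> elem_adm F a v (elem_before v xs)"
  by (induction xs rule: elem_induct) (auto simp: min_def)

lemma elem_after_adm: "0 \<le> a \<Longrightarrow> a \<le> v \<Longrightarrow> v \<le> t \<Longrightarrow> elem_adm F a t xs \<Longrightarrow> elem_adm F v t (elem_after v xs)"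
proof (induction xs rule: elem_induct)
  case (Cons s u \<xi> xs)
  then show ?case using F_imp_F[of s "max v s" \<xi> borel] by auto
qed simp

text \<open>This is the uniqueness of the integral in disguise. The second-moment inequality is used
  with truncation level 1, which on almost every path is eventually inactive because the energies
  tend to 0.\<close>

lemma elem_int_vanish:
  assumes "0 \<le> a" "a \<le> t" and xs: "\<And>k. elem_adm F a t (xs k)"
    and lim: "AE \<omega> in M. (\<lambda>k. energy a t (\<lambda>r. elem_proc (xs k) r \<omega>)) \<longlonglongrightarrow> 0"
  shows "\<exists>\<rho>. strict_mono \<rho> \<and> (AE \<omega> in M. (\<lambda>k. elem_int W (xs (\<rho> k)) \<omega>) \<longlonglongrightarrow> 0)"
proof -
  define V where "V k \<omega> = energy a t (\<lambda>r. elem_proc (xs k) r \<omega>)" for k \<omega>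
  have [measurable]: "V k \<in> borel_measurable M" "elem_int W (xs k) \<in> borel_measurable M" for k
    unfolding V_def energy_def using elem_energy_measurable elem_int_measurable assms by auto
  define u where "u k \<omega> = (if V k \<omega> < 1 then (elem_int W (xs k) \<omega>)\<^sup>2 else 0)" for k \<omega>
  have [measurable]: "u k \<in> borel_measurable M" for k unfolding u_def by measurable
  have bound: "(\<integral>\<^sup>+\<omega>. ennreal (u k \<omega>) \<partial>M) \<le> (\<integral>\<^sup>+\<omega>. min (V k \<omega>) 1 \<partial>M)" for k
  proof -
    have "(\<integral>\<^sup>+\<omega>. ennreal (u k \<omega>) \<partial>M) = (\<integral>\<^sup>+\<omega>. (if V k \<omega> < 1 then ennreal ((0 + elem_int W (xs k) \<omega>)\<^sup>2) else 0) \<partial>M)"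
      by (intro nn_integral_cong) (auto simp: u_def)
    then show ?thesis
      using elem_second_moment[OF assms(1,2) xs[of k], of "\<lambda>_. 0" 1] by (simp add: V_def energy_def)
  qed
  have "(\<lambda>k. \<integral>\<^sup>+\<omega>. min (V k \<omega>) 1 \<partial>M) \<longlonglongrightarrow> (\<integral>\<^sup>+\<omega>. 0 \<partial>M)"
  proof (rule nn_integral_dominated_convergence[where w = "\<lambda>_. 1"])
    show "AE \<omega> in M. (\<lambda>k. min (V k \<omega>) 1) \<longlonglongrightarrow> 0" using lim
    proof eventually_elim
      case (elim \<omega>)
      then have "(\<lambda>k. V k \<omega>) \<longlonglongrightarrow> 0" by (simp add: V_def)
      from tendsto_min[OF this tendsto_const[of 1]] show ?case by simp
    qed
  qed (auto simp: emeasure_space_1)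
  then have lim0: "(\<lambda>k. \<integral>\<^sup>+\<omega>. min (V k \<omega>) 1 \<partial>M) \<longlonglongrightarrow> 0" by simp
  have fin: "(\<integral>\<^sup>+\<omega>. ennreal (u k \<omega>) \<partial>M) < \<infinity>" for k
  proof -
    have "(\<integral>\<^sup>+\<omega>. min (V k \<omega>) 1 \<partial>M) \<le> (\<integral>\<^sup>+\<omega>. 1 \<partial>M)" by (intro nn_integral_mono) auto
    then show ?thesis using bound[of k] by (simp add: emeasure_space_1 less_top order_le_less_trans)
  qed
  have int: "integrable M (u k)" for k
    using fin by (intro integrableI_nonneg) (auto simp: u_def)
  have "(\<lambda>k. ennreal (\<integral>\<omega>. norm (u k \<omega>) \<partial>M)) \<longlonglongrightarrow> 0"
  proof (rule tendsto_sandwich[OF _ _ tendsto_const lim0])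
    show "\<forall>\<^sub>F k in sequentially. ennreal (\<integral>\<omega>. norm (u k \<omega>) \<partial>M) \<le> (\<integral>\<^sup>+\<omega>. min (V k \<omega>) 1 \<partial>M)"
    proof (intro always_eventually allI)
      fix k
      have "norm (u k \<omega>) = u k \<omega>" for \<omega> by (auto simp: u_def)
      moreover have "ennreal (\<integral>\<omega>. u k \<omega> \<partial>M) = (\<integral>\<^sup>+\<omega>. ennreal (u k \<omega>) \<partial>M)"
        using int by (subst nn_integral_eq_integral) (auto simp: u_def)
      ultimately show "ennreal (\<integral>\<omega>. norm (u k \<omega>) \<partial>M) \<le> (\<integral>\<^sup>+\<omega>. min (V k \<omega>) 1 \<partial>M)"
        using bound[of k] by simp
    qed
  qed auto
  then have "(\<lambda>k. \<integral>\<omega>. norm (u k \<omega>) \<partial>M) \<longlonglongrightarrow> 0"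
    by (subst (asm) tendsto_ennreal_iff[of _ _ 0, simplified]) (auto intro: integral_nonneg)
  then obtain \<rho> where \<rho>: "strict_mono \<rho>" "AE \<omega> in M. (\<lambda>k. u (\<rho> k) \<omega>) \<longlonglongrightarrow> 0"
    using tendsto_L1_AE_subseq[of M u, OF int] by blast
  have "AE \<omega> in M. (\<lambda>k. elem_int W (xs (\<rho> k)) \<omega>) \<longlonglongrightarrow> 0" using \<rho>(2) lim
  proof eventually_elim
    case (elim \<omega>)
    have "(\<lambda>k. V (\<rho> k) \<omega>) \<longlonglongrightarrow> 0"
      using LIMSEQ_subseq_LIMSEQ[OF elim(2) \<rho>(1)] by (simp add: V_def o_def)
    then have "\<forall>\<^sub>F k in sequentially. V (\<rho> k) \<omega> < 1" by (rule order_tendstoD) simp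
    then have "\<forall>\<^sub>F k in sequentially. u (\<rho> k) \<omega> = (elem_int W (xs (\<rho> k)) \<omega>)\<^sup>2"
      by eventually_elim (simp add: u_def)
    then have "(\<lambda>k. (elem_int W (xs (\<rho> k)) \<omega>)\<^sup>2) \<longlonglongrightarrow> 0" using elim(1) by (simp add: tendsto_cong)
    from tendsto_real_sqrt[OF this] show ?case by (simp add: tendsto_rabs_zero_iff)
  qed
  then show ?thesis using \<rho>(1) by blast
qed

lemma ito_pair_borel: "ito_pair M F W a t D J \<Longrightarrow> \<omega> \<in> space M \<Longrightarrow> (\<lambda>r. D r \<omega>) \<in> borel_measurable borel"
  by (simp add: ito_pair_def)

lemma ito_pair_add:
  assumes 1: "ito_pair M F W a t D1 J1" and 2: "ito_pair M F W a t D2 J2"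
  shows "ito_pair M F W a t (\<lambda>r \<omega>. D1 r \<omega> + D2 r \<omega>) (\<lambda>\<omega>. J1 \<omega> + J2 \<omega>)"
proof -
  obtain xs where xs: "\<And>k. elem_adm F a t (xs k)"
    "AE \<omega> in M. (\<lambda>k. energy a t (\<lambda>r. elem_proc (xs k) r \<omega> - D1 r \<omega>)) \<longlonglongrightarrow> 0 \<and> (\<lambda>k. elem_int W (xs k) \<omega>) \<longlonglongrightarrow> J1 \<omega>"
    using 1 unfolding ito_pair_def by blast
  obtain ys where ys: "\<And>k. elem_adm F a t (ys k)"
    "AE \<omega> in M. (\<lambda>k. energy a t (\<lambda>r. elem_proc (ys k) r \<omega> - D2 r \<omega>)) \<longlonglongrightarrow> 0 \<and> (\<lambda>k. elem_int W (ys k) \<omega>) \<longlonglongrightarrow> J2 \<omega>"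
    using 2 unfolding ito_pair_def by blast
  have "AE \<omega> in M. (\<lambda>k. energy a t (\<lambda>r. elem_proc (xs k @ ys k) r \<omega> - (D1 r \<omega> + D2 r \<omega>))) \<longlonglongrightarrow> 0 \<and>
      (\<lambda>k. elem_int W (xs k @ ys k) \<omega>) \<longlonglongrightarrow> J1 \<omega> + J2 \<omega>"
    using xs(2) ys(2) AE_space
  proof eventually_elim
    case (elim \<omega>)
    note [measurable] = ito_pair_borel[OF 1 elim(3)] ito_pair_borel[OF 2 elim(3)]
    have "(\<lambda>k. energy a t (\<lambda>r. elem_proc (xs k @ ys k) r \<omega> - (D1 r \<omega> + D2 r \<omega>))) \<longlonglongrightarrow> 0"
    proof (rule tendsto_sandwich[OF _ _ tendsto_const])
      have "(\<lambda>k. 2 * energy a t (\<lambda>r. elem_proc (xs k) r \<omega> - D1 r \<omega>) + 2 * energy a t (\<lambda>r. elem_proc (ys k) r \<omega> - D2 r \<omega>)) \<longlonglongrightarrow> 2 * 0 + 2 * 0"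
        using elim by (intro tendsto_add ennreal_tendsto_cmult) auto
      then show "(\<lambda>k. 2 * energy a t (\<lambda>r. elem_proc (xs k) r \<omega> - D1 r \<omega>) + 2 * energy a t (\<lambda>r. elem_proc (ys k) r \<omega> - D2 r \<omega>)) \<longlonglongrightarrow> 0" by simp
      show "\<forall>\<^sub>F k in sequentially. energy a t (\<lambda>r. elem_proc (xs k @ ys k) r \<omega> - (D1 r \<omega> + D2 r \<omega>)) \<le>
          2 * energy a t (\<lambda>r. elem_proc (xs k) r \<omega> - D1 r \<omega>) + 2 * energy a t (\<lambda>r. elem_proc (ys k) r \<omega> - D2 r \<omega>)"
      proof (intro always_eventually allI energy_le_sum)
        fix k r
        show "(elem_proc (xs k @ ys k) r \<omega> - (D1 r \<omega> + D2 r \<omega>))\<^sup>2 \<le> 2 * (elem_proc (xs k) r \<omega> - D1 r \<omega>)\<^sup>2 + 2 * (elem_proc (ys k) r \<omega> - D2 r \<omega>)\<^sup>2"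
          using power2_add_le[of "elem_proc (xs k) r \<omega> - D1 r \<omega>" "elem_proc (ys k) r \<omega> - D2 r \<omega>"]
          by (simp add: algebra_simps)
      qed measurable
    qed auto
    then show ?case using elim by (auto intro!: tendsto_add)
  qed
  moreover have "elem_adm F a t (xs k @ ys k)" for k using xs(1) ys(1) by simp
  moreover have "(\<lambda>r. D1 r \<omega> + D2 r \<omega>) \<in> borel_measurable borel" if "\<omega> \<in> space M" for \<omega>
    using ito_pair_borel[OF 1 that] ito_pair_borel[OF 2 that] by measurable
  ultimately show ?thesis by (intro ito_pairI)
qed

lemma ito_pair_scale:
  assumes 1: "ito_pair M F W a t D J" and "0 \<le> a" and c: "c \<in> borel_measurable (F a)"
  shows "ito_pair M F W a t (\<lambda>r \<omega>. c \<omega> * D r \<omega>) (\<lambda>\<omega>. c \<omega> * J \<omega>)"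
proof -
  obtain xs where xs: "\<And>k. elem_adm F a t (xs k)"
    "AE \<omega> in M. (\<lambda>k. energy a t (\<lambda>r. elem_proc (xs k) r \<omega> - D r \<omega>)) \<longlonglongrightarrow> 0 \<and> (\<lambda>k. elem_int W (xs k) \<omega>) \<longlonglongrightarrow> J \<omega>"
    using 1 unfolding ito_pair_def by blast
  have "AE \<omega> in M. (\<lambda>k. energy a t (\<lambda>r. elem_proc (elem_scale c (xs k)) r \<omega> - c \<omega> * D r \<omega>)) \<longlonglongrightarrow> 0 \<and>
      (\<lambda>k. elem_int W (elem_scale c (xs k)) \<omega>) \<longlonglongrightarrow> c \<omega> * J \<omega>"
    using xs(2) AE_space
  proof eventually_elim
    case (elim \<omega>)
    note [measurable] = ito_pair_borel[OF 1 elim(2)]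
    have "energy a t (\<lambda>r. elem_proc (elem_scale c (xs k)) r \<omega> - c \<omega> * D r \<omega>) = ennreal ((c \<omega>)\<^sup>2) * energy a t (\<lambda>r. elem_proc (xs k) r \<omega> - D r \<omega>)" for k
      unfolding elem_scale_proc right_diff_distrib[symmetric] by (rule energy_scale) measurable
    moreover have "(\<lambda>k. ennreal ((c \<omega>)\<^sup>2) * energy a t (\<lambda>r. elem_proc (xs k) r \<omega> - D r \<omega>)) \<longlonglongrightarrow> ennreal ((c \<omega>)\<^sup>2) * 0"
      using elim by (intro ennreal_tendsto_cmult) auto
    ultimately show ?case using elim by (auto simp: elem_scale_int intro!: tendsto_mult)
  qed
  moreover have "elem_adm F a t (elem_scale c (xs k))" for k using xs(1) elem_scale_adm assms by blast
  moreover have "(\<lambda>r. c \<omega> * D r \<omega>) \<in> borel_measurable borel" if "\<omega> \<in> space M" for \<omega>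
    using ito_pair_borel[OF 1 that] by measurable
  ultimately show ?thesis by (intro ito_pairI)
qed

lemma ito_pair_elem:
  assumes "a \<le> s" "s \<le> u" "u \<le> t" "c \<in> borel_measurable (F s)"
  shows "ito_pair M F W a t (\<lambda>r \<omega>. c \<omega> * indicator {s<..u} r) (\<lambda>\<omega>. c \<omega> * (W u \<omega> - W s \<omega>))"
  unfolding ito_pair_def using assms by (intro conjI exI[of _ "\<lambda>_. [(s, u, c)]"]) (auto simp: energy_def)

lemma ito_pair_extend:
  assumes 1: "ito_pair M F W s u D J" and "a \<le> s" "u \<le> t"
  shows "ito_pair M F W a t (\<lambda>r \<omega>. indicator {s<..u} r * D r \<omega>) J"
proof -
  obtain xs where xs: "\<And>k. elem_adm F s u (xs k)"
    "AE \<omega> in M. (\<lambda>k. energy s u (\<lambda>r. elem_proc (xs k) r \<omega> - D r \<omega>)) \<longlonglongrightarrow> 0 \<and> (\<lambda>k. elem_int W (xs k) \<omega>) \<longlonglongrightarrow> J \<omega>"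
    using 1 unfolding ito_pair_def by blast
  have "energy a t (\<lambda>r. elem_proc (xs k) r \<omega> - indicator {s<..u} r * D r \<omega>) = energy s u (\<lambda>r. elem_proc (xs k) r \<omega> - D r \<omega>)" for k \<omega>
    unfolding energy_def using assms(2,3) elem_proc_outside[OF xs(1)[of k]]
    by (intro nn_integral_cong) (auto simp: indicator_def)
  moreover have "elem_adm F a t (xs k)" for k using xs(1)[of k] assms(2,3) unfolding elem_adm_def by fastforce
  moreover have "(\<lambda>r. indicator {s<..u} r * D r \<omega>) \<in> borel_measurable borel" if "\<omega> \<in> space M" for \<omega>
    using ito_pair_borel[OF 1 that] by measurable
  ultimately show ?thesis using xs unfolding ito_pair_def by (auto intro!: exI[of _ xs])
qed

text \<open>The two integrals come with unrelated approximating sequences. Up to \<open>s\<close>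
  both sequences approximate the same integrand, so their integrals there agree in the limit, and in
  the difference only the part of the second sequence after \<open>s\<close> survives.\<close>

lemma ito_pair_diff:
  assumes 1: "ito_pair M F W a s D J1" and 2: "ito_pair M F W a u D J2" and "0 \<le> a" "a \<le> s" "s \<le> u"
  shows "ito_pair M F W s u D (\<lambda>\<omega>. J2 \<omega> - J1 \<omega>)"
proof -
  obtain xs where xs: "\<And>k. elem_adm F a s (xs k)"
    "AE \<omega> in M. (\<lambda>k. energy a s (\<lambda>r. elem_proc (xs k) r \<omega> - D r \<omega>)) \<longlonglongrightarrow> 0 \<and> (\<lambda>k. elem_int W (xs k) \<omega>) \<longlonglongrightarrow> J1 \<omega>"
    using 1 unfolding ito_pair_def by blast
  obtain ys where ys: "\<And>k. elem_adm F a u (ys k)"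
    "AE \<omega> in M. (\<lambda>k. energy a u (\<lambda>r. elem_proc (ys k) r \<omega> - D r \<omega>)) \<longlonglongrightarrow> 0 \<and> (\<lambda>k. elem_int W (ys k) \<omega>) \<longlonglongrightarrow> J2 \<omega>"
    using 2 unfolding ito_pair_def by blast
  \<comment> \<open>The difference of the two approximations of \<open>D\<close> up to
    \<open>s\<close>. Both errors vanish in energy, hence so does \<open>zs\<close>, although
    neither approximant does.\<close>
  define zs where "zs k = elem_before s (ys k) @ elem_scale (\<lambda>_. - 1) (xs k)" for k
  have "elem_adm F a s (zs k)" for k
    unfolding zs_def using xs(1) ys(1) assms elem_before_adm[of a s u "ys k"] elem_scale_adm[of a s "xs k"] by simp
  moreover have "AE \<omega> in M. (\<lambda>k. energy a s (\<lambda>r. elem_proc (zs k) r \<omega>)) \<longlonglongrightarrow> 0"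
    using xs(2) ys(2) AE_space
  proof eventually_elim
    case (elim \<omega>)
    note [measurable] = ito_pair_borel[OF 1 elim(3)]
    have "(\<lambda>k. 2 * energy a u (\<lambda>r. elem_proc (ys k) r \<omega> - D r \<omega>) + 2 * energy a s (\<lambda>r. elem_proc (xs k) r \<omega> - D r \<omega>)) \<longlonglongrightarrow> 2 * 0 + 2 * 0"
      using elim by (intro tendsto_add ennreal_tendsto_cmult) auto
    then have lim: "(\<lambda>k. 2 * energy a u (\<lambda>r. elem_proc (ys k) r \<omega> - D r \<omega>) + 2 * energy a s (\<lambda>r. elem_proc (xs k) r \<omega> - D r \<omega>)) \<longlonglongrightarrow> 0"
      by simp
    have "energy a s (\<lambda>r. elem_proc (zs k) r \<omega>) \<le>
       2 * energy a u (\<lambda>r. elem_proc (ys k) r \<omega> - D r \<omega>) + 2 * energy a s (\<lambda>r. elem_proc (xs k) r \<omega> - D r \<omega>)" for k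
    proof -
      have "energy a s (\<lambda>r. elem_proc (zs k) r \<omega>) \<le>
        2 * energy a s (\<lambda>r. elem_proc (ys k) r \<omega> - D r \<omega>) + 2 * energy a s (\<lambda>r. elem_proc (xs k) r \<omega> - D r \<omega>)"
      proof (rule energy_le_sum)
        fix r assume "r \<le> s"
        then show "(elem_proc (zs k) r \<omega>)\<^sup>2 \<le> 2 * (elem_proc (ys k) r \<omega> - D r \<omega>)\<^sup>2 + 2 * (elem_proc (xs k) r \<omega> - D r \<omega>)\<^sup>2"
          using power2_add_le[of "elem_proc (ys k) r \<omega> - D r \<omega>" "D r \<omega> - elem_proc (xs k) r \<omega>"]
          by (simp add: zs_def elem_before_proc elem_scale_proc power2_commute)
      qed measurable
      also have "\<dots> \<le> 2 * energy a u (\<lambda>r. elem_proc (ys k) r \<omega> - D r \<omega>) + 2 * energy a s (\<lambda>r. elem_proc (xs k) r \<omega> - D r \<omega>)"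
        using assms by (intro add_right_mono mult_left_mono energy_interval_mono) auto
      finally show ?thesis .
    qed
    then show ?case by (rule ennreal_tendsto_0_le[OF lim])
  qed
  ultimately obtain \<rho> where \<rho>: "strict_mono \<rho>" "AE \<omega> in M. (\<lambda>k. elem_int W (zs (\<rho> k)) \<omega>) \<longlonglongrightarrow> 0"
    using elem_int_vanish[of a s zs] assms by blast
  define vs where "vs k = elem_after s (ys (\<rho> k))" for k
  have "AE \<omega> in M. (\<lambda>k. energy s u (\<lambda>r. elem_proc (vs k) r \<omega> - D r \<omega>)) \<longlonglongrightarrow> 0 \<and>
      (\<lambda>k. elem_int W (vs k) \<omega>) \<longlonglongrightarrow> J2 \<omega> - J1 \<omega>"
    using xs(2) ys(2) \<rho>(2)
  proof eventually_elim
    case (elim \<omega>)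
    have e: "(\<lambda>k. energy a u (\<lambda>r. elem_proc (ys (\<rho> k)) r \<omega> - D r \<omega>)) \<longlonglongrightarrow> 0"
      and y: "(\<lambda>k. elem_int W (ys (\<rho> k)) \<omega>) \<longlonglongrightarrow> J2 \<omega>"
      and x: "(\<lambda>k. elem_int W (xs (\<rho> k)) \<omega>) \<longlonglongrightarrow> J1 \<omega>"
      using elim LIMSEQ_subseq_LIMSEQ[OF _ \<rho>(1)] by (force simp: o_def)+
    have "energy s u (\<lambda>r. elem_proc (vs k) r \<omega> - D r \<omega>) \<le> energy a u (\<lambda>r. elem_proc (ys (\<rho> k)) r \<omega> - D r \<omega>)" for k
    proof -
      have "energy s u (\<lambda>r. elem_proc (vs k) r \<omega> - D r \<omega>) = energy s u (\<lambda>r. elem_proc (ys (\<rho> k)) r \<omega> - D r \<omega>)"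
        by (intro energy_cong) (simp add: vs_def elem_after_proc)
      then show ?thesis using assms by (simp add: energy_interval_mono)
    qed
    then have "(\<lambda>k. energy s u (\<lambda>r. elem_proc (vs k) r \<omega> - D r \<omega>)) \<longlonglongrightarrow> 0"
      by (intro ennreal_tendsto_0_le[OF e])
    moreover have "elem_int W (vs k) \<omega> = elem_int W (ys (\<rho> k)) \<omega> - (elem_int W (zs (\<rho> k)) \<omega> + elem_int W (xs (\<rho> k)) \<omega>)" for k
      using elem_before_after_int[OF ys(1)[of "\<rho> k"], of W s \<omega>]
      by (simp add: vs_def zs_def elem_scale_int)
    moreover have "(\<lambda>k. elem_int W (ys (\<rho> k)) \<omega> - (elem_int W (zs (\<rho> k)) \<omega> + elem_int W (xs (\<rho> k)) \<omega>)) \<longlonglongrightarrow> J2 \<omega> - (0 + J1 \<omega>)"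
      by (intro tendsto_diff tendsto_add x y elim(3))
    ultimately show ?case by simp
  qed
  moreover have "elem_adm F s u (vs k)" for k
    unfolding vs_def using ys(1) assms by (intro elem_after_adm) auto
  ultimately show ?thesis using ito_pair_borel[OF 1] by (intro ito_pairI)
qed

text \<open>The approximants satisfy the inequality with their own energy, which is at most twice
  that of \<open>D\<close> plus twice a vanishing error: this is the origin of the factor 2. Only
  the order in \<open>t - a\<close> matters later, so the constant may be generous.\<close>

lemma ito_pair_second_moment:
  assumes "0 \<le> a" "a \<le> t" and 1: "ito_pair M F W a t D J"
    and [measurable]: "J \<in> borel_measurable M" "(\<lambda>\<omega>. energy a t (\<lambda>r. D r \<omega>)) \<in> borel_measurable M"
    and w: "w \<in> borel_measurable (F a)" and "0 \<le> b"
  shows "(\<integral>\<^sup>+\<omega>. (if 2 * energy a t (\<lambda>r. D r \<omega>) < ennreal b then ennreal ((w \<omega> + J \<omega>)\<^sup>2) else 0) \<partial>M)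
    \<le> (\<integral>\<^sup>+\<omega>. ennreal ((w \<omega>)\<^sup>2) \<partial>M) + (\<integral>\<^sup>+\<omega>. min (2 * energy a t (\<lambda>r. D r \<omega>)) (ennreal b) \<partial>M)"
proof -
  obtain xs where xs: "\<And>k. elem_adm F a t (xs k)"
    "AE \<omega> in M. (\<lambda>k. energy a t (\<lambda>r. elem_proc (xs k) r \<omega> - D r \<omega>)) \<longlonglongrightarrow> 0 \<and> (\<lambda>k. elem_int W (xs k) \<omega>) \<longlonglongrightarrow> J \<omega>"
    using 1 unfolding ito_pair_def by blast
  have [measurable]: "w \<in> borel_measurable M" using F_imp_M[OF _ w] assms by simp
  have [measurable]: "(\<lambda>\<omega>. energy a t (\<lambda>r. elem_proc (xs k) r \<omega>)) \<in> borel_measurable M" "elem_int W (xs k) \<in> borel_measurable M" for k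
    unfolding energy_def using elem_energy_measurable elem_int_measurable assms(1) xs(1) by auto
  have "(\<integral>\<^sup>+\<omega>. (if 2 * energy a t (\<lambda>r. D r \<omega>) < ennreal b then ennreal ((w \<omega> + J \<omega>)\<^sup>2) else 0) \<partial>M)
    \<le> (\<integral>\<^sup>+\<omega>. ennreal ((w \<omega>)\<^sup>2) \<partial>M) + 1 * (\<integral>\<^sup>+\<omega>. min (2 * energy a t (\<lambda>r. D r \<omega>)) (ennreal b) \<partial>M)"
  proof (rule Fatou_truncated_bound[OF prob_space_axioms, where Zk = "\<lambda>k \<omega>. ennreal ((w \<omega> + elem_int W (xs k) \<omega>)\<^sup>2)"
        and Vk = "\<lambda>k \<omega>. energy a t (\<lambda>r. elem_proc (xs k) r \<omega>)"])
    show "(\<integral>\<^sup>+\<omega>. (if energy a t (\<lambda>r. elem_proc (xs k) r \<omega>) < ennreal b then ennreal ((w \<omega> + elem_int W (xs k) \<omega>)\<^sup>2) else 0) \<partial>M)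
      \<le> (\<integral>\<^sup>+\<omega>. ennreal ((w \<omega>)\<^sup>2) \<partial>M) + 1 * (\<integral>\<^sup>+\<omega>. min (energy a t (\<lambda>r. elem_proc (xs k) r \<omega>)) (ennreal b) \<partial>M)" for k
      using elem_second_moment[OF assms(1,2) xs(1)[of k] w \<open>0 \<le> b\<close>] by (simp add: energy_def)
    show "AE \<omega> in M. \<exists>d. d \<longlonglongrightarrow> 0 \<and> (\<forall>\<^sub>F k in sequentially. energy a t (\<lambda>r. elem_proc (xs k) r \<omega>) \<le> 2 * energy a t (\<lambda>r. D r \<omega>) + d k)"
      using xs(2) AE_space
    proof eventually_elim
      case (elim \<omega>)
      note [measurable] = ito_pair_borel[OF 1 elim(2)]
      let ?d = "\<lambda>k. 2 * energy a t (\<lambda>r. elem_proc (xs k) r \<omega> - D r \<omega>)"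
      have "?d \<longlonglongrightarrow> 2 * 0" using elim by (intro ennreal_tendsto_cmult) auto
      moreover have "energy a t (\<lambda>r. elem_proc (xs k) r \<omega>) \<le> 2 * energy a t (\<lambda>r. D r \<omega>) + ?d k" for k
      proof (rule energy_le_sum)
        fix r
        show "(elem_proc (xs k) r \<omega>)\<^sup>2 \<le> 2 * (D r \<omega>)\<^sup>2 + 2 * (elem_proc (xs k) r \<omega> - D r \<omega>)\<^sup>2"
          using power2_add_le[of "D r \<omega>" "elem_proc (xs k) r \<omega> - D r \<omega>"] by simp
      qed measurable
      ultimately show ?case by (intro exI[of _ ?d]) auto
    qed
    show "AE \<omega> in M. ennreal ((w \<omega> + J \<omega>)\<^sup>2) \<le> liminf (\<lambda>k. ennreal ((w \<omega> + elem_int W (xs k) \<omega>)\<^sup>2))"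
      using xs(2)
    proof eventually_elim
      case (elim \<omega>)
      have "(\<lambda>k. ennreal ((w \<omega> + elem_int W (xs k) \<omega>)\<^sup>2)) \<longlonglongrightarrow> ennreal ((w \<omega> + J \<omega>)\<^sup>2)"
        using elim by (intro tendsto_ennrealI tendsto_power tendsto_add tendsto_const) auto
      from lim_imp_Liminf[OF _ this] show ?case by simp
    qed
  qed auto
  then show ?thesis by simp
qed

end

section \<open>Joint measurability of processes\<close>

lemma progressively_measurable_clamp:
  assumes "progressively_measurable F H" "0 \<le> v" "subalgebra M (F v)"
  shows "(\<lambda>(\<omega>, r). H (max 0 (min v r)) \<omega>) \<in> borel_measurable (M \<Otimes>\<^sub>M borel)"
proof -
  have H: "(\<lambda>(s, \<omega>). H s \<omega>) \<in> borel_measurable (restrict_space borel {0..v} \<Otimes>\<^sub>M F v)"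
    using assms by (simp add: progressively_measurable_def)
  have id: "(\<lambda>\<omega>. \<omega>) \<in> M \<rightarrow>\<^sub>M F v"
    by (rule measurable_from_subalg[OF assms(3) measurable_ident_sets]) simp
  \<comment> \<open>Clamping the time to the interval from 0 to \<open>v\<close> gives a process on
    the whole line, so that measurability can be stated on \<open>M \<Otimes>\<^sub>M borel\<close>
    without restricted spaces.\<close>
  have "(\<lambda>(\<omega>, r). (max 0 (min v r), \<omega>)) \<in> M \<Otimes>\<^sub>M borel \<rightarrow>\<^sub>M restrict_space borel {0..v} \<Otimes>\<^sub>M F v"
    unfolding case_prod_beta'
  proof (rule measurable_Pair)
    show "(\<lambda>x. max 0 (min v (snd x))) \<in> M \<Otimes>\<^sub>M borel \<rightarrow>\<^sub>M restrict_space borel {0..v}"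
      using \<open>0 \<le> v\<close> by (intro measurable_restrict_space2) auto
    show "fst \<in> M \<Otimes>\<^sub>M borel \<rightarrow>\<^sub>M F v" by (rule measurable_compose[OF measurable_fst id])
  qed
  from measurable_compose[OF this H] show ?thesis by (simp add: case_prod_beta')
qed

text \<open>The clamped time is rounded down to a multiple of \<open>1 / Suc n\<close>. The rounded
  times take countably many values, which gives measurability; they stay nonnegative and converge,
  so continuity of the paths gives the limit.\<close>

lemma continuous_process_clamp:
  fixes S :: "real \<Rightarrow> 'a \<Rightarrow> real"
  assumes S: "\<And>s. 0 \<le> s \<Longrightarrow> S s \<in> borel_measurable M"
    and cont: "\<And>\<omega>. \<omega> \<in> space M \<Longrightarrow> continuous_on {0..} (\<lambda>s. S s \<omega>)"
  shows "(\<lambda>(\<omega>, r). S (max 0 (min v r)) \<omega>) \<in> borel_measurable (M \<Otimes>\<^sub>M borel)"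
proof (rule borel_measurable_LIMSEQ_real)
  let ?c = "\<lambda>r. max 0 (min v r :: real)"
  let ?g = "\<lambda>n x. real (nat \<lfloor>real (Suc n) * ?c (snd x)\<rfloor>) / real (Suc n)"
  show "(\<lambda>x. S (?g n x) (fst x)) \<in> borel_measurable (M \<Otimes>\<^sub>M borel)" for n
  proof (rule measurable_compose_countable[where f = "\<lambda>i x. S (real i / real (Suc n)) (fst x)" and g = "\<lambda>x. nat \<lfloor>real (Suc n) * ?c (snd x)\<rfloor>"])
    show "(\<lambda>x. S (real i / real (Suc n)) (fst x)) \<in> borel_measurable (M \<Otimes>\<^sub>M borel)" for i
      using measurable_compose[OF measurable_fst S[of "real i / real (Suc n)"]] by simp
  qed measurable
  fix x assume x: "x \<in> space (M \<Otimes>\<^sub>M (borel :: real measure))"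
  let ?r = "?c (snd x)"
  have "(\<lambda>n. ?g n x) \<longlonglongrightarrow> ?r"
  proof (rule tendsto_sandwich)
    have le: "?r - 1 / real (Suc n) \<le> ?g n x \<and> ?g n x \<le> ?r" for n
    proof -
      have "0 \<le> real (Suc n) * ?r" by simp
      then have "real (nat \<lfloor>real (Suc n) * ?r\<rfloor>) \<le> real (Suc n) * ?r" "real (Suc n) * ?r - 1 \<le> real (nat \<lfloor>real (Suc n) * ?r\<rfloor>)"
        by linarith+
      moreover have "(real (Suc n) * ?r - 1) / real (Suc n) = ?r - 1 / real (Suc n)"
        by (simp add: diff_divide_distrib del: of_nat_Suc)
      ultimately show ?thesis
        using divide_right_mono[of "real (Suc n) * ?r - 1" "real (nat \<lfloor>real (Suc n) * ?r\<rfloor>)" "real (Suc n)"]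
        by (simp add: divide_le_eq mult.commute del: of_nat_Suc)
    qed
    show "\<forall>\<^sub>F n in sequentially. ?r - 1 / real (Suc n) \<le> ?g n x" using le by simp
    show "\<forall>\<^sub>F n in sequentially. ?g n x \<le> ?r" using le by simp
    have "(\<lambda>n. ?r - 1 / real (Suc n)) \<longlonglongrightarrow> ?r - 0"
      by (intro tendsto_diff tendsto_const LIMSEQ_Suc[OF lim_1_over_n])
    then show "(\<lambda>n. ?r - 1 / real (Suc n)) \<longlonglongrightarrow> ?r" by simp
  qed simp
  then show "(\<lambda>n. S (?g n x) (fst x)) \<longlonglongrightarrow> (case x of (\<omega>, r) \<Rightarrow> S (?c r) \<omega>)"
    using continuous_on_tendsto_compose[OF cont[of "fst x"], of "\<lambda>n. ?g n x" ?r sequentially] x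
    by (auto simp: space_pair_measure case_prod_beta')
qed

text \<open>Averaging over the signs of the increments replaces the square of a sum by the sum of squares.\<close>

lemma nn_integral_sum_squares_le:
  fixes \<zeta> :: "nat \<Rightarrow> 'a \<Rightarrow> real"
  assumes [measurable]: "\<And>i. i < m \<Longrightarrow> \<zeta> i \<in> borel_measurable M" "Measurable.pred M P"
    and bound: "\<And>\<epsilon> :: nat \<Rightarrow> real. (\<And>i. \<bar>\<epsilon> i\<bar> = 1) \<Longrightarrow>
      (\<integral>\<^sup>+\<omega>. (if P \<omega> then ennreal ((\<Sum>i<m. \<epsilon> i * \<zeta> i \<omega>)\<^sup>2) else 0) \<partial>M) \<le> C"
  shows "(\<integral>\<^sup>+\<omega>. (if P \<omega> then ennreal (\<Sum>i<m. (\<zeta> i \<omega>)\<^sup>2) else 0) \<partial>M) \<le> C"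
proof -
  have "(\<integral>\<^sup>+\<omega>. (if P \<omega> then ennreal ((\<Sum>i<k. (\<zeta> i \<omega>)\<^sup>2) + (\<Sum>i\<in>{k..<m}. \<epsilon> i * \<zeta> i \<omega>)\<^sup>2) else 0) \<partial>M) \<le> C"
    if "k \<le> m" "\<And>i. \<bar>\<epsilon> i\<bar> = 1" for k and \<epsilon> :: "nat \<Rightarrow> real"
    using that
  \<comment> \<open>After \<open>k\<close> steps the first \<open>k\<close> signs have been averaged
    out into squares while the others are still arbitrary; hence the induction keeps
    \<open>\<epsilon>\<close> free.\<close>
  proof (induction k arbitrary: \<epsilon>)
    case 0
    then show ?case using bound[of \<epsilon>] by (simp add: atLeast0LessThan cong: if_cong)
  next
    case (Suc k)
    define A where "A \<omega> = (\<Sum>i<k. (\<zeta> i \<omega>)\<^sup>2)" for \<omega>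
    define B where "B \<omega> = (\<Sum>i\<in>{Suc k..<m}. \<epsilon> i * \<zeta> i \<omega>)" for \<omega>
    have [measurable]: "A \<in> borel_measurable M" "B \<in> borel_measurable M" "\<zeta> k \<in> borel_measurable M"
      unfolding A_def B_def using Suc by auto
    have A0: "0 \<le> A \<omega>" for \<omega> by (auto simp: A_def intro: sum_nonneg)
    have split: "(\<Sum>i\<in>{k..<m}. (\<epsilon>(k := c)) i * \<zeta> i \<omega>) = c * \<zeta> k \<omega> + B \<omega>" for c \<omega>
    proof -
      have "{k..<m} = insert k {Suc k..<m}" using Suc by auto
      then show ?thesis by (simp add: B_def)
    qed
    \<comment> \<open>With both values \<open>1\<close> and \<open>- 1\<close> of the sign at
      \<open>k\<close>, the cross terms between \<open>\<zeta> k\<close> and \<open>B\<close> cancel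
      in the sum of the two squares.\<close>
    have IH: "(\<integral>\<^sup>+\<omega>. (if P \<omega> then ennreal (A \<omega> + (c * \<zeta> k \<omega> + B \<omega>)\<^sup>2) else 0) \<partial>M) \<le> C" if "\<bar>c\<bar> = 1" for c
      using Suc.IH[of "\<epsilon>(k := c)"] Suc.prems that unfolding split A_def by auto
    have "2 * (\<integral>\<^sup>+\<omega>. (if P \<omega> then ennreal ((A \<omega> + (\<zeta> k \<omega>)\<^sup>2) + (B \<omega>)\<^sup>2) else 0) \<partial>M)
        = (\<integral>\<^sup>+\<omega>. (if P \<omega> then ennreal (A \<omega> + (1 * \<zeta> k \<omega> + B \<omega>)\<^sup>2) else 0) + (if P \<omega> then ennreal (A \<omega> + (- 1 * \<zeta> k \<omega> + B \<omega>)\<^sup>2) else 0) \<partial>M)"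
    proof (subst nn_integral_cmult[symmetric], measurable, intro nn_integral_cong)
      fix \<omega>
      have "2 * ennreal ((A \<omega> + (\<zeta> k \<omega>)\<^sup>2) + (B \<omega>)\<^sup>2) = ennreal (2 * ((A \<omega> + (\<zeta> k \<omega>)\<^sup>2) + (B \<omega>)\<^sup>2))"
        using A0[of \<omega>] by (simp add: ennreal_mult')
      also have "2 * ((A \<omega> + (\<zeta> k \<omega>)\<^sup>2) + (B \<omega>)\<^sup>2) = (A \<omega> + (1 * \<zeta> k \<omega> + B \<omega>)\<^sup>2) + (A \<omega> + (- 1 * \<zeta> k \<omega> + B \<omega>)\<^sup>2)"
        by (simp add: power2_eq_square algebra_simps)
      also have "ennreal \<dots> = ennreal (A \<omega> + (1 * \<zeta> k \<omega> + B \<omega>)\<^sup>2) + ennreal (A \<omega> + (- 1 * \<zeta> k \<omega> + B \<omega>)\<^sup>2)"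
        using A0[of \<omega>] by (intro ennreal_plus) auto
      finally show "2 * (if P \<omega> then ennreal ((A \<omega> + (\<zeta> k \<omega>)\<^sup>2) + (B \<omega>)\<^sup>2) else 0)
        = (if P \<omega> then ennreal (A \<omega> + (1 * \<zeta> k \<omega> + B \<omega>)\<^sup>2) else 0) + (if P \<omega> then ennreal (A \<omega> + (- 1 * \<zeta> k \<omega> + B \<omega>)\<^sup>2) else 0)"
        by simp
    qed
    also have "\<dots> = (\<integral>\<^sup>+\<omega>. (if P \<omega> then ennreal (A \<omega> + (1 * \<zeta> k \<omega> + B \<omega>)\<^sup>2) else 0) \<partial>M)
        + (\<integral>\<^sup>+\<omega>. (if P \<omega> then ennreal (A \<omega> + (- 1 * \<zeta> k \<omega> + B \<omega>)\<^sup>2) else 0) \<partial>M)"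
      by (intro nn_integral_add) measurable
    also have "\<dots> \<le> C + C" by (intro add_mono IH) auto
    finally have "2 * (\<integral>\<^sup>+\<omega>. (if P \<omega> then ennreal ((A \<omega> + (\<zeta> k \<omega>)\<^sup>2) + (B \<omega>)\<^sup>2) else 0) \<partial>M) \<le> 2 * C"
      by (simp add: mult_2)
    then have "(\<integral>\<^sup>+\<omega>. (if P \<omega> then ennreal ((A \<omega> + (\<zeta> k \<omega>)\<^sup>2) + (B \<omega>)\<^sup>2) else 0) \<partial>M) \<le> C"
      by (subst (asm) ennreal_mult_le_mult_iff) auto
    then show ?case by (simp add: A_def B_def cong: if_cong)
  qed
  from this[of m "\<lambda>_. 1"] show ?thesis by (simp cong: if_cong)
qed

lemma elem_int_of_upt:
  "elem_int W (map (\<lambda>i. (p i, q i, \<xi> i)) [0..<n]) \<omega> = (\<Sum>i<n. \<xi> i \<omega> * (W (q i) \<omega> - W (p i) \<omega>))"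
  by (simp add: elem_int_def o_def interv_sum_list_conv_sum_set_nat atLeast0LessThan)

lemma elem_proc_of_upt:
  "elem_proc (map (\<lambda>i. (p i, q i, \<xi> i)) [0..<n]) r \<omega> = (\<Sum>i<n. \<xi> i \<omega> * indicator {p i<..q i} r)"
  by (simp add: elem_proc_def o_def interv_sum_list_conv_sum_set_nat atLeast0LessThan)

section \<open>From Ito integrals to pairs\<close>

context standard_brownian_motion
begin

text \<open>Two nested subsequences turn both convergences in probability into almost sure ones.
  \<open>D\<close> agrees with \<open>H\<close> up to time \<open>v\<close> and continues it in such
  a way that all paths are Borel functions on the line.\<close>

lemma ito_pair_has_ito_integral:
  assumes H: "has_ito_integral M F W H v Y" and "0 \<le> v"
    and D: "\<And>\<omega>. \<omega> \<in> space M \<Longrightarrow> (\<lambda>r. D r \<omega>) \<in> borel_measurable borel"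
    and DH: "\<And>r \<omega>. \<omega> \<in> space M \<Longrightarrow> 0 \<le> r \<Longrightarrow> r \<le> v \<Longrightarrow> D r \<omega> = H r \<omega>"
  shows "ito_pair M F W 0 v D Y"
proof -
  obtain n p \<xi> where simple: "\<And>k. simple_integrand M F (n k) (p k) (\<xi> k)"
    and lim: "tendsto_in_probability M
          (\<lambda>k \<omega>. LBINT s:{0..v}. (simple_process (n k) (p k) (\<xi> k) s \<omega> - H s \<omega>)\<^sup>2) (\<lambda>_. 0)"
    and limI: "tendsto_in_probability M (\<lambda>k. simple_ito_integral W (n k) (p k) (\<xi> k) v) Y"
    using H unfolding has_ito_integral_def by blast
  have int: "AE \<omega> in M. set_integrable lborel {0..v} (\<lambda>s. (H s \<omega>)\<^sup>2)"
    using H unfolding has_ito_integral_def by blast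
  define X where "X k \<omega> = (LBINT s:{0..v}. (simple_process (n k) (p k) (\<xi> k) s \<omega> - H s \<omega>)\<^sup>2)" for k \<omega>
  obtain \<rho> where \<rho>: "strict_mono \<rho>" "AE \<omega> in M. (\<lambda>k. X (\<rho> k) \<omega>) \<longlonglongrightarrow> 0"
    using tendsto_in_probability_AE_subseq[OF lim] unfolding X_def by blast
  obtain \<rho>' where \<rho>': "strict_mono \<rho>'" "AE \<omega> in M. (\<lambda>k. simple_ito_integral W (n (\<rho> (\<rho>' k))) (p (\<rho> (\<rho>' k))) (\<xi> (\<rho> (\<rho>' k))) v \<omega>) \<longlonglongrightarrow> Y \<omega>"
    using tendsto_in_probability_AE_subseq[OF tendsto_in_probability_subseq[OF limI \<rho>(1)]] by blast
  define raw where "raw k = map (\<lambda>i. (p k i, p k (Suc i), \<xi> k i)) [0..<n k]" for k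
  have p0: "0 \<le> p k i \<and> p k i \<le> p k (n k)" if "i \<le> n k" for k i
  proof -
    have st: "p k j \<le> p k (Suc j)" if "j < n k" for j
      using simple[of k] that unfolding simple_integrand_def by (auto intro: less_imp_le)
    have "p k 0 \<le> p k i" using that by (induction i) (auto intro: order_trans[OF _ st])
    moreover have "p k i \<le> p k (n k)" using that by (induction rule: inc_induct) (auto intro: order_trans[OF st])
    ultimately show ?thesis using simple[of k] unfolding simple_integrand_def by auto
  qed
  \<comment> \<open>The partition may reach beyond \<open>v\<close>, so the list is admissible only
    up to the larger of the two times; \<open>elem_before v\<close> cuts it afterwards.\<close>
  have adm: "elem_adm F 0 (max v (p k (n k))) (raw k)" for k
  proof -
    have "0 \<le> p k i" "p k (Suc i) \<le> p k (n k)" "p k i \<le> p k (Suc i)" "\<xi> k i \<in> borel_measurable (F (p k i))"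
      if "i < n k" for i
      using p0[of i k] p0[of "Suc i" k] that simple[of k] unfolding simple_integrand_def by (auto intro: less_imp_le)
    then show ?thesis unfolding elem_adm_def raw_def by (auto intro: max.coboundedI2)
  qed
  have raw_proc: "elem_proc (raw k) r \<omega> = simple_process (n k) (p k) (\<xi> k) r \<omega>" for k r \<omega>
    unfolding raw_def simple_process_def by (rule elem_proc_of_upt)
  have raw_int: "elem_int W (elem_before v (raw k)) \<omega> = simple_ito_integral W (n k) (p k) (\<xi> k) v \<omega>" for k \<omega>
  proof -
    have "elem_before v (raw k) = map (\<lambda>i. (min v (p k i), min v (p k (Suc i)), if p k i < v then \<xi> k i else (\<lambda>_. 0))) [0..<n k]"
      by (simp add: elem_before_def raw_def)
    then have "elem_int W (elem_before v (raw k)) \<omega> =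
      (\<Sum>i<n k. (if p k i < v then \<xi> k i else (\<lambda>_. 0)) \<omega> * (W (min v (p k (Suc i))) \<omega> - W (min v (p k i)) \<omega>))"
      by (simp only: elem_int_of_upt)
    also have "\<dots> = simple_ito_integral W (n k) (p k) (\<xi> k) v \<omega>"
      unfolding simple_ito_integral_def
    proof (intro sum.cong refl)
      fix i assume "i \<in> {..<n k}"
      then have "p k i \<le> p k (Suc i)" using simple[of k] unfolding simple_integrand_def by (auto intro: less_imp_le)
      then show "(if p k i < v then \<xi> k i else (\<lambda>_. 0)) \<omega> * (W (min v (p k (Suc i))) \<omega> - W (min v (p k i)) \<omega>) =
        \<xi> k i \<omega> * (W (min v (p k (Suc i))) \<omega> - W (min v (p k i)) \<omega>)"
        by (auto simp: min_absorb1)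
    qed
    finally show ?thesis .
  qed
  \<comment> \<open>A Bochner integral defaults to 0 off the integrable functions, so the energy is
    identified with \<open>X k \<omega>\<close> only where the path of \<open>H\<close> is square
    integrable. The simple integrand is bounded along the path by the sum \<open>c\<close> of its
    coefficients in absolute value.\<close>
  have energy: "energy 0 v (\<lambda>r. elem_proc (elem_before v (raw k)) r \<omega> - D r \<omega>) = ennreal (X k \<omega>)"
    if \<omega>: "\<omega> \<in> space M" and H2: "set_integrable lborel {0..v} (\<lambda>s. (H s \<omega>)\<^sup>2)" for k \<omega>
  proof -
    note [measurable] = D[OF \<omega>]
    define f where "f r = indicator {0..v} r * (elem_proc (raw k) r \<omega> - D r \<omega>)\<^sup>2" for r
    have [measurable]: "f \<in> borel_measurable borel" unfolding f_def by measurable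
    define c where "c = (\<Sum>i<n k. \<bar>\<xi> k i \<omega>\<bar>)"
    have c: "(elem_proc (raw k) r \<omega>)\<^sup>2 \<le> c\<^sup>2" for r
    proof -
      have "\<bar>elem_proc (raw k) r \<omega>\<bar> \<le> c"
        unfolding raw_proc simple_process_def c_def
        by (intro order_trans[OF sum_abs] sum_mono) (auto simp: indicator_def)
      then show ?thesis by (metis abs_ge_zero power2_abs power_mono)
    qed
    have "integrable lborel (\<lambda>r. (2 * c\<^sup>2) * indicator {0..v} r + 2 * (indicator {0..v} r *\<^sub>R (H r \<omega>)\<^sup>2))"
      using H2 unfolding set_integrable_def
      by (intro Bochner_Integration.integrable_add integrable_mult_right integrable_real_indicator) (use \<open>0 \<le> v\<close> in auto)
    then have f_int: "integrable lborel f"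
    proof (rule Bochner_Integration.integrable_bound)
      show "AE r in lborel. norm (f r) \<le> norm ((2 * c\<^sup>2) * indicator {0..v} r + 2 * (indicator {0..v} r *\<^sub>R (H r \<omega>)\<^sup>2))"
      proof (intro AE_I2)
        fix r
        have "(elem_proc (raw k) r \<omega> + - H r \<omega>)\<^sup>2 \<le> 2 * c\<^sup>2 + 2 * (H r \<omega>)\<^sup>2"
          using power2_add_le[of "elem_proc (raw k) r \<omega>" "- H r \<omega>"] c[of r] by simp
        then show "norm (f r) \<le> norm ((2 * c\<^sup>2) * indicator {0..v} r + 2 * (indicator {0..v} r *\<^sub>R (H r \<omega>)\<^sup>2))"
          using DH[OF \<omega>] by (auto simp: f_def indicator_def)
      qed
    qed simp
    have "energy 0 v (\<lambda>r. elem_proc (elem_before v (raw k)) r \<omega> - D r \<omega>) = energy 0 v (\<lambda>r. elem_proc (raw k) r \<omega> - D r \<omega>)"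
      by (intro energy_cong) (simp add: elem_before_proc)
    also have "\<dots> = (\<integral>\<^sup>+r. ennreal (f r) \<partial>lborel)"
      unfolding energy_def
    proof (intro nn_integral_cong_AE)
      show "AE r in lborel. ennreal ((elem_proc (raw k) r \<omega> - D r \<omega>)\<^sup>2) * indicator {0<..v} r = ennreal (f r)"
        using AE_lborel_singleton[of "0::real"]
        by eventually_elim (auto simp: f_def indicator_def)
    qed
    also have "\<dots> = ennreal (\<integral>r. f r \<partial>lborel)"
      by (intro nn_integral_eq_integral[OF f_int]) (auto simp: f_def)
    also have "(\<integral>r. f r \<partial>lborel) = X k \<omega>"
      unfolding X_def set_lebesgue_integral_def f_def raw_proc
      by (intro Bochner_Integration.integral_cong) (auto simp: indicator_def DH[OF \<omega>])
    finally show ?thesis .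
  qed
  show ?thesis
  proof (rule ito_pairI)
    show "elem_adm F 0 v (elem_before v (raw (\<rho> (\<rho>' k))))" for k
      using adm \<open>0 \<le> v\<close> by (intro elem_before_adm)
    show "AE \<omega> in M. (\<lambda>k. energy 0 v (\<lambda>r. elem_proc (elem_before v (raw (\<rho> (\<rho>' k)))) r \<omega> - D r \<omega>)) \<longlonglongrightarrow> 0 \<and>
          (\<lambda>k. elem_int W (elem_before v (raw (\<rho> (\<rho>' k)))) \<omega>) \<longlonglongrightarrow> Y \<omega>"
      using \<rho>(2) \<rho>'(2) int AE_space
    proof eventually_elim
      case (elim \<omega>)
      have "(\<lambda>k. ennreal (X (\<rho> (\<rho>' k)) \<omega>)) \<longlonglongrightarrow> ennreal 0"
        using LIMSEQ_subseq_LIMSEQ[OF elim(1) \<rho>'(1)] by (intro tendsto_ennrealI) (simp add: o_def)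
      then show ?case using elim by (simp add: energy raw_int)
    qed
  qed (rule D)
qed

end

section \<open>Logarithms along uniform grids\<close>

text \<open>There are \<open>Suc n\<close> cells, indexed by \<open>i \<le> n\<close>, so that every
  \<open>n\<close> is admissible and no division by zero occurs.\<close>

definition grid :: "real \<Rightarrow> real \<Rightarrow> nat \<Rightarrow> nat \<Rightarrow> real" where
  "grid a t n i = a + (t - a) * real i / real (Suc n)"

lemma grid_0 [simp]: "grid a t n 0 = a"
  by (simp add: grid_def)

lemma grid_Suc_n [simp]: "grid a t n (Suc n) = t"
  by (simp add: grid_def del: of_nat_Suc)

lemma grid_mono: "a \<le> t \<Longrightarrow> i \<le> j \<Longrightarrow> grid a t n i \<le> grid a t n j"
  unfolding grid_def by (intro add_left_mono divide_right_mono mult_left_mono) auto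

lemma grid_bounds:
  assumes "a \<le> t" "i \<le> Suc n"
  shows "a \<le> grid a t n i" "grid a t n i \<le> t"
  using grid_mono[OF assms(1), of 0 i n] grid_mono[OF assms(1) assms(2), of n] by auto

lemma grid_step: "grid a t n (Suc i) - grid a t n i = (t - a) / real (Suc n)"
  unfolding grid_def by (simp add: field_simps del: of_nat_Suc) (simp add: algebra_simps)

text \<open>The arguments of \<open>\<Phi>\<close> are the left end, the right end and an
  intermediate point of a cell. On fine cells they are close to the diagonal, where
  \<open>\<Phi>\<close> vanishes, and \<open>\<Phi>\<close> is uniformly continuous on the compact
  cube. Weights, returns and drift errors all take this form.\<close>

lemma grid_uniform:
  fixes \<Phi> :: "real \<times> real \<times> real \<Rightarrow> real"
  assumes "a < t" and cont: "continuous_on ({a..t} \<times> {a..t} \<times> {a..t}) \<Phi>"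
    and diag: "\<And>u. u \<in> {a..t} \<Longrightarrow> \<Phi> (u, u, u) = 0" and "0 < \<eta>"
  shows "\<forall>\<^sub>F n in sequentially. \<forall>i\<le>n. \<forall>u\<in>{grid a t n i..grid a t n (Suc i)}.
    \<bar>\<Phi> (grid a t n i, grid a t n (Suc i), u)\<bar> \<le> \<eta>"
proof -
  have "uniformly_continuous_on ({a..t} \<times> {a..t} \<times> {a..t}) \<Phi>"
    using cont by (intro compact_uniformly_continuous compact_Times) auto
  then obtain d where d: "0 < d" "\<And>x y. x \<in> {a..t} \<times> {a..t} \<times> {a..t} \<Longrightarrow> y \<in> {a..t} \<times> {a..t} \<times> {a..t} \<Longrightarrow>
      dist y x < d \<Longrightarrow> dist (\<Phi> y) (\<Phi> x) < \<eta>"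
    using \<open>0 < \<eta>\<close> unfolding uniformly_continuous_on_def by metis
  have "(\<lambda>n. (t - a) / real (Suc n)) \<longlonglongrightarrow> 0"
    by (intro LIMSEQ_Suc[OF lim_const_over_n])
  then have "\<forall>\<^sub>F n in sequentially. (t - a) / real (Suc n) < d / 2"
    using d(1) by (intro order_tendstoD) auto
  then show ?thesis
  proof eventually_elim
    case (elim n)
    show ?case
    proof (intro allI impI ballI)
      fix i u assume i: "i \<le> n" and u: "u \<in> {grid a t n i..grid a t n (Suc i)}"
      let ?x = "grid a t n i" and ?y = "grid a t n (Suc i)"
      have b: "?x \<in> {a..t}" "?y \<in> {a..t}" using grid_bounds[of a t i n] grid_bounds[of a t "Suc i" n] i \<open>a < t\<close> by auto
      have "u \<in> {a..t}" using u b by auto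
      have "dist (?x, ?y, u) (?x, ?x, ?x) \<le> \<bar>?y - ?x\<bar> + \<bar>u - ?x\<bar>"
        by (simp add: dist_Pair_Pair dist_real_def sqrt_sum_squares_le_sum_abs)
      also have "\<dots> < d"
      proof -
        define h where "h = (t - a) / real (Suc n)"
        have "?y - ?x = h" "h < d / 2" using grid_step[of a t n i] elim by (simp_all only: h_def)
        then show ?thesis using u by auto
      qed
      finally have "dist (\<Phi> (?x, ?y, u)) (\<Phi> (?x, ?x, ?x)) < \<eta>"
        using b \<open>u \<in> {a..t}\<close> by (intro d(2)) auto
      then show "\<bar>\<Phi> (?x, ?y, u)\<bar> \<le> \<eta>" using diag[OF b(1)] by (simp add: dist_real_def)
    qed
  qed
qed

text \<open>The upper half rests on \<open>exp (- x) \<le> 1 / (1 + x)\<close> and on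
  \<open>(1 - x + x\<^sup>2) * (1 + x) = 1 + x ^ 3\<close>.\<close>

lemma exp_neg_expansion_bound: "0 \<le> (x::real) \<Longrightarrow> \<bar>exp (- x) - 1 + x\<bar> \<le> x\<^sup>2"
proof -
  assume x: "0 \<le> x"
  have "1 - x \<le> exp (- x)" using exp_ge_add_one_self[of "- x"] by simp
  moreover have "exp (- x) \<le> 1 - x + x\<^sup>2"
  proof -
    have "exp (- x) = 1 / exp x" by (simp add: exp_minus divide_inverse)
    also have "\<dots> \<le> 1 / (1 + x)"
      using exp_ge_add_one_self[of x] x by (intro divide_left_mono) (auto simp: add.commute)
    also have "\<dots> \<le> 1 - x + x\<^sup>2"
    proof -
      have "1 \<le> (1 - x + x\<^sup>2) * (1 + x)" using x by (simp add: algebra_simps power2_eq_square)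
      then show ?thesis using x by (simp add: divide_le_eq)
    qed
    finally show ?thesis .
  qed
  ultimately show ?thesis by simp
qed

text \<open>\<open>s\<close> is a price path, \<open>R\<close> the integrated rate and \<open>P\<close> the accumulated drift, the integral of
  \<open>s\<close> against \<open>R\<close>.\<close>

locale positive_path =
  fixes a t :: real and s R P :: "real \<Rightarrow> real"
  assumes a_t: "a < t"
    and s_cont: "continuous_on {a..t} s" and s_pos: "\<And>u. a \<le> u \<Longrightarrow> u \<le> t \<Longrightarrow> 0 < s u"
    and R_a: "R a = 0" and R_cont: "continuous_on {a..t} R"
    and R_mono: "\<And>x y. a \<le> x \<Longrightarrow> x \<le> y \<Longrightarrow> y \<le> t \<Longrightarrow> R x \<le> R y"
    and P: "\<And>x y c \<eta>. a \<le> x \<Longrightarrow> x \<le> y \<Longrightarrow> y \<le> t \<Longrightarrow> (\<And>u. x \<le> u \<Longrightarrow> u \<le> y \<Longrightarrow> \<bar>s u - c\<bar> \<le> \<eta>) \<Longrightarrow>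
      \<bar>P y - P x - c * (R y - R x)\<bar> \<le> \<eta> * (R y - R x)"
begin

abbreviation "q \<equiv> grid a t"

definition disc :: "real \<Rightarrow> real" where
  "disc u = exp (- R u) * s u / s a"

definition ret :: "nat \<Rightarrow> nat \<Rightarrow> real" where
  "ret n i = disc (q n (Suc i)) / disc (q n i) - 1"

text \<open>For a price path, the increment of \<open>s - P\<close> is that of the stochastic
  integral of \<open>S \<delta>\<close>; divided by the price at the left end it approximates an
  increment of the integral of \<open>\<delta>\<close>. In contrast, \<open>ret\<close> is the
  actual return of the discounted price.\<close>

definition mret :: "nat \<Rightarrow> nat \<Rightarrow> real" where
  "mret n i = ((s (q n (Suc i)) - P (q n (Suc i))) - (s (q n i) - P (q n i))) / s (q n i)"

definition err :: "nat \<Rightarrow> real" where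
  "err n = (\<Sum>i\<le>n. \<bar>ret n i - mret n i\<bar>)"

lemma q_bounds: "i \<le> Suc n \<Longrightarrow> a \<le> q n i" "i \<le> Suc n \<Longrightarrow> q n i \<le> t"
  using a_t by (auto intro: grid_bounds)

lemma disc_a: "disc a = 1"
  using s_pos[of a] a_t by (simp add: disc_def R_a)

lemma disc_pos: "a \<le> u \<Longrightarrow> u \<le> t \<Longrightarrow> 0 < disc u"
  using s_pos[of a] s_pos[of u] a_t by (simp add: disc_def)

lemma disc_cont: "continuous_on {a..t} disc"
  unfolding disc_def using s_pos[of a] a_t
  by (intro continuous_intros s_cont R_cont) auto

lemma cont_fst: "continuous_on {a..t} f \<Longrightarrow> continuous_on ({a..t} \<times> {a..t} \<times> {a..t}) (\<lambda>z. f (fst z))"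
  and cont_fst_snd: "continuous_on {a..t} f \<Longrightarrow> continuous_on ({a..t} \<times> {a..t} \<times> {a..t}) (\<lambda>z. f (fst (snd z)))"
  and cont_snd_snd: "continuous_on {a..t} f \<Longrightarrow> continuous_on ({a..t} \<times> {a..t} \<times> {a..t}) (\<lambda>z. f (snd (snd z)))"
  for f :: "real \<Rightarrow> real"
  by (rule continuous_on_compose2[of "{a..t}" f]; auto intro!: continuous_intros)+

text \<open>The integrand behind a weighted \<open>mret\<close> carries the running price
  \<open>s u\<close> over the price frozen at the left end. This shows that such a partly frozen
  weight can be replaced by the running weight \<open>\<psi> (disc u)\<close>.\<close>

lemma weight_close:
  assumes \<psi>: "continuous_on {0<..} \<psi>" and "0 < \<eta>"
  shows "\<forall>\<^sub>F n in sequentially. \<forall>i\<le>n. \<forall>u\<in>{q n i..q n (Suc i)}.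
    \<bar>\<psi> (disc (q n i)) / s (q n i) * s u - \<psi> (disc u)\<bar> \<le> \<eta>"
proof -
  have \<psi>': "continuous_on {a..t} (\<lambda>u. \<psi> (disc u))"
    by (rule continuous_on_compose2[OF \<psi> disc_cont]) (auto simp: disc_pos)
  have "\<forall>\<^sub>F n in sequentially. \<forall>i\<le>n. \<forall>u\<in>{q n i..q n (Suc i)}.
    \<bar>(\<lambda>z. \<psi> (disc (fst z)) / s (fst z) * s (snd (snd z)) - \<psi> (disc (snd (snd z)))) (q n i, q n (Suc i), u)\<bar> \<le> \<eta>"
  proof (rule grid_uniform[OF a_t _ _ \<open>0 < \<eta>\<close>])
    show "continuous_on ({a..t} \<times> {a..t} \<times> {a..t}) (\<lambda>z. \<psi> (disc (fst z)) / s (fst z) * s (snd (snd z)) - \<psi> (disc (snd (snd z))))"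
      by (intro continuous_intros cont_fst[OF \<psi>'] cont_snd_snd[OF \<psi>'] cont_fst[OF s_cont] cont_snd_snd[OF s_cont])
         (use s_pos in force)
  qed (use s_pos in \<open>auto simp: less_imp_neq[symmetric]\<close>)
  then show ?thesis by simp
qed

lemma ret_small:
  assumes "0 < \<eta>"
  shows "\<forall>\<^sub>F n in sequentially. \<forall>i\<le>n. \<bar>ret n i\<bar> \<le> \<eta>"
proof -
  have "\<forall>\<^sub>F n in sequentially. \<forall>i\<le>n. \<forall>u\<in>{q n i..q n (Suc i)}.
    \<bar>(\<lambda>z. disc (fst (snd z)) / disc (fst z) - 1) (q n i, q n (Suc i), u)\<bar> \<le> \<eta>"
  proof (rule grid_uniform[OF a_t _ _ \<open>0 < \<eta>\<close>])
    show "continuous_on ({a..t} \<times> {a..t} \<times> {a..t}) (\<lambda>z. disc (fst (snd z)) / disc (fst z) - 1)"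
      by (intro continuous_intros cont_fst[OF disc_cont] cont_fst_snd[OF disc_cont])
         (use disc_pos in force)
  qed (use disc_pos in \<open>auto simp: less_imp_neq[symmetric]\<close>)
  then show ?thesis
  proof eventually_elim
    case (elim n)
    have "\<bar>ret n i\<bar> \<le> \<eta>" if "i \<le> n" for i
      using elim[rule_format, OF that, of "q n i"] grid_mono[of a t i "Suc i" n] a_t by (simp add: ret_def)
    then show ?case by blast
  qed
qed

text \<open>Discounting cancels the drift to first order. Per cell there remain the quadratic
  remainder of the exponential and the oscillation of \<open>s\<close> inside the drift, each at
  most \<open>\<eta>\<close> times the increment of \<open>R\<close>, and the increments of
  \<open>R\<close> telescope.\<close>

lemma err_tendsto_0: "err \<longlonglongrightarrow> 0"
proof (rule LIMSEQ_I)
  fix \<epsilon> :: real assume "0 < \<epsilon>"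
  \<comment> \<open>The total error will be \<open>2 * \<eta> * R t\<close>; the \<open>+ 1\<close>
    covers the case \<open>R t = 0\<close>.\<close>
  define \<eta> where "\<eta> = \<epsilon> / (2 * (R t + 1))"
  have "0 \<le> R t" using R_mono[of a t] a_t R_a by simp
  then have "0 < \<eta>" using \<open>0 < \<epsilon>\<close> by (simp add: \<eta>_def)
  have "\<forall>\<^sub>F n in sequentially. \<forall>i\<le>n. \<forall>u\<in>{q n i..q n (Suc i)}.
    \<bar>(\<lambda>z. (s (snd (snd z)) - s (fst (snd z))) / s (fst z)) (q n i, q n (Suc i), u)\<bar> \<le> \<eta>"
  proof (rule grid_uniform[OF a_t _ _ \<open>0 < \<eta>\<close>])
    show "continuous_on ({a..t} \<times> {a..t} \<times> {a..t}) (\<lambda>z. (s (snd (snd z)) - s (fst (snd z))) / s (fst z))"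
      by (intro continuous_intros cont_fst[OF s_cont] cont_fst_snd[OF s_cont] cont_snd_snd[OF s_cont])
         (use s_pos in force)
  qed simp
  moreover have "\<forall>\<^sub>F n in sequentially. \<forall>i\<le>n. \<forall>u\<in>{q n i..q n (Suc i)}.
    \<bar>(\<lambda>z. (R (fst (snd z)) - R (fst z)) * s (fst (snd z)) / s (fst z)) (q n i, q n (Suc i), u)\<bar> \<le> \<eta>"
  proof (rule grid_uniform[OF a_t _ _ \<open>0 < \<eta>\<close>])
    show "continuous_on ({a..t} \<times> {a..t} \<times> {a..t}) (\<lambda>z. (R (fst (snd z)) - R (fst z)) * s (fst (snd z)) / s (fst z))"
      by (intro continuous_intros cont_fst[OF s_cont] cont_fst_snd[OF s_cont] cont_fst[OF R_cont] cont_fst_snd[OF R_cont])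
         (use s_pos in force)
  qed simp
  ultimately have "\<forall>\<^sub>F n in sequentially. norm (err n - 0) < \<epsilon>"
  proof eventually_elim
    case (elim n)
    have "\<bar>ret n i - mret n i\<bar> \<le> 2 * \<eta> * (R (q n (Suc i)) - R (q n i))" if i: "i \<le> n" for i
    proof -
      let ?x = "q n i" and ?y = "q n (Suc i)"
      have xy: "a \<le> ?x" "?x \<le> ?y" "?y \<le> t"
        using q_bounds[of i n] q_bounds[of "Suc i" n] grid_mono[of a t i "Suc i" n] a_t i by auto
      then have pos: "0 < s ?x" "0 < s ?y" "0 < s a" using s_pos a_t by auto
      define \<Delta> where "\<Delta> = R ?y - R ?x"
      have \<Delta>: "0 \<le> \<Delta>" using R_mono xy by (simp add: \<Delta>_def)
      have "disc ?y / disc ?x = exp (- \<Delta>) * s ?y / s ?x"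
        using pos by (simp add: disc_def \<Delta>_def exp_diff exp_minus field_simps)
      \<comment> \<open>The term \<open>\<Delta> * s ?y / s ?x\<close> is added and subtracted: it
        completes the expansion of the exponential and is the relative drift computed with the price
        frozen at the right end.\<close>
      then have eq: "ret n i - mret n i = (exp (- \<Delta>) - 1 + \<Delta>) * (s ?y / s ?x) + (P ?y - P ?x - s ?y * \<Delta>) / s ?x"
        using pos by (simp add: ret_def mret_def field_simps)
      have "\<bar>(exp (- \<Delta>) - 1 + \<Delta>) * (s ?y / s ?x)\<bar> \<le> \<Delta>\<^sup>2 * (s ?y / s ?x)"
        using exp_neg_expansion_bound[OF \<Delta>] pos by (simp add: abs_mult mult_right_mono divide_right_mono)
      also have "\<dots> = \<Delta> * (\<Delta> * s ?y / s ?x)" by (simp add: power2_eq_square)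
      also have "\<dots> \<le> \<Delta> * \<eta>"
      proof (rule mult_left_mono[OF _ \<Delta>])
        have "\<bar>\<Delta> * s ?y / s ?x\<bar> \<le> \<eta>" using elim(2) i xy by (force simp: \<Delta>_def)
        then show "\<Delta> * s ?y / s ?x \<le> \<eta>" by (rule abs_le_D1)
      qed
      finally have 1: "\<bar>(exp (- \<Delta>) - 1 + \<Delta>) * (s ?y / s ?x)\<bar> \<le> \<Delta> * \<eta>" .
      have "\<bar>P ?y - P ?x - s ?y * (R ?y - R ?x)\<bar> \<le> (\<eta> * s ?x) * (R ?y - R ?x)"
      proof (rule P[OF xy])
        fix u assume "?x \<le> u" "u \<le> ?y"
        then have "\<bar>(s u - s ?y) / s ?x\<bar> \<le> \<eta>" using elim(1) i by force
        then show "\<bar>s u - s ?y\<bar> \<le> \<eta> * s ?x" using pos by (simp add: divide_le_eq)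
      qed
      then have 2: "\<bar>(P ?y - P ?x - s ?y * \<Delta>) / s ?x\<bar> \<le> \<Delta> * \<eta>"
        using pos by (simp add: \<Delta>_def divide_le_eq mult_ac)
      show ?thesis unfolding eq using abs_triangle_ineq[of "(exp (- \<Delta>) - 1 + \<Delta>) * (s ?y / s ?x)" "(P ?y - P ?x - s ?y * \<Delta>) / s ?x"] 1 2
        by (simp add: \<Delta>_def algebra_simps)
    qed
    then have "err n \<le> (\<Sum>i\<le>n. 2 * \<eta> * (R (q n (Suc i)) - R (q n i)))"
      unfolding err_def by (intro sum_mono) auto
    also have "\<dots> = 2 * \<eta> * (\<Sum>i<Suc n. R (q n (Suc i)) - R (q n i))"
      by (simp add: sum_distrib_left lessThan_Suc_atMost)
    also have "\<dots> = 2 * \<eta> * R t" by (subst sum_lessThan_telescope) (simp add: R_a)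
    also have "\<dots> < \<epsilon>" using \<open>0 \<le> R t\<close> \<open>0 < \<epsilon>\<close> by (simp add: \<eta>_def field_simps)
    finally show ?case by (simp add: err_def sum_nonneg)
  qed
  then show "\<exists>no. \<forall>n\<ge>no. norm (err n - 0) < \<epsilon>" by (simp add: eventually_sequentially)
qed

text \<open>\<open>ln (disc t)\<close> is the telescoping sum of \<open>ln (1 + ret n i)\<close>,
  and \<open>\<bar>ln (1 + z) - z\<bar> \<le> 2 * z\<^sup>2\<close> for
  \<open>\<bar>z\<bar> \<le> 1 / 2\<close>. Once \<open>err n < 1\<close>, each discrepancy between
  \<open>ret\<close> and \<open>mret\<close> dominates its own square; hence the constants
  \<open>4 = 2 * 2\<close> and \<open>5 = 1 + 2 * 2\<close>.\<close>

lemma ln_disc_bound: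
  "\<forall>\<^sub>F n in sequentially. \<bar>ln (disc t) - y\<bar> \<le> \<bar>(\<Sum>i\<le>n. mret n i) - y\<bar> + 4 * (\<Sum>i\<le>n. (mret n i)\<^sup>2) + 5 * err n"
proof -
  have "\<forall>\<^sub>F n in sequentially. \<forall>i\<le>n. \<bar>ret n i\<bar> \<le> 1 / 2" by (rule ret_small) simp
  moreover have "\<forall>\<^sub>F n in sequentially. err n < 1" using err_tendsto_0 by (rule order_tendstoD) simp
  ultimately show ?thesis
  proof eventually_elim
    case (elim n)
    have pos: "0 < disc (q n i)" if "i \<le> Suc n" for i using disc_pos q_bounds[of i n] that by simp
    have ln_sum: "ln (disc t) = (\<Sum>i\<le>n. ln (1 + ret n i))"
    proof -
      have "(\<Sum>i\<le>n. ln (1 + ret n i)) = (\<Sum>i<Suc n. ln (disc (q n (Suc i))) - ln (disc (q n i)))"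
        unfolding lessThan_Suc_atMost
      proof (intro sum.cong refl)
        fix i assume "i \<in> {..n}"
        then show "ln (1 + ret n i) = ln (disc (q n (Suc i))) - ln (disc (q n i))"
          using pos[of i] pos[of "Suc i"] by (simp add: ret_def ln_div)
      qed
      also have "\<dots> = ln (disc t)" by (subst sum_lessThan_telescope) (simp add: disc_a)
      finally show ?thesis ..
    qed
    have "\<bar>ln (1 + ret n i) - ret n i\<bar> \<le> 2 * (ret n i)\<^sup>2" if "i \<le> n" for i
    proof -
      have z: "\<bar>ret n i\<bar> \<le> 1 / 2" using elim that by auto
      then have "ln (1 + ret n i) \<le> ret n i" by (intro ln_add_one_self_le_self2) auto
      moreover have "ret n i - 2 * (ret n i)\<^sup>2 \<le> ln (1 + ret n i)"
      proof (cases "0 \<le> ret n i")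
        case True
        then have "ret n i - (ret n i)\<^sup>2 \<le> ln (1 + ret n i)"
          using z by (intro ln_one_plus_pos_lower_bound) auto
        then show ?thesis using zero_le_power2[of "ret n i"] by linarith
      next
        case False
        then have "- (- ret n i) - 2 * (- ret n i)\<^sup>2 \<le> ln (1 - (- ret n i))"
          using z by (intro ln_one_minus_pos_lower_bound) auto
        then show ?thesis by simp
      qed
      ultimately show ?thesis by simp
    qed
    then have A: "\<bar>ln (disc t) - (\<Sum>i\<le>n. ret n i)\<bar> \<le> 2 * (\<Sum>i\<le>n. (ret n i)\<^sup>2)"
      unfolding ln_sum sum_subtractf[symmetric] sum_distrib_left by (intro order_trans[OF sum_abs] sum_mono) auto
    have B: "\<bar>(\<Sum>i\<le>n. ret n i) - (\<Sum>i\<le>n. mret n i)\<bar> \<le> err n"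
      unfolding err_def sum_subtractf[symmetric] by (rule sum_abs)
    have "(ret n i)\<^sup>2 \<le> 2 * (mret n i)\<^sup>2 + 2 * \<bar>ret n i - mret n i\<bar>" if "i \<le> n" for i
    proof -
      have "\<bar>ret n i - mret n i\<bar> \<le> err n" unfolding err_def using that by (intro member_le_sum) auto
      then have "\<bar>ret n i - mret n i\<bar> \<le> 1" using elim by simp
      then have "(ret n i - mret n i)\<^sup>2 \<le> \<bar>ret n i - mret n i\<bar>"
        using mult_left_mono[of "\<bar>ret n i - mret n i\<bar>" 1 "\<bar>ret n i - mret n i\<bar>"] by (simp add: power2_eq_square flip: abs_mult)
      then show ?thesis using power2_add_le[of "mret n i" "ret n i - mret n i"] by simp
    qed
    then have C: "(\<Sum>i\<le>n. (ret n i)\<^sup>2) \<le> 2 * (\<Sum>i\<le>n. (mret n i)\<^sup>2) + 2 * err n"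
      unfolding err_def sum_distrib_left sum.distrib[symmetric] by (intro sum_mono) auto
    show ?case using A B C by linarith
  qed
qed

text \<open>With \<open>\<phi> x = m * ln (1 + x / m)\<close>, the weight is
  \<open>\<psi> x = x * \<phi>' x\<close>, and the tangent inequality of the concave
  \<open>\<phi>\<close> bounds each increment by \<open>\<psi>\<close> times the return. Concavity
  takes the place of the second-order term of an Ito formula, and
  \<open>0 \<le> \<psi> \<le> m\<close> on positive arguments keeps the energy of the weighted
  integrand under control.\<close>

lemma log_utility_bound:
  assumes "0 < m"
  defines "\<psi> \<equiv> \<lambda>x. x / (1 + x / m)"
  shows "m * ln (1 + disc t / m) - m * ln (1 + 1 / m) \<le> (\<Sum>i\<le>n. \<psi> (disc (q n i)) * mret n i) + m * err n"
proof -
  let ?\<phi> = "\<lambda>x. m * ln (1 + x / m)"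
  have pos: "0 < disc (q n i)" if "i \<le> Suc n" for i using disc_pos q_bounds[of i n] that by simp
  have "?\<phi> (disc t) - ?\<phi> 1 = (\<Sum>i<Suc n. ?\<phi> (disc (q n (Suc i))) - ?\<phi> (disc (q n i)))"
    by (subst sum_lessThan_telescope) (simp add: disc_a)
  also have "\<dots> \<le> (\<Sum>i<Suc n. \<psi> (disc (q n i)) * ret n i)"
  proof (intro sum_mono)
    fix i assume "i \<in> {..<Suc n}"
    then have p: "0 < disc (q n i)" "0 < disc (q n (Suc i))" using pos[of i] pos[of "Suc i"] by auto
    define x y where "x = disc (q n i)" and "y = disc (q n (Suc i))"
    have xy: "0 < x" "0 < y" using p by (simp_all add: x_def y_def)
    have "ln (1 + y / m) - ln (1 + x / m) = ln ((1 + y / m) / (1 + x / m))"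
      using xy \<open>0 < m\<close> add_pos_pos[OF zero_less_one divide_pos_pos[OF xy(1) \<open>0 < m\<close>]]
        add_pos_pos[OF zero_less_one divide_pos_pos[OF xy(2) \<open>0 < m\<close>]] by (simp add: ln_div)
    also have "\<dots> \<le> (1 + y / m) / (1 + x / m) - 1"
      using xy \<open>0 < m\<close> by (intro ln_le_minus_one divide_pos_pos add_pos_pos) auto
    finally have "m * (ln (1 + y / m) - ln (1 + x / m)) \<le> m * ((1 + y / m) / (1 + x / m) - 1)"
      using \<open>0 < m\<close> by simp
    also have "\<dots> = \<psi> x * (y / x - 1)"
    proof -
      have "0 < m + x" using xy \<open>0 < m\<close> by simp
      moreover have "1 + x / m = (m + x) / m" "1 + y / m = (m + y) / m"
        using \<open>0 < m\<close> by (simp_all add: field_simps)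
      ultimately have "(1 + y / m) / (1 + x / m) = (m + y) / (m + x)" "\<psi> x = x * m / (m + x)"
        using \<open>0 < m\<close> by (simp_all add: \<psi>_def)
      moreover have "(m + y) / (m + x) - 1 = (y - x) / (m + x)"
        using \<open>0 < m + x\<close> by (simp add: divide_diff_eq_iff)
      moreover have "y / x - 1 = (y - x) / x" using xy by (simp add: field_simps)
      ultimately show ?thesis using xy by simp
    qed
    finally show "?\<phi> (disc (q n (Suc i))) - ?\<phi> (disc (q n i)) \<le> \<psi> (disc (q n i)) * ret n i"
      by (simp add: x_def y_def ret_def right_diff_distrib)
  qed
  also have "\<dots> \<le> (\<Sum>i<Suc n. \<psi> (disc (q n i)) * mret n i + m * \<bar>ret n i - mret n i\<bar>)"
  proof (intro sum_mono)
    fix i assume "i \<in> {..<Suc n}"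
    then have x: "0 < disc (q n i)" using pos[of i] by auto
    have "0 \<le> \<psi> (disc (q n i))" "\<psi> (disc (q n i)) \<le> m"
      unfolding \<psi>_def using x \<open>0 < m\<close> by (auto simp: field_simps)
    then have "\<psi> (disc (q n i)) * (ret n i - mret n i) \<le> m * \<bar>ret n i - mret n i\<bar>"
      by (intro order_trans[OF mult_left_mono[OF abs_ge_self] mult_right_mono]) auto
    then show "\<psi> (disc (q n i)) * ret n i \<le> \<psi> (disc (q n i)) * mret n i + m * \<bar>ret n i - mret n i\<bar>"
      by (simp add: algebra_simps)
  qed
  also have "\<dots> = (\<Sum>i\<le>n. \<psi> (disc (q n i)) * mret n i) + m * err n"
    unfolding lessThan_Suc_atMost by (simp add: sum.distrib err_def sum_distrib_left)
  finally show ?thesis .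
qed

end

text \<open>Turns a bound for every \<open>\<eta>\<close> into one with a single null sequence, the
  form that the Fatou arguments expect.\<close>

lemma vanishing_excess:
  fixes x :: "nat \<Rightarrow> ennreal"
  assumes "\<And>\<eta> :: real. 0 < \<eta> \<Longrightarrow> \<forall>\<^sub>F n in sequentially. x n \<le> y + ennreal \<eta>"
  shows "\<exists>d. d \<longlonglongrightarrow> 0 \<and> (\<forall>\<^sub>F n in sequentially. x n \<le> y + d n)"
proof (cases "y = top")
  case True
  then show ?thesis by (intro exI[of _ "\<lambda>_. 0"]) auto
next
  case False
  have "(\<lambda>n. x n - y) \<longlonglongrightarrow> 0"
  proof (rule order_tendstoI)
    fix c :: ennreal assume "0 < c"
    then obtain z where z: "0 < z" "z < c" using dense by blast
    then have "z < top" by (auto intro: less_le_trans)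
    then obtain \<eta> where "z = ennreal \<eta>" "0 \<le> \<eta>" by (cases z) auto
    then have \<eta>: "0 < \<eta>" "ennreal \<eta> < c" using z by auto
    from assms[OF \<eta>(1)] show "\<forall>\<^sub>F n in sequentially. x n - y < c"
    proof eventually_elim
      case (elim n)
      then have "x n - y \<le> ennreal \<eta>" using False by (simp add: ennreal_minus_le_iff)
      then show ?case using \<eta>(2) by (rule le_less_trans)
    qed
  qed simp
  moreover have "x n \<le> y + (x n - y)" for n
    by (cases "x n \<le> y") (auto simp: add_increasing2 add_diff_inverse_ennreal)
  ultimately show ?thesis by (intro exI[of _ "\<lambda>n. x n - y"]) auto
qed

lemma grid_cell:
  assumes "a < t" "a < u" "u \<le> t"
  obtains i where "i \<le> n" "grid a t n i < u" "u \<le> grid a t n (Suc i)"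
proof -
  define i where "i = (LEAST i. u \<le> grid a t n (Suc i))"
  have ex: "u \<le> grid a t n (Suc n)" using assms by simp
  have 1: "u \<le> grid a t n (Suc i)" unfolding i_def by (rule LeastI[of "\<lambda>i. u \<le> grid a t n (Suc i)", OF ex])
  have 2: "i \<le> n" unfolding i_def by (rule Least_le[of "\<lambda>i. u \<le> grid a t n (Suc i)", OF ex])
  have 3: "grid a t n i < u"
  proof (cases i)
    case 0 then show ?thesis using assms by simp
  next
    case (Suc j)
    then have "j < i" by simp
    then have "\<not> u \<le> grid a t n (Suc j)" unfolding i_def by (rule not_less_Least)
    then show ?thesis using Suc by simp
  qed
  show ?thesis using that[OF 2 3 1] .
qed

lemma sum_grid_cell:
  fixes f :: "nat \<Rightarrow> real"
  assumes "a < t" "i \<le> n" "grid a t n i < u" "u \<le> grid a t n (Suc i)"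
  shows "(\<Sum>j\<le>n. indicator {grid a t n j<..grid a t n (Suc j)} u * f j) = f i"
proof -
  have "indicator {grid a t n j<..grid a t n (Suc j)} u * f j = (if j = i then f i else 0)" for j
  proof (cases j i rule: linorder_cases)
    case less
    then have "grid a t n (Suc j) \<le> grid a t n i" using assms(1) by (intro grid_mono) auto
    then show ?thesis using assms less by auto
  next
    case greater
    then have "grid a t n (Suc i) \<le> grid a t n j" using assms(1) by (intro grid_mono) auto
    then show ?thesis using assms greater by auto
  qed (use assms in auto)
  then show ?thesis using assms(2) by simp
qed

section \<open>The price process\<close>

locale price_model = standard_brownian_motion M F W
  for M :: "'a measure" and F :: "real \<Rightarrow> 'a measure" and W :: "real \<Rightarrow> 'a \<Rightarrow> real" +
  fixes S \<delta> :: "real \<Rightarrow> 'a \<Rightarrow> real" and \<rho> :: "real \<Rightarrow> real"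
  assumes r_continuous: "continuous_on {0..} \<rho>"
    and r_positive: "\<And>t. 0 \<le> t \<Longrightarrow> 0 < \<rho> t"
    and \<delta>_adapted: "adapted F \<delta>"
    and S_adapted: "adapted F S"
    and S_continuous: "\<And>\<omega>. \<omega> \<in> space M \<Longrightarrow> continuous_on {0..} (\<lambda>t. S t \<omega>)"
    and S_positive: "\<And>t \<omega>. 0 \<le> t \<Longrightarrow> \<omega> \<in> space M \<Longrightarrow> 0 < S t \<omega>"
    and S_equation: "\<And>t. 0 \<le> t \<Longrightarrow>
          \<exists>I. has_ito_integral M F W (\<lambda>s \<omega>. S s \<omega> * \<delta> s \<omega>) t I \<and>
              (AE \<omega> in M. S t \<omega> = S 0 \<omega> + (LBINT s:{0..t}. \<rho> s * S s \<omega>) + I \<omega>)"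
begin

definition drift :: "real \<Rightarrow> 'a \<Rightarrow> real" where
  "drift u \<omega> = (LBINT s:{0..u}. \<rho> s * S s \<omega>)"

text \<open>A version of the integral is chosen separately for each time, without any regularity in
  \<open>u\<close>; the comparison with price paths uses it at grid points only, of which there are
  countably many.\<close>

definition mart :: "real \<Rightarrow> 'a \<Rightarrow> real" where
  "mart u = (SOME I. has_ito_integral M F W (\<lambda>s \<omega>. S s \<omega> * \<delta> s \<omega>) u I \<and>
              (AE \<omega> in M. S u \<omega> = S 0 \<omega> + drift u \<omega> + I \<omega>))"

definition rate :: "real \<Rightarrow> real \<Rightarrow> real" where
  "rate a u = (LBINT s:{a..u}. \<rho> s)"

lemma mart:
  assumes "0 \<le> u"
  shows "has_ito_integral M F W (\<lambda>s \<omega>. S s \<omega> * \<delta> s \<omega>) u (mart u)"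
    and "AE \<omega> in M. S u \<omega> = S 0 \<omega> + drift u \<omega> + mart u \<omega>"
  using someI_ex[OF S_equation[OF assms]] unfolding mart_def drift_def by auto

lemma mart_measurable [measurable]: "0 \<le> u \<Longrightarrow> mart u \<in> borel_measurable M"
  using mart(1)[of u] unfolding has_ito_integral_def tendsto_in_probability_def by blast

lemma S_F: "0 \<le> u \<Longrightarrow> S u \<in> borel_measurable (F u)"
  using S_adapted by (simp add: adapted_def)

lemma S_M [measurable]: "0 \<le> u \<Longrightarrow> S u \<in> borel_measurable M"
  using F_imp_M[OF _ S_F] .

lemma \<delta>_F: "0 \<le> u \<Longrightarrow> \<delta> u \<in> borel_measurable (F u)"
  using \<delta>_adapted by (simp add: adapted_def)

lemma set_integral_continuous:
  fixes f :: "real \<Rightarrow> real"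
  assumes "continuous_on {0..} f" "0 \<le> x"
  shows "(LBINT s:{x..y}. f s) = integral {x..y} f" "f integrable_on {x..y}"
proof -
  have c: "continuous_on {x..y} f" using assms by (auto intro: continuous_on_subset)
  have "set_integrable lborel {x..y} f"
    unfolding set_integrable_def using borel_integrable_atLeastAtMost'[OF c] by (simp add: set_integrable_def)
  then show "(LBINT s:{x..y}. f s) = integral {x..y} f" by (rule set_borel_integral_eq_integral(2))
  show "f integrable_on {x..y}" using c by (rule integrable_continuous_real)
qed

lemma rS_cont: "\<omega> \<in> space M \<Longrightarrow> continuous_on {0..} (\<lambda>s. \<rho> s * S s \<omega>)"
  by (intro continuous_on_mult r_continuous S_continuous)

lemma rate_diff:
  assumes "0 \<le> a" "a \<le> x" "x \<le> y"
  shows "rate a y - rate a x = integral {x..y} \<rho>"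
  using assms Henstock_Kurzweil_Integration.integral_combine[of a x y \<rho>]
  by (simp add: rate_def set_integral_continuous[OF r_continuous])

lemma drift_diff:
  assumes "\<omega> \<in> space M" "0 \<le> x" "x \<le> y"
  shows "drift y \<omega> - drift x \<omega> = integral {x..y} (\<lambda>s. \<rho> s * S s \<omega>)"
  using assms Henstock_Kurzweil_Integration.integral_combine[of 0 x y "\<lambda>s. \<rho> s * S s \<omega>"]
  by (simp add: drift_def set_integral_continuous[OF rS_cont])

text \<open>Holds for every path, not merely almost every one, since continuity and positivity of
  the price are assumed everywhere. The drift condition comes from \<open>\<bar>\<rho> s * (S s
  \<omega> - c)\<bar> \<le> \<eta> * \<rho> s\<close> under the integral.\<close>

lemma positive_path:
  assumes "0 \<le> a" "a < t" "\<omega> \<in> space M"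
  shows "positive_path a t (\<lambda>u. S u \<omega>) (rate a) (\<lambda>u. drift u \<omega>)"
proof
  show "a < t" by fact
  show "continuous_on {a..t} (\<lambda>u. S u \<omega>)"
    using S_continuous[OF assms(3)] assms by (auto intro: continuous_on_subset)
  show "0 < S u \<omega>" if "a \<le> u" "u \<le> t" for u using S_positive assms that by auto
  have "rate a a = integral {a..a} \<rho>"
    unfolding rate_def by (rule set_integral_continuous(1)[OF r_continuous assms(1)])
  then show "rate a a = 0" by simp
  have "continuous_on {a..t} (\<lambda>u. integral {a..u} \<rho>)"
    using set_integral_continuous(2)[OF r_continuous assms(1)] by (rule indefinite_integral_continuous_1)
  then show "continuous_on {a..t} (rate a)"
    by (rule continuous_on_eq) (use assms in \<open>simp add: rate_def set_integral_continuous[OF r_continuous]\<close>)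
  show "rate a x \<le> rate a y" if "a \<le> x" "x \<le> y" "y \<le> t" for x y
  proof -
    have "0 \<le> integral {x..y} \<rho>"
    proof (rule Henstock_Kurzweil_Integration.integral_nonneg)
      show "\<rho> integrable_on {x..y}" using that assms by (intro set_integral_continuous(2)[OF r_continuous]) auto
      show "0 \<le> \<rho> u" if "u \<in> {x..y}" for u using r_positive[of u] that \<open>a \<le> x\<close> assms(1) by auto
    qed
    then show ?thesis using rate_diff[of a x y] that assms by simp
  qed
  fix x y c \<eta> assume xy: "a \<le> x" "x \<le> y" "y \<le> t" and le: "\<And>u. x \<le> u \<Longrightarrow> u \<le> y \<Longrightarrow> \<bar>S u \<omega> - c\<bar> \<le> \<eta>"
  have x0: "0 \<le> x" using xy assms by simp
  note i1 = set_integral_continuous(2)[OF r_continuous x0, of y]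
    and i2 = set_integral_continuous(2)[OF rS_cont[OF assms(3)] x0, of y]
  have "drift y \<omega> - drift x \<omega> - c * (rate a y - rate a x) = integral {x..y} (\<lambda>s. \<rho> s * S s \<omega>) - c * integral {x..y} \<rho>"
    using drift_diff[OF assms(3) x0 xy(2)] rate_diff[OF assms(1) xy(1,2)] by simp
  also have "\<dots> = integral {x..y} (\<lambda>s. \<rho> s * S s \<omega> - c * \<rho> s)"
    by (subst Henstock_Kurzweil_Integration.integral_diff[OF i2 integrable_on_mult_right[OF i1]])
       (simp only: Henstock_Kurzweil_Integration.integral_mult_right)
  finally have eq: "drift y \<omega> - drift x \<omega> - c * (rate a y - rate a x) = integral {x..y} (\<lambda>s. \<rho> s * S s \<omega> - c * \<rho> s)" .
  have "norm (integral {x..y} (\<lambda>s. \<rho> s * S s \<omega> - c * \<rho> s)) \<le> integral {x..y} (\<lambda>s. \<eta> * \<rho> s)"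
  proof (rule integral_norm_bound_integral)
    show "(\<lambda>s. \<rho> s * S s \<omega> - c * \<rho> s) integrable_on {x..y}" "(\<lambda>s. \<eta> * \<rho> s) integrable_on {x..y}"
      by (intro Henstock_Kurzweil_Integration.integrable_diff integrable_on_mult_right i1 i2)+
    fix s assume s: "s \<in> {x..y}"
    have "norm (\<rho> s * S s \<omega> - c * \<rho> s) = \<rho> s * \<bar>S s \<omega> - c\<bar>"
    proof -
      have "\<rho> s * S s \<omega> - c * \<rho> s = \<rho> s * (S s \<omega> - c)" by (simp add: algebra_simps)
      then show ?thesis using r_positive[of s] s x0 by (simp add: abs_mult)
    qed
    also have "\<dots> \<le> \<rho> s * \<eta>" using le[of s] s r_positive[of s] x0 by (intro mult_left_mono) auto
    finally show "norm (\<rho> s * S s \<omega> - c * \<rho> s) \<le> \<eta> * \<rho> s" by (simp add: mult.commute)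
  qed
  also have "\<dots> = \<eta> * (rate a y - rate a x)" using rate_diff[OF assms(1) xy(1,2)] by simp
  finally show "\<bar>drift y \<omega> - drift x \<omega> - c * (rate a y - rate a x)\<bar> \<le> \<eta> * (rate a y - rate a x)"
    unfolding eq by simp
qed

end

context prob_space
begin

lemma energy_measurable:
  assumes [measurable]: "(\<lambda>(\<omega>, r). f r \<omega>) \<in> borel_measurable (M \<Otimes>\<^sub>M borel)"
  shows "(\<lambda>\<omega>. energy a t (\<lambda>r. f r \<omega>)) \<in> borel_measurable M"
proof -
  have "(\<lambda>(\<omega>, r). ennreal ((f r \<omega>)\<^sup>2) * indicator {a<..t} r) \<in> borel_measurable (M \<Otimes>\<^sub>M lborel)"
    by measurable
  from lborel.borel_measurable_nn_integral[OF this] show ?thesis by (simp add: energy_def)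
qed

lemma section_borel:
  assumes "(\<lambda>(\<omega>, r). f r \<omega>) \<in> borel_measurable (M \<Otimes>\<^sub>M borel)" "\<omega> \<in> space M"
  shows "(\<lambda>r. f r \<omega>) \<in> borel_measurable borel"
  using measurable_compose[OF measurable_Pair1'[OF assms(2)] assms(1)] by simp

end

context standard_brownian_motion
begin

lemma ito_pair_zero: "ito_pair M F W a t (\<lambda>_ _. 0) (\<lambda>_. 0)"
  by (rule ito_pairI[where xs = "\<lambda>_. []"]) (auto simp: energy_def)

lemma ito_pair_sum:
  assumes "\<And>i. i \<in> I \<Longrightarrow> ito_pair M F W a t (D i) (J i)" and "finite I"
  shows "ito_pair M F W a t (\<lambda>r \<omega>. \<Sum>i\<in>I. D i r \<omega>) (\<lambda>\<omega>. \<Sum>i\<in>I. J i \<omega>)"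
  using assms(2,1)
proof (induction I rule: finite_induct)
  case (insert i I)
  then show ?case using ito_pair_add[of a t "D i" "J i"] by simp
qed (simp add: ito_pair_zero)

end

section \<open>Step integrands for relative returns\<close>

context price_model
begin

text \<open>Clamping leaves the volatility unchanged between 0 and \<open>t\<close> and yields a
  process that is jointly measurable with time in the whole line.\<close>

definition vol :: "real \<Rightarrow> real \<Rightarrow> 'a \<Rightarrow> real" where
  "vol t r \<omega> = \<delta> (max 0 (min t r)) \<omega>"

definition price :: "real \<Rightarrow> real \<Rightarrow> 'a \<Rightarrow> real" where
  "price t r \<omega> = S (max 0 (min t r)) \<omega>"

definition dprice :: "real \<Rightarrow> real \<Rightarrow> 'a \<Rightarrow> real" where
  "dprice a u \<omega> = exp (- rate a u) * S u \<omega> / S a \<omega>"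

definition incr :: "real \<Rightarrow> real \<Rightarrow> nat \<Rightarrow> nat \<Rightarrow> 'a \<Rightarrow> real" where
  "incr a t n i \<omega> = (mart (grid a t n (Suc i)) \<omega> - mart (grid a t n i) \<omega>) / S (grid a t n i) \<omega>"

text \<open>The integrand \<open>S \<delta>\<close> keeps running inside a cell while its weight
  \<open>\<psi> / S\<close> is frozen at the left end. Three choices are used:
  \<open>\<psi> = 1\<close> with \<open>e\<close> a candidate for \<open>\<delta>\<close>,
  \<open>\<psi> = 1\<close> with signs \<open>\<epsilon>\<close> and \<open>e = 0\<close>, and
  \<open>\<psi> x = x / (1 + x / m)\<close> with \<open>e = 0\<close>.\<close>

definition step :: "real \<Rightarrow> real \<Rightarrow> (real \<Rightarrow> real) \<Rightarrow> (nat \<Rightarrow> real) \<Rightarrow> ('a \<Rightarrow> real) \<Rightarrow> nat \<Rightarrow> real \<Rightarrow> 'a \<Rightarrow> real" where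
  "step a t \<psi> \<epsilon> e n r \<omega> = (\<Sum>i\<le>n. indicator {grid a t n i<..grid a t n (Suc i)} r *
      (\<epsilon> i * (\<psi> (dprice a (grid a t n i) \<omega>) / S (grid a t n i) \<omega>) * (price t r \<omega> * vol t r \<omega>)))
      - e \<omega> * indicator {a<..t} r"

definition step_int :: "real \<Rightarrow> real \<Rightarrow> (real \<Rightarrow> real) \<Rightarrow> (nat \<Rightarrow> real) \<Rightarrow> ('a \<Rightarrow> real) \<Rightarrow> nat \<Rightarrow> 'a \<Rightarrow> real" where
  "step_int a t \<psi> \<epsilon> e n \<omega> = (\<Sum>i\<le>n. \<epsilon> i * \<psi> (dprice a (grid a t n i) \<omega>) * incr a t n i \<omega>) - e \<omega> * (W t \<omega> - W a \<omega>)"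

lemma price_joint [measurable]: "(\<lambda>(\<omega>, r). price t r \<omega>) \<in> borel_measurable (M \<Otimes>\<^sub>M borel)"
  unfolding price_def using S_M S_continuous by (rule continuous_process_clamp)

lemma price_pos: "\<omega> \<in> space M \<Longrightarrow> 0 < price t r \<omega>"
  by (simp add: price_def S_positive)

text \<open>Progressive measurability comes with the Ito integral and so concerns the product
  \<open>S \<delta>\<close>; dividing by the positive and jointly measurable price recovers
  \<open>\<delta>\<close>.\<close>

lemma vol_joint [measurable]:
  assumes "0 \<le> t"
  shows "(\<lambda>(\<omega>, r). vol t r \<omega>) \<in> borel_measurable (M \<Otimes>\<^sub>M borel)"
proof -
  have "progressively_measurable F (\<lambda>s \<omega>. S s \<omega> * \<delta> s \<omega>)"
    using mart(1)[OF assms] by (simp add: has_ito_integral_def)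
  from progressively_measurable_clamp[OF this assms subalgebra_F[OF assms]]
  have [measurable]: "(\<lambda>(\<omega>, r). price t r \<omega> * vol t r \<omega>) \<in> borel_measurable (M \<Otimes>\<^sub>M borel)"
    by (simp add: price_def vol_def)
  have "(\<lambda>(\<omega>, r). (price t r \<omega> * vol t r \<omega>) / price t r \<omega>) \<in> borel_measurable (M \<Otimes>\<^sub>M borel)"
    by measurable
  then show ?thesis
  proof (rule measurable_cong[THEN iffD1, rotated])
    fix x assume "x \<in> space (M \<Otimes>\<^sub>M (borel :: real measure))"
    then have "fst x \<in> space M" by (auto simp: space_pair_measure)
    from price_pos[OF this, of t "snd x"]
    show "(case x of (\<omega>, r) \<Rightarrow> (price t r \<omega> * vol t r \<omega>) / price t r \<omega>) = (case x of (\<omega>, r) \<Rightarrow> vol t r \<omega>)"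
      by (simp add: case_prod_beta')
  qed
qed

lemma dprice_F: "0 \<le> a \<Longrightarrow> a \<le> u \<Longrightarrow> dprice a u \<in> borel_measurable (F u)"
  unfolding dprice_def using F_imp_F[OF _ _ S_F, of a u] S_F[of u] by measurable

lemma dprice_disc:
  assumes "0 \<le> a" "a < t" "\<omega> \<in> space M"
  shows "dprice a u \<omega> = positive_path.disc a (\<lambda>u. S u \<omega>) (rate a) u"
  using positive_path.disc_def[OF positive_path[OF assms]] by (simp add: dprice_def)

lemma dprice_pos: "0 \<le> a \<Longrightarrow> a \<le> u \<Longrightarrow> \<omega> \<in> space M \<Longrightarrow> 0 < dprice a u \<omega>"
  using S_positive[of a \<omega>] S_positive[of u \<omega>] by (simp add: dprice_def)

text \<open>The integrals in the price equation all start at time 0; the difference rule moves the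
  start to \<open>s\<close>, as is needed to multiply by coefficients known only at
  \<open>s\<close>.\<close>

lemma ito_pair_mart:
  assumes "0 \<le> s" "s \<le> u" "u \<le> t"
  shows "ito_pair M F W s u (\<lambda>r \<omega>. price t r \<omega> * vol t r \<omega>) (\<lambda>\<omega>. mart u \<omega> - mart s \<omega>)"
proof -
  have t: "0 \<le> t" using assms by simp
  have "ito_pair M F W 0 v (\<lambda>r \<omega>. price t r \<omega> * vol t r \<omega>) (mart v)" if "0 \<le> v" "v \<le> t" for v
  proof (rule ito_pair_has_ito_integral[OF mart(1)[OF that(1)] that(1)])
    show "(\<lambda>r. price t r \<omega> * vol t r \<omega>) \<in> borel_measurable borel" if "\<omega> \<in> space M" for \<omega>
      using section_borel[OF price_joint that] section_borel[OF vol_joint[OF t] that] by measurable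
  qed (use that in \<open>simp add: price_def vol_def min_absorb2 max_absorb2\<close>)
  from ito_pair_diff[OF this[of s] this[of u]] show ?thesis using assms by auto
qed

lemma ito_pair_step:
  assumes "0 \<le> a" "a < t" and [measurable]: "\<psi> \<in> borel_measurable borel" and e: "e \<in> borel_measurable (F a)"
  shows "ito_pair M F W a t (step a t \<psi> \<epsilon> e n) (step_int a t \<psi> \<epsilon> e n)"
proof -
  let ?q = "grid a t n"
  have "ito_pair M F W a t
      (\<lambda>r \<omega>. indicator {?q i<..?q (Suc i)} r * ((\<epsilon> i * (\<psi> (dprice a (?q i) \<omega>) / S (?q i) \<omega>)) * (price t r \<omega> * vol t r \<omega>)))
      (\<lambda>\<omega>. (\<epsilon> i * (\<psi> (dprice a (?q i) \<omega>) / S (?q i) \<omega>)) * (mart (?q (Suc i)) \<omega> - mart (?q i) \<omega>))"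
    (is "ito_pair M F W a t (?D i) (?J i)")
    if "i \<in> {..n}" for i
  proof -
    have q: "a \<le> ?q i" "?q i \<le> ?q (Suc i)" "?q (Suc i) \<le> t"
      using that assms(2) by (auto intro!: grid_bounds grid_mono)
    have [measurable]: "dprice a (?q i) \<in> borel_measurable (F (?q i))" "S (?q i) \<in> borel_measurable (F (?q i))"
      using q assms by (auto intro!: dprice_F S_F)
    show ?thesis
      using q assms by (intro ito_pair_extend ito_pair_scale ito_pair_mart) auto
  qed
  then have 1: "ito_pair M F W a t
      (\<lambda>r \<omega>. \<Sum>i\<le>n. indicator {?q i<..?q (Suc i)} r * ((\<epsilon> i * (\<psi> (dprice a (?q i) \<omega>) / S (?q i) \<omega>)) * (price t r \<omega> * vol t r \<omega>)))
      (\<lambda>\<omega>. \<Sum>i\<le>n. (\<epsilon> i * (\<psi> (dprice a (?q i) \<omega>) / S (?q i) \<omega>)) * (mart (?q (Suc i)) \<omega> - mart (?q i) \<omega>))"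
    by (rule ito_pair_sum[where D = ?D and J = ?J]) auto
  have 2: "ito_pair M F W a t (\<lambda>r \<omega>. - e \<omega> * indicator {a<..t} r) (\<lambda>\<omega>. - e \<omega> * (W t \<omega> - W a \<omega>))"
    using assms e by (intro ito_pair_elem) auto
  have eq1: "(\<lambda>r \<omega>. (\<Sum>i\<le>n. indicator {?q i<..?q (Suc i)} r * ((\<epsilon> i * (\<psi> (dprice a (?q i) \<omega>) / S (?q i) \<omega>)) * (price t r \<omega> * vol t r \<omega>))) + - e \<omega> * indicator {a<..t} r)
    = step a t \<psi> \<epsilon> e n"
    by (simp add: fun_eq_iff step_def)
  have eq2: "(\<lambda>\<omega>. (\<Sum>i\<le>n. (\<epsilon> i * (\<psi> (dprice a (?q i) \<omega>) / S (?q i) \<omega>)) * (mart (?q (Suc i)) \<omega> - mart (?q i) \<omega>)) + - e \<omega> * (W t \<omega> - W a \<omega>))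
    = step_int a t \<psi> \<epsilon> e n"
    by (simp add: fun_eq_iff step_int_def incr_def)
  show ?thesis using ito_pair_add[OF 1 2] unfolding eq1 eq2 .
qed

lemma step_int_measurable:
  assumes "0 \<le> a" "a < t" and [measurable]: "\<psi> \<in> borel_measurable borel" and e: "e \<in> borel_measurable (F a)"
  shows "step_int a t \<psi> \<epsilon> e n \<in> borel_measurable M"
  unfolding step_int_def
proof (intro borel_measurable_diff borel_measurable_sum borel_measurable_times borel_measurable_const)
  fix i assume "i \<in> {..n}"
  then have q: "a \<le> grid a t n i" "a \<le> grid a t n (Suc i)"
    using assms(2) by (auto intro!: grid_bounds)
  have [measurable]: "dprice a (grid a t n i) \<in> borel_measurable M" "S (grid a t n i) \<in> borel_measurable M"
    "mart (grid a t n i) \<in> borel_measurable M" "mart (grid a t n (Suc i)) \<in> borel_measurable M"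
    using q assms F_imp_M[OF _ dprice_F] by auto
  show "(\<lambda>\<omega>. \<psi> (dprice a (grid a t n i) \<omega>)) \<in> borel_measurable M" by measurable
  show "incr a t n i \<in> borel_measurable M" unfolding incr_def by measurable
qed (use assms F_imp_M[OF _ e] in auto)

lemma step_joint:
  assumes "0 \<le> a" "a < t" and [measurable]: "\<psi> \<in> borel_measurable borel" and e: "e \<in> borel_measurable (F a)"
  shows "(\<lambda>(\<omega>, r). step a t \<psi> \<epsilon> e n r \<omega>) \<in> borel_measurable (M \<Otimes>\<^sub>M borel)"
proof -
  have [measurable]: "e \<in> borel_measurable M" using F_imp_M[OF _ e] assms by auto
  note [measurable] = vol_joint[of t]
  have t: "0 \<le> t" using assms by simp
  have "(\<lambda>x. indicator {grid a t n i<..grid a t n (Suc i)} (snd x) *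
      (\<epsilon> i * (\<psi> (dprice a (grid a t n i) (fst x)) / S (grid a t n i) (fst x)) * (price t (snd x) (fst x) * vol t (snd x) (fst x))))
      \<in> borel_measurable (M \<Otimes>\<^sub>M borel)" if "i \<le> n" for i
  proof -
    have q: "a \<le> grid a t n i" using that assms(2) by (auto intro!: grid_bounds)
    have [measurable]: "dprice a (grid a t n i) \<in> borel_measurable M" "S (grid a t n i) \<in> borel_measurable M"
      using q assms F_imp_M[OF _ dprice_F] by auto
    have [measurable]: "(\<lambda>x. price t (snd x) (fst x)) \<in> borel_measurable (M \<Otimes>\<^sub>M borel)"
      "(\<lambda>x. vol t (snd x) (fst x)) \<in> borel_measurable (M \<Otimes>\<^sub>M borel)"
      using price_joint vol_joint[OF t] by (simp_all add: case_prod_beta')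
    show ?thesis unfolding indicator_def greaterThanAtMost_iff by measurable
  qed
  then have [measurable]: "(\<lambda>x. \<Sum>i\<le>n. indicator {grid a t n i<..grid a t n (Suc i)} (snd x) *
      (\<epsilon> i * (\<psi> (dprice a (grid a t n i) (fst x)) / S (grid a t n i) (fst x)) * (price t (snd x) (fst x) * vol t (snd x) (fst x))))
      \<in> borel_measurable (M \<Otimes>\<^sub>M borel)"
    by (intro borel_measurable_sum) auto
  show ?thesis
    unfolding step_def case_prod_beta' indicator_def[of "{a<..t}"] greaterThanAtMost_iff by measurable
qed

text \<open>The factor 2 is that of \<open>ito_pair_second_moment\<close>. The signs are set to 1
  because admissible signs leave the energy unchanged; \<open>\<kappa>\<close> is known at time
  \<open>a\<close> and serves to localise and to rescale.\<close>

definition step_energy :: "real \<Rightarrow> real \<Rightarrow> (real \<Rightarrow> real) \<Rightarrow> ('a \<Rightarrow> real) \<Rightarrow> ('a \<Rightarrow> real) \<Rightarrow> nat \<Rightarrow> 'a \<Rightarrow> ennreal" where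
  "step_energy a t \<psi> e \<kappa> n \<omega> = 2 * energy a t (\<lambda>r. \<kappa> \<omega> * step a t \<psi> (\<lambda>_. 1) e n r \<omega>)"

lemma step_energy_measurable:
  assumes "0 \<le> a" "a < t" and "\<psi> \<in> borel_measurable borel" and "e \<in> borel_measurable (F a)" and \<kappa>: "\<kappa> \<in> borel_measurable (F a)"
  shows "step_energy a t \<psi> e \<kappa> n \<in> borel_measurable M"
proof -
  have [measurable]: "\<kappa> \<in> borel_measurable M" using F_imp_M[OF _ \<kappa>] assms by auto
  note [measurable] = step_joint[OF assms(1-4)]
  have "(\<lambda>(\<omega>, r). \<kappa> \<omega> * step a t \<psi> (\<lambda>_. 1) e n r \<omega>) \<in> borel_measurable (M \<Otimes>\<^sub>M borel)" by measurable
  from energy_measurable[OF this] show ?thesis unfolding step_energy_def by measurable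
qed

lemma step_on_cell:
  assumes "a < t" "i \<le> n" "grid a t n i < u" "u \<le> grid a t n (Suc i)"
  shows "step a t \<psi> \<epsilon> e n u \<omega> =
    \<epsilon> i * (\<psi> (dprice a (grid a t n i) \<omega>) / S (grid a t n i) \<omega>) * (price t u \<omega> * vol t u \<omega>) - e \<omega>"
proof -
  have "a < u" "u \<le> t"
    using grid_bounds[of a t i n] grid_bounds[of a t "Suc i" n] assms by auto
  then show ?thesis unfolding step_def sum_grid_cell[OF assms] by simp
qed

text \<open>At each time a single cell is active, so a sign disappears in the square unless it is
  weighed against \<open>e\<close>; hence the alternative in \<open>sign\<close>.\<close>

lemma step_second_moment:
  assumes "0 \<le> a" "a < t" and "\<psi> \<in> borel_measurable borel" and "e \<in> borel_measurable (F a)"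
    and \<kappa>: "\<kappa> \<in> borel_measurable (F a)" and w: "w \<in> borel_measurable (F a)" and "0 \<le> b"
    and sign: "(\<forall>i. \<epsilon> i = 1) \<or> (\<forall>i. \<bar>\<epsilon> i\<bar> = 1) \<and> (\<forall>\<omega>. e \<omega> = 0)"
  shows "(\<integral>\<^sup>+\<omega>. (if step_energy a t \<psi> e \<kappa> n \<omega> < ennreal b then ennreal ((w \<omega> + \<kappa> \<omega> * step_int a t \<psi> \<epsilon> e n \<omega>)\<^sup>2) else 0) \<partial>M)
    \<le> (\<integral>\<^sup>+\<omega>. ennreal ((w \<omega>)\<^sup>2) \<partial>M) + (\<integral>\<^sup>+\<omega>. min (step_energy a t \<psi> e \<kappa> n \<omega>) (ennreal b) \<partial>M)"
proof -
  have [measurable]: "\<kappa> \<in> borel_measurable M" using F_imp_M[OF _ \<kappa>] assms by auto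
  have eq: "energy a t (\<lambda>r. \<kappa> \<omega> * step a t \<psi> \<epsilon> e n r \<omega>) = energy a t (\<lambda>r. \<kappa> \<omega> * step a t \<psi> (\<lambda>_. 1) e n r \<omega>)" for \<omega>
  proof (rule energy_cong)
    fix u assume "a < u" "u \<le> t"
    then obtain i where i: "i \<le> n" "grid a t n i < u" "u \<le> grid a t n (Suc i)"
      using grid_cell[OF \<open>a < t\<close>, of u n] by blast
    have "(\<epsilon> i)\<^sup>2 = 1 \<and> (\<epsilon> i = 1 \<or> e \<omega> = 0)" using sign by (auto simp: power2_eq_1_iff abs_if split: if_splits)
    then show "(\<kappa> \<omega> * step a t \<psi> \<epsilon> e n u \<omega>)\<^sup>2 = (\<kappa> \<omega> * step a t \<psi> (\<lambda>_. 1) e n u \<omega>)\<^sup>2"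
      unfolding step_on_cell[OF \<open>a < t\<close> i] by (auto simp: power_mult_distrib power_divide)
  qed
  have V: "2 * energy a t (\<lambda>r. \<kappa> \<omega> * step a t \<psi> \<epsilon> e n r \<omega>) = step_energy a t \<psi> e \<kappa> n \<omega>" for \<omega>
    unfolding eq step_energy_def ..
  have m: "(\<lambda>\<omega>. energy a t (\<lambda>r. \<kappa> \<omega> * step a t \<psi> \<epsilon> e n r \<omega>)) \<in> borel_measurable M"
  proof -
    note [measurable] = step_joint[OF assms(1-4)]
    show ?thesis by (rule energy_measurable) measurable
  qed
  show ?thesis
    using ito_pair_second_moment[OF \<open>0 \<le> a\<close> less_imp_le[OF \<open>a < t\<close>]
        ito_pair_scale[OF ito_pair_step[OF assms(1-4)] \<open>0 \<le> a\<close> \<kappa>] _ m w \<open>0 \<le> b\<close>]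
      step_int_measurable[OF assms(1-4)] unfolding V by measurable
qed

text \<open>A price path has a positive minimum on the compact interval, so square integrability of
  \<open>S \<delta>\<close> passes to \<open>\<delta>\<close>.\<close>

lemma vol_energy_finite:
  assumes "0 \<le> a" "a < t"
  shows "AE \<omega> in M. energy a t (\<lambda>r. vol t r \<omega>) < \<infinity>"
proof -
  have t: "0 \<le> t" using assms by simp
  have "AE \<omega> in M. set_integrable lborel {0..t} (\<lambda>s. (S s \<omega> * \<delta> s \<omega>)\<^sup>2)"
    using mart(1)[OF t] unfolding has_ito_integral_def by blast
  then show ?thesis using AE_space
  proof eventually_elim
    case (elim \<omega>)
    have "continuous_on {a..t} (\<lambda>u. S u \<omega>)"
      using S_continuous[OF elim(2)] assms by (auto intro: continuous_on_subset)
    then obtain x where x: "x \<in> {a..t}" "\<And>u. u \<in> {a..t} \<Longrightarrow> S x \<omega> \<le> S u \<omega>"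
      using continuous_attains_inf[of "{a..t}" "\<lambda>u. S u \<omega>"] assms by auto
    define m where "m = S x \<omega>"
    have m: "0 < m" using x(1) assms S_positive elim(2) by (auto simp: m_def)
    have vb: "(\<lambda>r. vol t r \<omega>) \<in> borel_measurable borel" using section_borel[OF vol_joint[OF t] elim(2)] .
    have "energy a t (\<lambda>r. m * vol t r \<omega>) \<le> (\<integral>\<^sup>+r. ennreal (indicator {0..t} r *\<^sub>R (S r \<omega> * \<delta> r \<omega>)\<^sup>2) \<partial>lborel)"
      unfolding energy_def
    proof (intro nn_integral_mono)
      fix r
      have "(m * vol t r \<omega>)\<^sup>2 \<le> (S r \<omega> * \<delta> r \<omega>)\<^sup>2" if "a < r" "r \<le> t"
      proof -
        have "vol t r \<omega> = \<delta> r \<omega>" using that assms by (simp add: vol_def)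
        moreover have "m\<^sup>2 \<le> (S r \<omega>)\<^sup>2" using x(2)[of r] that m by (intro power_mono) (auto simp: m_def)
        ultimately show ?thesis by (simp add: power_mult_distrib mult_right_mono)
      qed
      then show "ennreal ((m * vol t r \<omega>)\<^sup>2) * indicator {a<..t} r \<le> ennreal (indicator {0..t} r *\<^sub>R (S r \<omega> * \<delta> r \<omega>)\<^sup>2)"
        using assms by (auto simp: indicator_def intro!: ennreal_leI)
    qed
    also have "\<dots> < \<infinity>"
      using elim(1) unfolding set_integrable_def by (subst nn_integral_eq_integral) auto
    finally have "ennreal (m\<^sup>2) * energy a t (\<lambda>r. vol t r \<omega>) < \<infinity>" unfolding energy_scale[OF vb] .
    then show ?case using m by (auto simp: ennreal_mult_less_top)
  qed
qed

text \<open>The partly frozen weight is replaced by the running one at a cost of at most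
  \<open>\<eta>'\<close> times \<open>\<delta>\<close>, whose energy is finite on almost every path.
  The factor 4 is the 2 in \<open>step_energy\<close> times the 2 of
  \<open>energy_le_sum\<close>.\<close>

lemma step_energy_limit:
  assumes "0 \<le> a" "a < t" and [measurable]: "\<psi> \<in> borel_measurable borel" and \<psi>: "continuous_on {0<..} \<psi>"
  shows "AE \<omega> in M. \<exists>d. d \<longlonglongrightarrow> 0 \<and> (\<forall>\<^sub>F n in sequentially. step_energy a t \<psi> e \<kappa> n \<omega> \<le>
     4 * energy a t (\<lambda>r. \<kappa> \<omega> * (\<psi> (dprice a (max a (min t r)) \<omega>) * vol t r \<omega> - e \<omega>)) + d n)"
  using vol_energy_finite[OF assms(1,2)] AE_space
proof eventually_elim
  case (elim \<omega>)
  have t: "0 \<le> t" using assms by simp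
  interpret P: positive_path a t "\<lambda>u. S u \<omega>" "rate a" "\<lambda>u. drift u \<omega>" by (rule positive_path[OF assms(1,2) elim(2)])
  have d: "dprice a u \<omega> = P.disc u" for u using dprice_disc[OF assms(1,2) elim(2)] .
  obtain v where v: "0 \<le> v" "energy a t (\<lambda>r. vol t r \<omega>) = ennreal v"
    using elim(1) by (cases "energy a t (\<lambda>r. vol t r \<omega>)") auto
  have vb [measurable]: "(\<lambda>r. vol t r \<omega>) \<in> borel_measurable borel" using section_borel[OF vol_joint[OF t] elim(2)] .
  have db [measurable]: "(\<lambda>r. \<psi> (dprice a (max a (min t r)) \<omega>)) \<in> borel_measurable borel"
  proof (intro borel_measurable_continuous_onI continuous_on_compose2[OF \<psi>] )
    show "continuous_on UNIV (\<lambda>r. dprice a (max a (min t r)) \<omega>)"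
      unfolding d by (rule continuous_on_compose2[OF P.disc_cont]) (use assms in \<open>auto intro!: continuous_intros\<close>)
    show "(\<lambda>r. dprice a (max a (min t r)) \<omega>) ` UNIV \<subseteq> {0<..}"
      unfolding d using assms by (auto intro!: P.disc_pos)
  qed
  show ?case
  proof (rule vanishing_excess)
    fix \<eta> :: real assume \<eta>: "0 < \<eta>"
    \<comment> \<open>Chosen so that the excess
      \<open>4 * ((\<kappa> \<omega> * \<eta>')\<^sup>2 * v)\<close> is at most
      \<open>\<eta>\<close>; the added ones keep \<open>k\<close> positive when
      \<open>\<kappa> \<omega>\<close> or \<open>v\<close> is 0.\<close>
    define k where "k = ((\<kappa> \<omega>)\<^sup>2 + 1) * (v + 1)"
    define \<eta>' where "\<eta>' = sqrt (\<eta> / (4 * k))"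
    have pos: "0 < k" unfolding k_def using v zero_le_power2[of "\<kappa> \<omega>"] by (intro mult_pos_pos) linarith+
    have \<eta>': "0 < \<eta>'" using \<eta> pos by (simp add: \<eta>'_def)
    have sq: "4 * ((\<kappa> \<omega> * \<eta>')\<^sup>2 * v) \<le> \<eta>"
    proof -
      have "4 * \<eta>'\<^sup>2 * k = \<eta>" using \<eta> pos by (simp add: \<eta>'_def)
      moreover have "(\<kappa> \<omega>)\<^sup>2 * v \<le> k" unfolding k_def using v by (intro mult_mono) auto
      then have "4 * \<eta>'\<^sup>2 * ((\<kappa> \<omega>)\<^sup>2 * v) \<le> 4 * \<eta>'\<^sup>2 * k" by (intro mult_left_mono) auto
      moreover have "4 * ((\<kappa> \<omega> * \<eta>')\<^sup>2 * v) = 4 * \<eta>'\<^sup>2 * ((\<kappa> \<omega>)\<^sup>2 * v)"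
        by (simp add: power_mult_distrib)
      ultimately show ?thesis by linarith
    qed
    from P.weight_close[OF \<psi> \<eta>']
    show "\<forall>\<^sub>F n in sequentially. step_energy a t \<psi> e \<kappa> n \<omega> \<le>
      4 * energy a t (\<lambda>r. \<kappa> \<omega> * (\<psi> (dprice a (max a (min t r)) \<omega>) * vol t r \<omega> - e \<omega>)) + ennreal \<eta>"
    proof eventually_elim
      case (elim n)
      have "energy a t (\<lambda>r. \<kappa> \<omega> * step a t \<psi> (\<lambda>_. 1) e n r \<omega>) \<le>
        2 * energy a t (\<lambda>r. \<kappa> \<omega> * (\<psi> (dprice a (max a (min t r)) \<omega>) * vol t r \<omega> - e \<omega>)) + 2 * energy a t (\<lambda>r. (\<kappa> \<omega> * \<eta>') * vol t r \<omega>)"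
      proof (rule energy_le_sum)
        fix u assume u: "a < u" "u \<le> t"
        then obtain i where i: "i \<le> n" "grid a t n i < u" "u \<le> grid a t n (Suc i)"
          using grid_cell[OF \<open>a < t\<close>, of u n] by blast
        define g where "g = \<psi> (dprice a (grid a t n i) \<omega>) / S (grid a t n i) \<omega> * S u \<omega> - \<psi> (dprice a u \<omega>)"
        have g: "\<bar>g\<bar> \<le> \<eta>'" using elim i unfolding g_def d by auto
        have "price t u \<omega> = S u \<omega>" using u assms by (simp add: price_def)
        then have "step a t \<psi> (\<lambda>_. 1) e n u \<omega> = (\<psi> (dprice a u \<omega>) * vol t u \<omega> - e \<omega>) + g * vol t u \<omega>"
          unfolding step_on_cell[OF \<open>a < t\<close> i] g_def by (simp add: algebra_simps)
        then have "(\<kappa> \<omega> * step a t \<psi> (\<lambda>_. 1) e n u \<omega>)\<^sup>2 \<le> 2 * (\<kappa> \<omega> * (\<psi> (dprice a u \<omega>) * vol t u \<omega> - e \<omega>))\<^sup>2 + 2 * (\<kappa> \<omega> * (g * vol t u \<omega>))\<^sup>2"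
          using power2_add_le[of "\<kappa> \<omega> * (\<psi> (dprice a u \<omega>) * vol t u \<omega> - e \<omega>)" "\<kappa> \<omega> * (g * vol t u \<omega>)"] by (simp add: distrib_left)
        also have "(\<kappa> \<omega> * (g * vol t u \<omega>))\<^sup>2 \<le> ((\<kappa> \<omega> * \<eta>') * vol t u \<omega>)\<^sup>2"
        proof -
          have "g\<^sup>2 \<le> \<eta>'\<^sup>2" using g \<eta>' by (simp add: abs_le_square_iff[symmetric])
          then have "((\<kappa> \<omega>)\<^sup>2 * (vol t u \<omega>)\<^sup>2) * g\<^sup>2 \<le> ((\<kappa> \<omega>)\<^sup>2 * (vol t u \<omega>)\<^sup>2) * \<eta>'\<^sup>2"
            by (intro mult_left_mono) auto
          then show ?thesis by (simp add: power_mult_distrib mult_ac)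
        qed
        finally show "(\<kappa> \<omega> * step a t \<psi> (\<lambda>_. 1) e n u \<omega>)\<^sup>2 \<le>
          2 * (\<kappa> \<omega> * (\<psi> (dprice a (max a (min t u)) \<omega>) * vol t u \<omega> - e \<omega>))\<^sup>2 + 2 * ((\<kappa> \<omega> * \<eta>') * vol t u \<omega>)\<^sup>2"
          using u by (simp add: min_absorb2 max_absorb2)
      qed measurable
      then have "step_energy a t \<psi> e \<kappa> n \<omega> \<le> 2 * (2 * energy a t (\<lambda>r. \<kappa> \<omega> * (\<psi> (dprice a (max a (min t r)) \<omega>) * vol t r \<omega> - e \<omega>)) + 2 * energy a t (\<lambda>r. (\<kappa> \<omega> * \<eta>') * vol t r \<omega>))"
        unfolding step_energy_def by (intro mult_left_mono) auto
      also have "\<dots> = 4 * energy a t (\<lambda>r. \<kappa> \<omega> * (\<psi> (dprice a (max a (min t r)) \<omega>) * vol t r \<omega> - e \<omega>)) + 4 * (ennreal ((\<kappa> \<omega> * \<eta>')\<^sup>2) * ennreal v)"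
        unfolding energy_scale[OF vb] v by (simp add: distrib_left mult.assoc[symmetric])
      also have "4 * (ennreal ((\<kappa> \<omega> * \<eta>')\<^sup>2) * ennreal v) = ennreal (4 * ((\<kappa> \<omega> * \<eta>')\<^sup>2 * v))"
        using v by (simp add: ennreal_mult')
      also have "\<dots> \<le> ennreal \<eta>" using sq by (rule ennreal_leI)
      finally show ?case by (simp add: add_left_mono)
    qed
  qed
qed

text \<open>The price equation holds at each fixed time off a null set; the points of all grids
  together are countable, so one null set serves every \<open>n\<close>.\<close>

lemma incr_eq_mret:
  assumes "0 \<le> a" "a < t"
  shows "AE \<omega> in M. \<forall>n. \<forall>i\<le>n. incr a t n i \<omega> = positive_path.mret a t (\<lambda>u. S u \<omega>) (\<lambda>u. drift u \<omega>) n i"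
proof -
  have "AE \<omega> in M. i \<le> Suc n \<longrightarrow> S (grid a t n i) \<omega> = S 0 \<omega> + drift (grid a t n i) \<omega> + mart (grid a t n i) \<omega>" for n i
  proof (cases "i \<le> Suc n")
    case True
    then have "0 \<le> grid a t n i" using grid_bounds[of a t i n] assms by simp
    from mart(2)[OF this] show ?thesis by eventually_elim simp
  qed simp
  then have "AE \<omega> in M. \<forall>n i. i \<le> Suc n \<longrightarrow> S (grid a t n i) \<omega> = S 0 \<omega> + drift (grid a t n i) \<omega> + mart (grid a t n i) \<omega>"
    by (simp add: AE_all_countable)
  then show ?thesis using AE_space
  proof eventually_elim
    case (elim \<omega>)
    interpret P: positive_path a t "\<lambda>u. S u \<omega>" "rate a" "\<lambda>u. drift u \<omega>" by (rule positive_path[OF assms elim(2)])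
    show ?case
    proof (intro allI impI)
      fix n i :: nat assume "i \<le> n"
      then have "S (grid a t n i) \<omega> = S 0 \<omega> + drift (grid a t n i) \<omega> + mart (grid a t n i) \<omega>"
        "S (grid a t n (Suc i)) \<omega> = S 0 \<omega> + drift (grid a t n (Suc i)) \<omega> + mart (grid a t n (Suc i)) \<omega>"
        using elim(1) by auto
      then show "incr a t n i \<omega> = P.mret n i" unfolding incr_def P.mret_def by simp
    qed
  qed
qed

end

text \<open>The truncation level is sent to infinity along the integers. If \<open>V\<close> has
  infinite mean, the claim is trivial because \<open>0 < K\<close>; otherwise \<open>V\<close> is
  finite almost surely and the sets \<open>V < n\<close> exhaust the space up to a null set.\<close>

lemma Fatou_bound:
  fixes Z V :: "'a \<Rightarrow> ennreal" and C K :: ennreal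
  assumes M: "prob_space M"
    and Zk: "\<And>k. Zk k \<in> borel_measurable M" and Vk: "\<And>k. Vk k \<in> borel_measurable M"
    and [measurable]: "V \<in> borel_measurable M" "Z \<in> borel_measurable M"
    and K: "0 < K" "K < top"
    and bound: "\<And>k b :: real. 0 \<le> b \<Longrightarrow>
      (\<integral>\<^sup>+\<omega>. (if Vk k \<omega> < ennreal b then Zk k \<omega> else 0) \<partial>M) \<le> C + K * (\<integral>\<^sup>+\<omega>. min (Vk k \<omega>) (ennreal b) \<partial>M)"
    and le_V: "AE \<omega> in M. \<exists>d. d \<longlonglongrightarrow> 0 \<and> (\<forall>\<^sub>F k in sequentially. Vk k \<omega> \<le> V \<omega> + d k)"
    and le_Z: "AE \<omega> in M. Z \<omega> \<le> liminf (\<lambda>k. Zk k \<omega>)"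
  shows "(\<integral>\<^sup>+\<omega>. Z \<omega> \<partial>M) \<le> C + K * (\<integral>\<^sup>+\<omega>. V \<omega> \<partial>M)"
proof (cases "(\<integral>\<^sup>+\<omega>. V \<omega> \<partial>M) = top")
  case True
  then show ?thesis using K by (simp add: ennreal_mult_top zero_less_iff_neq_zero)
next
  case False
  then have fin: "AE \<omega> in M. V \<omega> < top"
    using nn_integral_noteq_infinite[of V M] by (simp add: less_top)
  define G where "G n \<omega> = (if V \<omega> < ennreal (real n) then Z \<omega> else 0)" for n :: nat and \<omega>
  have "(\<integral>\<^sup>+\<omega>. Z \<omega> \<partial>M) = (\<integral>\<^sup>+\<omega>. (SUP n. G n \<omega>) \<partial>M)"
  proof (rule nn_integral_cong_AE)
    show "AE \<omega> in M. Z \<omega> = (SUP n. G n \<omega>)" using fin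
    proof eventually_elim
      case (elim \<omega>)
      then obtain v where v: "V \<omega> = ennreal v" "0 \<le> v" by (cases "V \<omega>") auto
      obtain n :: nat where "v < real n" using reals_Archimedean2 by blast
      then have "G n \<omega> = Z \<omega>" using v by (simp add: G_def ennreal_less_iff)
      then have "Z \<omega> \<le> (SUP n. G n \<omega>)" by (metis SUP_upper UNIV_I)
      moreover have "(SUP n. G n \<omega>) \<le> Z \<omega>" by (intro SUP_least) (simp add: G_def)
      ultimately show ?case by (rule antisym)
    qed
  qed
  also have "\<dots> = (SUP n. \<integral>\<^sup>+\<omega>. G n \<omega> \<partial>M)"
  proof (rule nn_integral_monotone_convergence_SUP)
    show "incseq G"
      unfolding incseq_def le_fun_def
    proof (intro allI impI)
      fix k n :: nat and \<omega> assume "k \<le> n"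
      then have "V \<omega> < ennreal (real n)" if "V \<omega> < ennreal (real k)"
        by (intro less_le_trans[OF that] ennreal_leI) simp
      then show "G k \<omega> \<le> G n \<omega>" by (simp add: G_def)
    qed
    show "G n \<in> borel_measurable M" for n unfolding G_def by measurable
  qed
  also have "\<dots> \<le> C + K * (\<integral>\<^sup>+\<omega>. V \<omega> \<partial>M)"
  proof (rule SUP_least)
    fix n :: nat
    have "(\<integral>\<^sup>+\<omega>. G n \<omega> \<partial>M) \<le> C + K * (\<integral>\<^sup>+\<omega>. min (V \<omega>) (ennreal (real n)) \<partial>M)"
      unfolding G_def
      by (rule Fatou_truncated_bound[where Zk = Zk and Vk = Vk, OF M Zk Vk assms(4) _ K(2) bound le_V le_Z]) simp_all
    also have "\<dots> \<le> C + K * (\<integral>\<^sup>+\<omega>. V \<omega> \<partial>M)"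
      by (intro add_left_mono mult_left_mono nn_integral_mono) auto
    finally show "(\<integral>\<^sup>+\<omega>. G n \<omega> \<partial>M) \<le> C + K * (\<integral>\<^sup>+\<omega>. V \<omega> \<partial>M)" .
  qed
  finally show ?thesis .
qed

section \<open>Mean error of the logarithm\<close>

context price_model
begin

lemma incr_measurable:
  assumes "0 \<le> a" "a < t" "i \<le> n"
  shows "incr a t n i \<in> borel_measurable M"
proof -
  have "a \<le> grid a t n i" "a \<le> grid a t n (Suc i)"
    using assms by (auto intro!: grid_bounds)
  then have [measurable]: "S (grid a t n i) \<in> borel_measurable M"
    "mart (grid a t n i) \<in> borel_measurable M" "mart (grid a t n (Suc i)) \<in> borel_measurable M"
    using assms by auto
  show ?thesis unfolding incr_def by measurable
qed

text \<open>Signs on the cells do not change the energy of the integrand, so one second-moment bound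
  holds for all sign patterns, and averaging over them bounds the discrete quadratic
  variation.\<close>

lemma incr_squares_bound:
  assumes "0 \<le> a" "a < t" and A: "A \<in> sets (F a)" and "0 \<le> b"
  shows "(\<integral>\<^sup>+\<omega>. (if step_energy a t (\<lambda>_. 1) (\<lambda>_. 0) (indicator A) n \<omega> < ennreal b
      then ennreal (\<Sum>i\<le>n. (indicator A \<omega> * incr a t n i \<omega>)\<^sup>2) else 0) \<partial>M)
    \<le> (\<integral>\<^sup>+\<omega>. min (step_energy a t (\<lambda>_. 1) (\<lambda>_. 0) (indicator A) n \<omega>) (ennreal b) \<partial>M)"
proof -
  note [measurable] = A
  have [measurable]: "A \<in> sets M" using subalgebra_F[OF assms(1)] A by (auto simp: subalgebra_def)
  have [measurable]: "step_energy a t (\<lambda>_. 1) (\<lambda>_. 0) (indicator A) n \<in> borel_measurable M"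
    using assms by (intro step_energy_measurable) auto
  show ?thesis
    unfolding lessThan_Suc_atMost[symmetric]
  proof (rule nn_integral_sum_squares_le)
    fix \<epsilon> :: "nat \<Rightarrow> real" assume \<epsilon>: "\<And>i. \<bar>\<epsilon> i\<bar> = 1"
    have eq: "(\<Sum>i<Suc n. \<epsilon> i * (indicator A \<omega> * incr a t n i \<omega>)) = 0 + indicator A \<omega> * step_int a t (\<lambda>_. 1) \<epsilon> (\<lambda>_. 0) n \<omega>" for \<omega>
      unfolding step_int_def lessThan_Suc_atMost by (simp add: sum_distrib_left mult_ac)
    show "(\<integral>\<^sup>+\<omega>. (if step_energy a t (\<lambda>_. 1) (\<lambda>_. 0) (indicator A) n \<omega> < ennreal b
      then ennreal ((\<Sum>i<Suc n. \<epsilon> i * (indicator A \<omega> * incr a t n i \<omega>))\<^sup>2) else 0) \<partial>M)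
    \<le> (\<integral>\<^sup>+\<omega>. min (step_energy a t (\<lambda>_. 1) (\<lambda>_. 0) (indicator A) n \<omega>) (ennreal b) \<partial>M)"
      unfolding eq using step_second_moment[OF assms(1,2), of "\<lambda>_. 1" "\<lambda>_. 0" "indicator A" "\<lambda>_. 0" b \<epsilon> n] \<epsilon> \<open>0 \<le> b\<close> A by simp
  next
    fix i assume "i < Suc n"
    then have [measurable]: "incr a t n i \<in> borel_measurable M" using assms by (intro incr_measurable) auto
    show "(\<lambda>\<omega>. indicator A \<omega> * incr a t n i \<omega>) \<in> borel_measurable M" by measurable
  qed measurable
qed

lemma dprice_cut_energy_measurable:
  assumes "0 \<le> a" "a < t" and [measurable]: "\<psi> \<in> borel_measurable borel" and \<psi>: "continuous_on {0<..} \<psi>"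
    and [measurable]: "e \<in> borel_measurable M" "\<kappa> \<in> borel_measurable M"
  shows "(\<lambda>\<omega>. energy a t (\<lambda>r. \<kappa> \<omega> * (\<psi> (dprice a (max a (min t r)) \<omega>) * vol t r \<omega> - e \<omega>))) \<in> borel_measurable M"
proof (rule energy_measurable)
  have t: "0 \<le> t" using assms by simp
  note [measurable] = vol_joint[OF t]
  have [measurable]: "(\<lambda>(\<omega>, r). dprice a (max a (min t r)) \<omega>) \<in> borel_measurable (M \<Otimes>\<^sub>M borel)"
  proof -
    have [measurable]: "S a \<in> borel_measurable M" using assms by simp
    have rate: "continuous_on UNIV (\<lambda>r. rate a (max a (min t r)))" if "\<omega> \<in> space M" for \<omega>
    proof -
      interpret P: positive_path a t "\<lambda>u. S u \<omega>" "rate a" "\<lambda>u. drift u \<omega>" by (rule positive_path[OF assms(1,2) that])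
      show ?thesis by (rule continuous_on_compose2[OF P.R_cont]) (use assms in \<open>auto intro!: continuous_intros\<close>)
    qed
    have [measurable]: "(\<lambda>r. rate a (max a (min t r))) \<in> borel_measurable borel"
      using rate not_empty by (auto intro!: borel_measurable_continuous_onI)
    have eq: "dprice a (max a (min t r)) \<omega> = exp (- rate a (max a (min t r))) * price t (max a r) \<omega> / S a \<omega>" for r \<omega>
    proof -
      have "max 0 (min t (max a r)) = max a (min t r)" using assms by (auto simp: min_def max_def)
      then show ?thesis by (simp add: dprice_def price_def)
    qed
    have "(\<lambda>x. (fst x, max a (snd x))) \<in> M \<Otimes>\<^sub>M borel \<rightarrow>\<^sub>M M \<Otimes>\<^sub>M (borel :: real measure)" by measurable
    from measurable_compose[OF this price_joint[of t]]
    have [measurable]: "(\<lambda>x. price t (max a (snd x)) (fst x)) \<in> borel_measurable (M \<Otimes>\<^sub>M borel)" by simp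
    show ?thesis unfolding eq case_prod_beta' by measurable
  qed
  show "(\<lambda>(\<omega>, r). \<kappa> \<omega> * (\<psi> (dprice a (max a (min t r)) \<omega>) * vol t r \<omega> - e \<omega>)) \<in> borel_measurable (M \<Otimes>\<^sub>M borel)"
    by measurable
qed

text \<open>A second moment becomes a first one through
  \<open>\<bar>J\<bar> \<le> l + J\<^sup>2 / l\<close>, with a level \<open>l\<close> known at time
  \<open>a\<close> and left free for now. The energy of \<open>\<delta> - e\<close> controls the
  stochastic integral, that of \<open>\<delta>\<close> the squared returns.\<close>

lemma log_price_bound:
  assumes "0 \<le> a" "a < t" and A: "A \<in> sets (F a)"
    and e: "e \<in> borel_measurable (F a)" and l: "l \<in> borel_measurable (F a)" and l_pos: "\<And>\<omega>. \<omega> \<in> space M \<Longrightarrow> 0 < l \<omega>"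
  shows "(\<integral>\<^sup>+\<omega>\<in>A. ennreal \<bar>ln (dprice a t \<omega>) - e \<omega> * (W t \<omega> - W a \<omega>)\<bar> \<partial>M) \<le>
    (\<integral>\<^sup>+\<omega>\<in>A. ennreal (l \<omega>) \<partial>M) +
    20 * (\<integral>\<^sup>+\<omega>\<in>A. (ennreal (1 / l \<omega>) * energy a t (\<lambda>r. vol t r \<omega> - e \<omega>) + energy a t (\<lambda>r. vol t r \<omega>)) \<partial>M)"
proof -
  have t: "0 \<le> t" using assms by simp
  note [measurable] = A e l
  have [measurable]: "A \<in> sets M" using subalgebra_F[OF assms(1)] A by (auto simp: subalgebra_def)
  have [measurable]: "e \<in> borel_measurable M" "l \<in> borel_measurable M" using F_imp_M[OF assms(1) e] F_imp_M[OF assms(1) l] by auto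
  have [measurable]: "dprice a t \<in> borel_measurable M" using F_imp_M[OF t dprice_F] assms by auto
  have [measurable]: "W t \<in> borel_measurable M" "W a \<in> borel_measurable M" using t assms by auto
  \<comment> \<open>On \<open>A\<close> this gives \<open>(\<kappa> \<omega> * J n \<omega>)\<^sup>2
    = (J n \<omega>)\<^sup>2 / l \<omega>\<close>, so the weight \<open>1 / l\<close> is absorbed
    into the integrand.\<close>
  define \<kappa> where "\<kappa> \<omega> = indicator A \<omega> / sqrt (l \<omega>)" for \<omega>
  have \<kappa>F [measurable]: "\<kappa> \<in> borel_measurable (F a)" unfolding \<kappa>_def by measurable
  have [measurable]: "\<kappa> \<in> borel_measurable M" using F_imp_M[OF assms(1) \<kappa>F] .
  define V1 where "V1 = step_energy a t (\<lambda>_. 1) e \<kappa>"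
  define V2 where "V2 = step_energy a t (\<lambda>_. 1) (\<lambda>_. 0) (indicator A)"
  define J where "J = step_int a t (\<lambda>_. 1) (\<lambda>_. 1) e"
  define Q where "Q n \<omega> = (\<Sum>i\<le>n. (indicator A \<omega> * incr a t n i \<omega>)\<^sup>2)" for n \<omega>
  have [measurable]: "V1 n \<in> borel_measurable M" "V2 n \<in> borel_measurable M" for n
    unfolding V1_def V2_def using assms by (auto intro!: step_energy_measurable)
  have [measurable]: "J n \<in> borel_measurable M" for n
    unfolding J_def using assms by (intro step_int_measurable) auto
  have [measurable]: "Q n \<in> borel_measurable M" for n
    unfolding Q_def using incr_measurable[OF assms(1,2)]
    by (intro borel_measurable_sum borel_measurable_power borel_measurable_times) auto
  have Q0: "0 \<le> Q n \<omega>" for n \<omega> unfolding Q_def by (intro sum_nonneg) auto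
  define E1 where "E1 \<omega> = energy a t (\<lambda>r. \<kappa> \<omega> * (1 * vol t r \<omega> - e \<omega>))" for \<omega>
  define E2 where "E2 \<omega> = energy a t (\<lambda>r. indicator A \<omega> * (1 * vol t r \<omega> - 0))" for \<omega>
  have [measurable]: "E1 \<in> borel_measurable M" "E2 \<in> borel_measurable M"
    unfolding E1_def E2_def
    using dprice_cut_energy_measurable[OF assms(1,2), of "\<lambda>_. 1" e \<kappa>]
      dprice_cut_energy_measurable[OF assms(1,2), of "\<lambda>_. 1" "\<lambda>_. 0" "indicator A"] by simp_all
  \<comment> \<open>\<open>l\<close> is subtracted beforehand, and \<open>ennreal\<close> cuts
    negative values to 0, so that the Fatou bound is applied with \<open>C = 0\<close>.\<close>
  define Z where "Z \<omega> = ennreal (indicator A \<omega> * (\<bar>ln (dprice a t \<omega>) - e \<omega> * (W t \<omega> - W a \<omega>)\<bar> - l \<omega>))" for \<omega>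
  have [measurable]: "Z \<in> borel_measurable M" unfolding Z_def by measurable
  have "(\<integral>\<^sup>+\<omega>. Z \<omega> \<partial>M) \<le> 0 + 5 * (\<integral>\<^sup>+\<omega>. 4 * E1 \<omega> + 4 * E2 \<omega> \<partial>M)"
  proof (rule Fatou_bound[OF prob_space_axioms, where
      Zk = "\<lambda>n \<omega>. ennreal ((\<kappa> \<omega> * J n \<omega>)\<^sup>2) + 4 * ennreal (Q n \<omega>)" and Vk = "\<lambda>n \<omega>. V1 n \<omega> + V2 n \<omega>"])
    fix n and b :: real assume "0 \<le> b"
    have "(\<integral>\<^sup>+\<omega>. (if V1 n \<omega> + V2 n \<omega> < ennreal b then ennreal ((\<kappa> \<omega> * J n \<omega>)\<^sup>2) + 4 * ennreal (Q n \<omega>) else 0) \<partial>M)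
      \<le> (\<integral>\<^sup>+\<omega>. (if V1 n \<omega> < ennreal b then ennreal ((0 + \<kappa> \<omega> * J n \<omega>)\<^sup>2) else 0) + 4 * (if V2 n \<omega> < ennreal b then ennreal (Q n \<omega>) else 0) \<partial>M)"
    proof (intro nn_integral_mono)
      fix \<omega>
      \<comment> \<open>Truncating by the sum of the energies truncates each of them, so both
        second-moment bounds apply; on the right, each minimum is then enlarged to that of the
        sum.\<close>
      have "V1 n \<omega> < ennreal b \<and> V2 n \<omega> < ennreal b" if lt: "V1 n \<omega> + V2 n \<omega> < ennreal b"
        using le_less_trans[OF _ lt, of "V1 n \<omega>"] le_less_trans[OF _ lt, of "V2 n \<omega>"] by simp
      then show "(if V1 n \<omega> + V2 n \<omega> < ennreal b then ennreal ((\<kappa> \<omega> * J n \<omega>)\<^sup>2) + 4 * ennreal (Q n \<omega>) else 0)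
        \<le> (if V1 n \<omega> < ennreal b then ennreal ((0 + \<kappa> \<omega> * J n \<omega>)\<^sup>2) else 0) + 4 * (if V2 n \<omega> < ennreal b then ennreal (Q n \<omega>) else 0)"
        by simp
    qed
    also have "\<dots> = (\<integral>\<^sup>+\<omega>. (if V1 n \<omega> < ennreal b then ennreal ((0 + \<kappa> \<omega> * J n \<omega>)\<^sup>2) else 0) \<partial>M) + 4 * (\<integral>\<^sup>+\<omega>. (if V2 n \<omega> < ennreal b then ennreal (Q n \<omega>) else 0) \<partial>M)"
      by (subst nn_integral_add) (auto simp: nn_integral_cmult)
    also have "\<dots> \<le> (\<integral>\<^sup>+\<omega>. min (V1 n \<omega>) (ennreal b) \<partial>M) + 4 * (\<integral>\<^sup>+\<omega>. min (V2 n \<omega>) (ennreal b) \<partial>M)"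
    proof (intro add_mono mult_left_mono)
      show "(\<integral>\<^sup>+\<omega>. (if V1 n \<omega> < ennreal b then ennreal ((0 + \<kappa> \<omega> * J n \<omega>)\<^sup>2) else 0) \<partial>M) \<le> (\<integral>\<^sup>+\<omega>. min (V1 n \<omega>) (ennreal b) \<partial>M)"
        using step_second_moment[OF assms(1,2) _ e \<kappa>F, of "\<lambda>_. 1" "\<lambda>_. 0" b "\<lambda>_. 1" n] \<open>0 \<le> b\<close>
        unfolding V1_def J_def by simp
      show "(\<integral>\<^sup>+\<omega>. (if V2 n \<omega> < ennreal b then ennreal (Q n \<omega>) else 0) \<partial>M) \<le> (\<integral>\<^sup>+\<omega>. min (V2 n \<omega>) (ennreal b) \<partial>M)"
        unfolding V2_def Q_def by (rule incr_squares_bound[OF assms(1,2) A \<open>0 \<le> b\<close>])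
    qed auto
    also have "\<dots> \<le> (\<integral>\<^sup>+\<omega>. min (V1 n \<omega> + V2 n \<omega>) (ennreal b) \<partial>M) + 4 * (\<integral>\<^sup>+\<omega>. min (V1 n \<omega> + V2 n \<omega>) (ennreal b) \<partial>M)"
      by (intro add_mono mult_left_mono nn_integral_mono min.mono) auto
    \<comment> \<open>One copy comes from the stochastic integral and four from the squares,
      \<open>1 + 4 = 5\<close>; with the factor 4 of the energy limits this makes the constant
      20.\<close>
    also have "\<dots> = 0 + 5 * (\<integral>\<^sup>+\<omega>. min (V1 n \<omega> + V2 n \<omega>) (ennreal b) \<partial>M)"
    proof -
      have "x + 4 * x = 5 * x" for x :: ennreal
        using distrib_right[of 1 4 x] by simp
      then show ?thesis by simp
    qed
    finally show "(\<integral>\<^sup>+\<omega>. (if V1 n \<omega> + V2 n \<omega> < ennreal b then ennreal ((\<kappa> \<omega> * J n \<omega>)\<^sup>2) + 4 * ennreal (Q n \<omega>) else 0) \<partial>M)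
      \<le> 0 + 5 * (\<integral>\<^sup>+\<omega>. min (V1 n \<omega> + V2 n \<omega>) (ennreal b) \<partial>M)" .
  next
    have "AE \<omega> in M. \<exists>d. d \<longlonglongrightarrow> 0 \<and> (\<forall>\<^sub>F n in sequentially. V1 n \<omega> \<le> 4 * E1 \<omega> + d n)"
      using step_energy_limit[OF assms(1,2), of "\<lambda>_. 1"] unfolding V1_def E1_def by simp
    moreover have "AE \<omega> in M. \<exists>d. d \<longlonglongrightarrow> 0 \<and> (\<forall>\<^sub>F n in sequentially. V2 n \<omega> \<le> 4 * E2 \<omega> + d n)"
      using step_energy_limit[OF assms(1,2), of "\<lambda>_. 1" "\<lambda>_. 0" "indicator A"] unfolding V2_def E2_def by simp
    ultimately show "AE \<omega> in M. \<exists>d. d \<longlonglongrightarrow> 0 \<and> (\<forall>\<^sub>F n in sequentially. V1 n \<omega> + V2 n \<omega> \<le> 4 * E1 \<omega> + 4 * E2 \<omega> + d n)"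
    proof eventually_elim
      case (elim \<omega>)
      then obtain d1 d2 where d: "d1 \<longlonglongrightarrow> 0" "\<forall>\<^sub>F n in sequentially. V1 n \<omega> \<le> 4 * E1 \<omega> + d1 n"
        "d2 \<longlonglongrightarrow> 0" "\<forall>\<^sub>F n in sequentially. V2 n \<omega> \<le> 4 * E2 \<omega> + d2 n" by blast
      have "(\<lambda>n. d1 n + d2 n) \<longlonglongrightarrow> 0 + 0" by (intro tendsto_add d)
      moreover have "\<forall>\<^sub>F n in sequentially. V1 n \<omega> + V2 n \<omega> \<le> 4 * E1 \<omega> + 4 * E2 \<omega> + (d1 n + d2 n)"
        using d(2,4)
      proof eventually_elim
        case (elim n)
        then have "V1 n \<omega> + V2 n \<omega> \<le> (4 * E1 \<omega> + d1 n) + (4 * E2 \<omega> + d2 n)" by (rule add_mono)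
        then show ?case by (simp add: ac_simps)
      qed
      ultimately show ?case by (intro exI[of _ "\<lambda>n. d1 n + d2 n"]) simp
    qed
    show "AE \<omega> in M. Z \<omega> \<le> liminf (\<lambda>n. ennreal ((\<kappa> \<omega> * J n \<omega>)\<^sup>2) + 4 * ennreal (Q n \<omega>))"
      using incr_eq_mret[OF assms(1,2)] AE_space
    proof eventually_elim
      case (elim \<omega>)
      interpret P: positive_path a t "\<lambda>u. S u \<omega>" "rate a" "\<lambda>u. drift u \<omega>" by (rule positive_path[OF assms(1,2) elim(2)])
      have d: "dprice a u \<omega> = P.disc u" for u using dprice_disc[OF assms(1,2) elim(2)] .
      let ?y = "e \<omega> * (W t \<omega> - W a \<omega>)"
      have l0: "0 < l \<omega>" using l_pos elim(2) .
      show ?case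
      proof (cases "\<omega> \<in> A")
        case True
        let ?g = "\<lambda>n. ennreal (\<bar>ln (dprice a t \<omega>) - ?y\<bar> - l \<omega> - 5 * P.err n)"
        have "(\<lambda>n. \<bar>ln (dprice a t \<omega>) - ?y\<bar> - l \<omega> - 5 * P.err n) \<longlonglongrightarrow> \<bar>ln (dprice a t \<omega>) - ?y\<bar> - l \<omega> - 5 * 0"
          by (intro tendsto_intros P.err_tendsto_0)
        then have "?g \<longlonglongrightarrow> Z \<omega>" using True by (auto simp: Z_def intro!: tendsto_ennrealI)
        then have "Z \<omega> = liminf ?g" using lim_imp_Liminf[OF trivial_limit_sequentially] by metis
        also have "\<dots> \<le> liminf (\<lambda>n. ennreal ((\<kappa> \<omega> * J n \<omega>)\<^sup>2) + 4 * ennreal (Q n \<omega>))"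
        proof (rule Liminf_mono)
          show "\<forall>\<^sub>F n in sequentially. ?g n \<le> ennreal ((\<kappa> \<omega> * J n \<omega>)\<^sup>2) + 4 * ennreal (Q n \<omega>)"
            using P.ln_disc_bound[of ?y]
          proof eventually_elim
            case (elim n)
            have m: "P.mret n i = incr a t n i \<omega>" if "i \<le> n" for i using \<open>\<forall>n. \<forall>i\<le>n. _ n i\<close> that by simp
            have J: "J n \<omega> = (\<Sum>i\<le>n. P.mret n i) - ?y" using m by (simp add: J_def step_int_def)
            have Q: "Q n \<omega> = (\<Sum>i\<le>n. (P.mret n i)\<^sup>2)" using m True by (simp add: Q_def)
            have "\<bar>J n \<omega>\<bar> \<le> l \<omega> + (\<kappa> \<omega> * J n \<omega>)\<^sup>2"
            proof -
              have "(\<kappa> \<omega> * J n \<omega>)\<^sup>2 = (J n \<omega>)\<^sup>2 / l \<omega>"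
                using True l0 by (simp add: \<kappa>_def power_mult_distrib power_divide)
              moreover have "\<bar>J n \<omega>\<bar> * l \<omega> \<le> l \<omega> * l \<omega> + (J n \<omega>)\<^sup>2"
              proof -
                have "0 \<le> \<bar>J n \<omega>\<bar> * l \<omega>" using l0 by simp
                then show ?thesis using sum_squares_bound[of "\<bar>J n \<omega>\<bar>" "l \<omega>"]
                  by (simp add: power2_eq_square)
              qed
              then have "\<bar>J n \<omega>\<bar> \<le> l \<omega> + (J n \<omega>)\<^sup>2 / l \<omega>" using l0 by (simp add: field_simps)
              ultimately show ?thesis by simp
            qed
            then have "\<bar>ln (dprice a t \<omega>) - ?y\<bar> - l \<omega> - 5 * P.err n \<le> (\<kappa> \<omega> * J n \<omega>)\<^sup>2 + 4 * Q n \<omega>"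
              using elim unfolding d J Q by linarith
            then have "?g n \<le> ennreal ((\<kappa> \<omega> * J n \<omega>)\<^sup>2 + 4 * Q n \<omega>)" by (rule ennreal_leI)
            also have "\<dots> = ennreal ((\<kappa> \<omega> * J n \<omega>)\<^sup>2) + 4 * ennreal (Q n \<omega>)"
              using Q0[of n \<omega>] by (simp add: ennreal_plus ennreal_mult')
            finally show ?case .
          qed
        qed
        finally show ?thesis .
      qed (simp add: Z_def)
    qed
  qed auto
  also have "0 + 5 * (\<integral>\<^sup>+\<omega>. 4 * E1 \<omega> + 4 * E2 \<omega> \<partial>M) = 20 * (\<integral>\<^sup>+\<omega>. E1 \<omega> + E2 \<omega> \<partial>M)"
  proof -
    have "(\<integral>\<^sup>+\<omega>. 4 * E1 \<omega> + 4 * E2 \<omega> \<partial>M) = (\<integral>\<^sup>+\<omega>. 4 * (E1 \<omega> + E2 \<omega>) \<partial>M)"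
      by (simp only: distrib_left)
    also have "\<dots> = 4 * (\<integral>\<^sup>+\<omega>. E1 \<omega> + E2 \<omega> \<partial>M)"
      by (rule nn_integral_cmult) measurable
    finally show ?thesis by (simp add: mult.assoc[symmetric])
  qed
  also have "(\<integral>\<^sup>+\<omega>. E1 \<omega> + E2 \<omega> \<partial>M) = (\<integral>\<^sup>+\<omega>\<in>A. (ennreal (1 / l \<omega>) * energy a t (\<lambda>r. vol t r \<omega> - e \<omega>) + energy a t (\<lambda>r. vol t r \<omega>)) \<partial>M)"
  proof (rule nn_integral_cong)
    fix \<omega> assume \<omega>: "\<omega> \<in> space M"
    have vb [measurable]: "(\<lambda>r. vol t r \<omega>) \<in> borel_measurable borel" using section_borel[OF vol_joint[OF t] \<omega>] .
    have "E1 \<omega> = ennreal ((\<kappa> \<omega>)\<^sup>2) * energy a t (\<lambda>r. vol t r \<omega> - e \<omega>)"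
      unfolding E1_def mult_1 by (rule energy_scale) measurable
    moreover have "E2 \<omega> = ennreal ((indicator A \<omega>)\<^sup>2) * energy a t (\<lambda>r. vol t r \<omega>)"
      unfolding E2_def mult_1 diff_0_right by (rule energy_scale[OF vb])
    moreover have "(\<kappa> \<omega>)\<^sup>2 = indicator A \<omega> * (1 / l \<omega>)"
      using l_pos[OF \<omega>] by (simp add: \<kappa>_def power_divide power2_eq_square indicator_def)
    ultimately show "E1 \<omega> + E2 \<omega> = (ennreal (1 / l \<omega>) * energy a t (\<lambda>r. vol t r \<omega> - e \<omega>) + energy a t (\<lambda>r. vol t r \<omega>)) * indicator A \<omega>"
      by (simp add: indicator_def)
  qed
  finally have *: "(\<integral>\<^sup>+\<omega>. Z \<omega> \<partial>M) \<le> 20 * (\<integral>\<^sup>+\<omega>\<in>A. (ennreal (1 / l \<omega>) * energy a t (\<lambda>r. vol t r \<omega> - e \<omega>) + energy a t (\<lambda>r. vol t r \<omega>)) \<partial>M)" .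
  have "(\<integral>\<^sup>+\<omega>\<in>A. ennreal \<bar>ln (dprice a t \<omega>) - e \<omega> * (W t \<omega> - W a \<omega>)\<bar> \<partial>M) \<le> (\<integral>\<^sup>+\<omega>. ennreal (l \<omega>) * indicator A \<omega> + Z \<omega> \<partial>M)"
  proof (rule nn_integral_mono)
    fix \<omega> assume "\<omega> \<in> space M"
    let ?x = "\<bar>ln (dprice a t \<omega>) - e \<omega> * (W t \<omega> - W a \<omega>)\<bar>"
    have "0 \<le> l \<omega>" using l_pos[OF \<open>\<omega> \<in> space M\<close>] by simp
    have "ennreal ?x \<le> ennreal (l \<omega>) + ennreal (?x - l \<omega>)"
      by (cases "l \<omega> \<le> ?x") (use \<open>0 \<le> l \<omega>\<close> in \<open>auto simp: ennreal_plus[symmetric] simp del: ennreal_plus intro: add_increasing2 ennreal_leI\<close>)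
    then show "ennreal ?x * indicator A \<omega> \<le> ennreal (l \<omega>) * indicator A \<omega> + Z \<omega>"
      by (auto simp: Z_def indicator_def)
  qed
  also have "\<dots> = (\<integral>\<^sup>+\<omega>\<in>A. ennreal (l \<omega>) \<partial>M) + (\<integral>\<^sup>+\<omega>. Z \<omega> \<partial>M)"
    by (rule nn_integral_add) measurable
  finally show ?thesis using * by (meson add_left_mono order_trans)
qed

end

text \<open>The exceptional set is cut to \<open>g \<le> n\<close>, which makes the integrals over
  it finite, so that their difference can be formed in \<open>ennreal\<close> and shown to vanish.
  Restricting to subsets of \<open>G\<close> permits estimates that are available only
  there.\<close>

lemma (in sigma_finite_subalgebra) nn_cond_exp_le_on:
  assumes [measurable]: "f \<in> borel_measurable M" "g \<in> borel_measurable F" "G \<in> sets F"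
    and le: "\<And>A. A \<in> sets F \<Longrightarrow> A \<subseteq> G \<Longrightarrow> (\<integral>\<^sup>+\<omega>\<in>A. f \<omega> \<partial>M) \<le> (\<integral>\<^sup>+\<omega>\<in>A. g \<omega> \<partial>M)"
    and fin: "emeasure M (space M) < top"
  shows "AE \<omega> in M. \<omega> \<in> G \<longrightarrow> nn_cond_exp M F f \<omega> \<le> g \<omega>"
proof -
  define c where "c = nn_cond_exp M F f"
  have cF [measurable]: "c \<in> borel_measurable F" unfolding c_def by simp
  have sp: "space F = space M" using subalg by (simp add: subalgebra_def)
  have [measurable]: "c \<in> borel_measurable M" "g \<in> borel_measurable M"
    using measurable_from_subalg[OF subalg cF] measurable_from_subalg[OF subalg assms(2)] by auto
  define A where "A n = {\<omega> \<in> space F. \<omega> \<in> G \<and> g \<omega> < c \<omega> \<and> g \<omega> \<le> of_nat n}" for n :: nat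
  have AF [measurable]: "A n \<in> sets F" for n unfolding A_def by measurable
  have [measurable]: "A n \<in> sets M" for n using AF subalg by (auto simp: subalgebra_def)
  have "AE \<omega> in M. \<omega> \<notin> A n" for n
  proof -
    have "(\<integral>\<^sup>+\<omega>. c \<omega> * indicator (A n) \<omega> \<partial>M) = (\<integral>\<^sup>+\<omega>\<in>A n. f \<omega> \<partial>M)"
      using nn_cond_exp_intg[of "indicator (A n)" f] by (simp add: c_def mult.commute)
    also have "\<dots> \<le> (\<integral>\<^sup>+\<omega>\<in>A n. g \<omega> \<partial>M)" by (intro le AF) (auto simp: A_def)
    finally have 1: "(\<integral>\<^sup>+\<omega>. c \<omega> * indicator (A n) \<omega> \<partial>M) \<le> (\<integral>\<^sup>+\<omega>. g \<omega> * indicator (A n) \<omega> \<partial>M)" .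
    have "(\<integral>\<^sup>+\<omega>. g \<omega> * indicator (A n) \<omega> \<partial>M) \<le> (\<integral>\<^sup>+\<omega>. of_nat n \<partial>M)"
      by (intro nn_integral_mono) (auto simp: A_def indicator_def)
    also have "\<dots> < top" using fin by (simp add: ennreal_mult_less_top of_nat_less_top)
    finally have fin': "(\<integral>\<^sup>+\<omega>. g \<omega> * indicator (A n) \<omega> \<partial>M) < top" .
    have "(\<integral>\<^sup>+\<omega>. c \<omega> * indicator (A n) \<omega> - g \<omega> * indicator (A n) \<omega> \<partial>M) =
      (\<integral>\<^sup>+\<omega>. c \<omega> * indicator (A n) \<omega> \<partial>M) - (\<integral>\<^sup>+\<omega>. g \<omega> * indicator (A n) \<omega> \<partial>M)"
    proof (rule nn_integral_diff)
      show "AE \<omega> in M. g \<omega> * indicator (A n) \<omega> \<le> c \<omega> * indicator (A n) \<omega>"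
        by (intro AE_I2) (auto simp: A_def indicator_def intro: less_imp_le)
      show "(\<integral>\<^sup>+\<omega>. g \<omega> * indicator (A n) \<omega> \<partial>M) \<noteq> \<infinity>" using fin' by simp
    qed measurable
    also have "\<dots> = 0" using 1 le_less_trans[OF 1 fin'] by (simp add: diff_eq_0_iff_ennreal)
    finally have "AE \<omega> in M. c \<omega> * indicator (A n) \<omega> - g \<omega> * indicator (A n) \<omega> = 0"
      by (subst (asm) nn_integral_0_iff_AE) auto
    then show ?thesis
    proof eventually_elim
      case (elim \<omega>)
      show ?case
      proof
        assume "\<omega> \<in> A n"
        then have "c \<omega> - g \<omega> = 0" "g \<omega> < c \<omega>" using elim by (auto simp: A_def)
        then show False using ennreal_minus_eq_0[of "c \<omega>" "g \<omega>"] by simp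
      qed
    qed
  qed
  then have "AE \<omega> in M. \<forall>n. \<omega> \<notin> A n" by (simp add: AE_all_countable)
  then show ?thesis using AE_space
  proof eventually_elim
    case (elim \<omega>)
    show ?case
    proof (rule impI, rule ccontr)
      assume G: "\<omega> \<in> G" and "\<not> nn_cond_exp M F f \<omega> \<le> g \<omega>"
      then have "g \<omega> < c \<omega>" by (simp add: c_def)
      then have "g \<omega> < top" by (auto intro: less_le_trans)
      then obtain n :: nat where "g \<omega> < of_nat n" using ennreal_Ex_less_of_nat by blast
      then have "\<omega> \<in> A n" using G \<open>g \<omega> < c \<omega>\<close> elim(2) sp by (simp add: A_def)
      then show False using elim by simp
    qed
  qed
qed

section \<open>Supermartingale bound for the discounted price\<close>

context price_model
begin

lemma sets_F_M: "0 \<le> a \<Longrightarrow> A \<in> sets (F a) \<Longrightarrow> A \<in> sets M"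
  using subalgebra_F by (auto simp: subalgebra_def)

lemma dprice_M: "0 \<le> a \<Longrightarrow> a \<le> u \<Longrightarrow> dprice a u \<in> borel_measurable M"
  using F_imp_M[OF _ dprice_F] by auto

lemma vol_energy_measurable:
  assumes "0 \<le> a" "a < t"
  shows "(\<lambda>\<omega>. energy a t (\<lambda>r. vol t r \<omega>)) \<in> borel_measurable M"
  using vol_joint[of t] assms by (intro energy_measurable) auto

text \<open>The constant \<open>l\<close> is placed under the square:
  \<open>(l + J)\<^sup>2 \<ge> l\<^sup>2 + 2 * l * J\<close>, and \<open>J\<close> dominates the
  utility gain up to a vanishing error. As \<open>\<psi>\<close> is at most \<open>m\<close>, the
  energy term does not depend on \<open>l\<close>.\<close>

lemma log_utility_second_moment:
  fixes l m :: real
  assumes "0 \<le> a" "a < t" and A: "A \<in> sets (F a)" and m: "0 < m" and "0 \<le> l"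
  shows "(\<integral>\<^sup>+\<omega>\<in>A. ennreal (l\<^sup>2 + 2 * l * (m * ln (1 + dprice a t \<omega> / m) - m * ln (1 + 1 / m))) \<partial>M)
    \<le> ennreal (l\<^sup>2) * emeasure M A + 4 * (ennreal (m\<^sup>2) * (\<integral>\<^sup>+\<omega>\<in>A. energy a t (\<lambda>r. vol t r \<omega>) \<partial>M))"
proof -
  define \<psi> :: "real \<Rightarrow> real" where "\<psi> x = x / (1 + x / m)" for x
  have [measurable]: "\<psi> \<in> borel_measurable borel" unfolding \<psi>_def by measurable
  have \<psi>_cont: "continuous_on {0<..} \<psi>" unfolding \<psi>_def using m
    by (intro continuous_intros) (auto simp: add_pos_pos less_imp_neq[symmetric])
  have \<psi>_bound: "0 \<le> \<psi> x" "\<psi> x \<le> m" if "0 < x" for x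
    unfolding \<psi>_def using m that by (auto simp: field_simps)
  have t: "0 \<le> t" using assms by simp
  note [measurable] = A sets_F_M[OF assms(1) A] dprice_M[of a t]
  have [measurable]: "dprice a t \<in> borel_measurable M" using assms by (intro dprice_M) auto
  define J where "J = step_int a t \<psi> (\<lambda>_. 1) (\<lambda>_. 0)"
  define V where "V = step_energy a t \<psi> (\<lambda>_. 0) (indicator A)"
  have [measurable]: "J n \<in> borel_measurable M" "V n \<in> borel_measurable M" for n
    unfolding J_def V_def using assms by (auto intro!: step_int_measurable step_energy_measurable)
  define E where "E \<omega> = energy a t (\<lambda>r. indicator A \<omega> * (\<psi> (dprice a (max a (min t r)) \<omega>) * vol t r \<omega> - 0))" for \<omega>
  have [measurable]: "E \<in> borel_measurable M"
    unfolding E_def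
    using dprice_cut_energy_measurable[OF assms(1,2) _ \<psi>_cont, of "\<lambda>_. 0" "indicator A"] by simp
  define gain where "gain \<omega> = m * ln (1 + dprice a t \<omega> / m) - m * ln (1 + 1 / m)" for \<omega>
  have [measurable]: "gain \<in> borel_measurable M" unfolding gain_def by measurable
  define Z where "Z \<omega> = ennreal (l\<^sup>2 + 2 * l * gain \<omega>) * indicator A \<omega>" for \<omega>
  have [measurable]: "Z \<in> borel_measurable M" unfolding Z_def by measurable
  have "(\<integral>\<^sup>+\<omega>. Z \<omega> \<partial>M) \<le> (\<integral>\<^sup>+\<omega>. ennreal ((l * indicator A \<omega>)\<^sup>2) \<partial>M) + 1 * (\<integral>\<^sup>+\<omega>. 4 * E \<omega> \<partial>M)"
  proof (rule Fatou_bound[OF prob_space_axioms, where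
      Zk = "\<lambda>n \<omega>. ennreal ((l * indicator A \<omega> + indicator A \<omega> * J n \<omega>)\<^sup>2)" and Vk = V])
    fix n and b :: real assume b: "0 \<le> b"
    show "(\<integral>\<^sup>+\<omega>. (if V n \<omega> < ennreal b then ennreal ((l * indicator A \<omega> + indicator A \<omega> * J n \<omega>)\<^sup>2) else 0) \<partial>M)
      \<le> (\<integral>\<^sup>+\<omega>. ennreal ((l * indicator A \<omega>)\<^sup>2) \<partial>M) + 1 * (\<integral>\<^sup>+\<omega>. min (V n \<omega>) (ennreal b) \<partial>M)"
      unfolding V_def J_def mult_1 using b
      by (intro step_second_moment[OF assms(1,2)]) auto
  next
    show "AE \<omega> in M. \<exists>d. d \<longlonglongrightarrow> 0 \<and> (\<forall>\<^sub>F n in sequentially. V n \<omega> \<le> 4 * E \<omega> + d n)"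
      using step_energy_limit[OF assms(1,2) _ \<psi>_cont, of "\<lambda>_. 0" "indicator A"] unfolding V_def E_def by simp
    show "AE \<omega> in M. Z \<omega> \<le> liminf (\<lambda>n. ennreal ((l * indicator A \<omega> + indicator A \<omega> * J n \<omega>)\<^sup>2))"
      using incr_eq_mret[OF assms(1,2)] AE_space
    proof eventually_elim
      case (elim \<omega>)
      interpret P: positive_path a t "\<lambda>u. S u \<omega>" "rate a" "\<lambda>u. drift u \<omega>" by (rule positive_path[OF assms(1,2) elim(2)])
      have d: "dprice a u \<omega> = P.disc u" for u using dprice_disc[OF assms(1,2) elim(2)] .
      show ?case
      proof (cases "\<omega> \<in> A")
        case True
        let ?g = "\<lambda>n. ennreal (l\<^sup>2 + 2 * l * (gain \<omega> - m * P.err n))"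
        have "(\<lambda>n. l\<^sup>2 + 2 * l * (gain \<omega> - m * P.err n)) \<longlonglongrightarrow> l\<^sup>2 + 2 * l * (gain \<omega> - m * 0)"
          by (intro tendsto_intros P.err_tendsto_0)
        then have "?g \<longlonglongrightarrow> Z \<omega>" using True by (auto simp: Z_def intro!: tendsto_ennrealI)
        then have "Z \<omega> = liminf ?g" using lim_imp_Liminf[OF trivial_limit_sequentially] by metis
        also have "\<dots> \<le> liminf (\<lambda>n. ennreal ((l * indicator A \<omega> + indicator A \<omega> * J n \<omega>)\<^sup>2))"
        proof (intro Liminf_mono always_eventually allI ennreal_leI)
          fix n
          have "J n \<omega> = (\<Sum>i\<le>n. \<psi> (P.disc (grid a t n i)) * P.mret n i)"
            using elim(1) by (simp add: J_def step_int_def d)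
          then have "gain \<omega> - m * P.err n \<le> J n \<omega>"
            using P.log_utility_bound[OF m, of n] by (simp add: gain_def d \<psi>_def)
          then have le: "2 * l * (gain \<omega> - m * P.err n) \<le> 2 * l * J n \<omega>" using \<open>0 \<le> l\<close> by (intro mult_left_mono) auto
          have "(l * indicator A \<omega> + indicator A \<omega> * J n \<omega>)\<^sup>2 = l\<^sup>2 + (J n \<omega>)\<^sup>2 + 2 * l * J n \<omega>"
            using True by (simp add: power2_sum)
          then show "l\<^sup>2 + 2 * l * (gain \<omega> - m * P.err n) \<le> (l * indicator A \<omega> + indicator A \<omega> * J n \<omega>)\<^sup>2"
            using le zero_le_power2[of "J n \<omega>"] by linarith
        qed
        finally show ?thesis .
      qed (simp add: Z_def)
    qed
  qed auto
  also have "(\<integral>\<^sup>+\<omega>. ennreal ((l * indicator A \<omega>)\<^sup>2) \<partial>M) = ennreal (l\<^sup>2) * emeasure M A"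
  proof -
    have "(\<integral>\<^sup>+\<omega>. ennreal ((l * indicator A \<omega>)\<^sup>2) \<partial>M) = (\<integral>\<^sup>+\<omega>. ennreal (l\<^sup>2) * indicator A \<omega> \<partial>M)"
      by (intro nn_integral_cong) (simp add: indicator_def)
    then show ?thesis by (simp add: nn_integral_cmult_indicator)
  qed
  also have "1 * (\<integral>\<^sup>+\<omega>. 4 * E \<omega> \<partial>M) \<le> 4 * (ennreal (m\<^sup>2) * (\<integral>\<^sup>+\<omega>\<in>A. energy a t (\<lambda>r. vol t r \<omega>) \<partial>M))"
  proof -
    note [measurable] = vol_energy_measurable[OF assms(1,2)]
    have "(\<integral>\<^sup>+\<omega>. E \<omega> \<partial>M) \<le> (\<integral>\<^sup>+\<omega>. ennreal (m\<^sup>2) * (energy a t (\<lambda>r. vol t r \<omega>) * indicator A \<omega>) \<partial>M)"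
    proof (rule nn_integral_mono)
      fix \<omega> assume \<omega>: "\<omega> \<in> space M"
      have vb: "(\<lambda>r. vol t r \<omega>) \<in> borel_measurable borel" using section_borel[OF vol_joint[OF t] \<omega>] .
      have "E \<omega> \<le> energy a t (\<lambda>r. (m * indicator A \<omega>) * vol t r \<omega>)"
        unfolding E_def
      proof (rule energy_mono)
        fix r
        have "0 < dprice a (max a (min t r)) \<omega>" using assms \<omega> by (intro dprice_pos) auto
        then have "(\<psi> (dprice a (max a (min t r)) \<omega>))\<^sup>2 \<le> m\<^sup>2" using \<psi>_bound by (intro power_mono) auto
        then have "(\<psi> (dprice a (max a (min t r)) \<omega>))\<^sup>2 * (vol t r \<omega>)\<^sup>2 \<le> m\<^sup>2 * (vol t r \<omega>)\<^sup>2" by (rule mult_right_mono) simp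
        then show "(indicator A \<omega> * (\<psi> (dprice a (max a (min t r)) \<omega>) * vol t r \<omega> - 0))\<^sup>2 \<le> (m * indicator A \<omega> * vol t r \<omega>)\<^sup>2"
          by (simp add: power_mult_distrib indicator_def)
      qed
      also have "\<dots> = ennreal (m\<^sup>2) * (energy a t (\<lambda>r. vol t r \<omega>) * indicator A \<omega>)"
        unfolding energy_scale[OF vb] by (simp add: indicator_def)
      finally show "E \<omega> \<le> ennreal (m\<^sup>2) * (energy a t (\<lambda>r. vol t r \<omega>) * indicator A \<omega>)" .
    qed
    also have "\<dots> = ennreal (m\<^sup>2) * (\<integral>\<^sup>+\<omega>\<in>A. energy a t (\<lambda>r. vol t r \<omega>) \<partial>M)"
      by (rule nn_integral_cmult) measurable
    finally have "4 * (\<integral>\<^sup>+\<omega>. E \<omega> \<partial>M) \<le> 4 * (ennreal (m\<^sup>2) * (\<integral>\<^sup>+\<omega>\<in>A. energy a t (\<lambda>r. vol t r \<omega>) \<partial>M))"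
      by (rule mult_left_mono) simp
    then show ?thesis by (simp add: nn_integral_cmult)
  qed
  finally show ?thesis unfolding Z_def gain_def by (simp add: add_left_mono)
qed

text \<open>Cancelling \<open>l\<^sup>2\<close> and dividing by \<open>2 * l\<close> leaves an error
  of order \<open>1 / l\<close>, which disappears as \<open>l\<close> grows. Thus a bound on squares
  yields a bound on a mean, with no separate argument that the integrals are centred.\<close>

lemma log_utility_mean:
  assumes "0 \<le> a" "a < t" and A: "A \<in> sets (F a)" and m: "0 < m"
    and fin: "(\<integral>\<^sup>+\<omega>\<in>A. energy a t (\<lambda>r. vol t r \<omega>) \<partial>M) < top"
  shows "(\<integral>\<^sup>+\<omega>\<in>A. ennreal (m * ln (1 + dprice a t \<omega> / m)) \<partial>M) \<le> ennreal (m * ln (1 + 1 / m)) * emeasure M A"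
proof -
  define \<phi> where "\<phi> x = m * ln (1 + x / m)" for x
  have \<phi>: "0 \<le> \<phi> x" if "0 \<le> x" for x unfolding \<phi>_def using m that by (intro mult_nonneg_nonneg ln_ge_zero) auto
  note [measurable] = sets_F_M[OF assms(1) A]
  have [measurable]: "dprice a t \<in> borel_measurable M" using assms by (intro dprice_M) auto
  have [measurable]: "\<phi> \<in> borel_measurable borel" unfolding \<phi>_def by measurable
  define I where "I = (\<integral>\<^sup>+\<omega>\<in>A. ennreal (\<phi> (dprice a t \<omega>)) \<partial>M)"
  obtain v where v: "0 \<le> v" "(\<integral>\<^sup>+\<omega>\<in>A. energy a t (\<lambda>r. vol t r \<omega>) \<partial>M) = ennreal v"
    using fin by (cases "\<integral>\<^sup>+\<omega>\<in>A. energy a t (\<lambda>r. vol t r \<omega>) \<partial>M") auto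
  \<comment> \<open>For \<open>l\<close> at least twice \<open>\<phi> 1\<close>, the coefficient
    \<open>l\<^sup>2 - 2 * l * \<phi> 1\<close> is nonnegative, so \<open>ennreal\<close> cuts
    nothing off and the integral splits.\<close>
  have key: "ennreal ((l\<^sup>2 - 2 * l * \<phi> 1) * prob A) + ennreal (2 * l) * I \<le> ennreal (l\<^sup>2 * prob A + 4 * (m\<^sup>2 * v))"
    if l: "2 * \<phi> 1 \<le> l" for l
  proof -
    have l0: "0 \<le> l" using l \<phi>[of 1] by simp
    have c0: "0 \<le> l\<^sup>2 - 2 * l * \<phi> 1"
      using mult_left_mono[OF l l0] by (simp add: power2_eq_square mult_ac)
    have "ennreal ((l\<^sup>2 - 2 * l * \<phi> 1) * prob A) + ennreal (2 * l) * I =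
      (\<integral>\<^sup>+\<omega>. ennreal (l\<^sup>2 - 2 * l * \<phi> 1) * indicator A \<omega> + ennreal (2 * l) * (ennreal (\<phi> (dprice a t \<omega>)) * indicator A \<omega>) \<partial>M)"
      unfolding I_def using c0
      by (subst nn_integral_add) (auto simp: nn_integral_cmult nn_integral_cmult_indicator emeasure_eq_measure ennreal_mult)
    also have "\<dots> = (\<integral>\<^sup>+\<omega>\<in>A. ennreal (l\<^sup>2 + 2 * l * (\<phi> (dprice a t \<omega>) - \<phi> 1)) \<partial>M)"
    proof (rule nn_integral_cong)
      fix \<omega> assume \<omega>: "\<omega> \<in> space M"
      have "0 \<le> \<phi> (dprice a t \<omega>)" using dprice_pos[of a t \<omega>] assms \<omega> by (intro \<phi>) simp
      then have "ennreal (l\<^sup>2 - 2 * l * \<phi> 1) + ennreal (2 * l) * ennreal (\<phi> (dprice a t \<omega>)) = ennreal ((l\<^sup>2 - 2 * l * \<phi> 1) + 2 * l * \<phi> (dprice a t \<omega>))"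
        using c0 l0 by (simp add: ennreal_plus ennreal_mult)
      also have "(l\<^sup>2 - 2 * l * \<phi> 1) + 2 * l * \<phi> (dprice a t \<omega>) = l\<^sup>2 + 2 * l * (\<phi> (dprice a t \<omega>) - \<phi> 1)"
        by (simp add: algebra_simps)
      finally show "ennreal (l\<^sup>2 - 2 * l * \<phi> 1) * indicator A \<omega> + ennreal (2 * l) * (ennreal (\<phi> (dprice a t \<omega>)) * indicator A \<omega>)
        = ennreal (l\<^sup>2 + 2 * l * (\<phi> (dprice a t \<omega>) - \<phi> 1)) * indicator A \<omega>"
        by (simp add: indicator_def)
    qed
    also have "\<dots> \<le> ennreal (l\<^sup>2) * emeasure M A + 4 * (ennreal (m\<^sup>2) * ennreal v)"
      using log_utility_second_moment[OF assms(1-3) m l0] by (simp add: \<phi>_def v)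
    also have "\<dots> = ennreal (l\<^sup>2 * prob A + 4 * (m\<^sup>2 * v))"
      using v by (simp add: emeasure_eq_measure ennreal_plus ennreal_mult)
    finally show ?thesis .
  qed
  \<comment> \<open>The inequality for a single positive \<open>l\<close> already shows that
    \<open>I\<close> is finite, which permits subtraction in the reals.\<close>
  have "I < top"
  proof -
    define l where "l = max 1 (2 * \<phi> 1)"
    have "ennreal (2 * l) * I \<le> ennreal (l\<^sup>2 * prob A + 4 * (m\<^sup>2 * v))"
      using key[of l] by (rule order_trans[rotated]) (auto simp: l_def)
    then have "ennreal (2 * l) * I < top" by (rule le_less_trans) simp
    moreover have "0 < 2 * l" by (simp add: l_def)
    ultimately show ?thesis by (auto simp: ennreal_mult_less_top)
  qed
  then obtain y where y: "I = ennreal y" "0 \<le> y" by (cases I) auto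
  have le: "y \<le> \<phi> 1 * prob A + 2 * m\<^sup>2 * v / l" if l: "max 1 (2 * \<phi> 1) \<le> l" for l
  proof -
    have l0: "1 \<le> l" "2 * \<phi> 1 \<le> l" using l by auto
    have c0: "0 \<le> l\<^sup>2 - 2 * l * \<phi> 1"
      using mult_left_mono[OF l0(2), of l] l0 by (simp add: power2_eq_square mult_ac)
    have "ennreal ((l\<^sup>2 - 2 * l * \<phi> 1) * prob A + 2 * l * y) \<le> ennreal (l\<^sup>2 * prob A + 4 * (m\<^sup>2 * v))"
      using key[OF l0(2)] c0 y l0 by (simp add: ennreal_plus ennreal_mult)
    then have "(l\<^sup>2 - 2 * l * \<phi> 1) * prob A + 2 * l * y \<le> l\<^sup>2 * prob A + 4 * (m\<^sup>2 * v)"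
      using v by (subst (asm) ennreal_le_iff) auto
    then have "2 * l * y \<le> 2 * l * (\<phi> 1 * prob A) + 4 * (m\<^sup>2 * v)" by (simp add: algebra_simps)
    then show ?thesis using l0 by (simp add: field_simps)
  qed
  have "y \<le> \<phi> 1 * prob A"
  proof (rule tendsto_lowerbound)
    have "((\<lambda>l. \<phi> 1 * prob A + 2 * m\<^sup>2 * v / l) \<longlongrightarrow> \<phi> 1 * prob A + 0) at_top"
      by (intro tendsto_add tendsto_const tendsto_divide_0[OF tendsto_const] filterlim_at_top_imp_at_infinity filterlim_ident)
    then show "((\<lambda>l. \<phi> 1 * prob A + 2 * m\<^sup>2 * v / l) \<longlongrightarrow> \<phi> 1 * prob A) at_top" by simp
    show "\<forall>\<^sub>F l in at_top. y \<le> \<phi> 1 * prob A + 2 * m\<^sup>2 * v / l"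
      using eventually_ge_at_top[of "max 1 (2 * \<phi> 1)"] by eventually_elim (rule le)
  qed simp
  then have "I \<le> ennreal (\<phi> 1 * prob A)" unfolding y by (rule ennreal_leI)
  also have "\<dots> = ennreal (\<phi> 1) * emeasure M A" using \<phi>[of 1] by (simp add: emeasure_eq_measure ennreal_mult)
  finally show ?thesis by (simp add: I_def \<phi>_def)
qed

text \<open>Fatou along the utilities with \<open>m = Suc k\<close>: their value at 1 is at most 1,
  while they tend to the identity.\<close>

lemma dprice_mean:
  assumes "0 \<le> a" "a < t" and A: "A \<in> sets (F a)"
    and fin: "(\<integral>\<^sup>+\<omega>\<in>A. energy a t (\<lambda>r. vol t r \<omega>) \<partial>M) < top"
  shows "(\<integral>\<^sup>+\<omega>\<in>A. ennreal (dprice a t \<omega>) \<partial>M) \<le> emeasure M A"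
proof -
  define \<phi> :: "nat \<Rightarrow> real \<Rightarrow> real" where "\<phi> k x = real (Suc k) * ln (1 + x / real (Suc k))" for k x
  note [measurable] = sets_F_M[OF assms(1) A]
  have [measurable]: "dprice a t \<in> borel_measurable M" using assms by (intro dprice_M) auto
  have [measurable]: "\<phi> k \<in> borel_measurable borel" for k unfolding \<phi>_def by measurable
  \<comment> \<open>\<open>ln (1 + z) \<ge> z - z\<^sup>2\<close> for
    \<open>0 \<le> z \<le> 1\<close> gives \<open>\<phi> k y \<ge> y - y\<^sup>2 / Suc k\<close> as
    soon as \<open>y \<le> Suc k\<close>.\<close>
  have lower: "x \<le> liminf (\<lambda>k. ennreal (\<phi> k y))" if x: "x = ennreal y" "0 < y" for x y
  proof -
    have "(\<lambda>k. y - y\<^sup>2 / real (Suc k)) \<longlonglongrightarrow> y - 0"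
      by (intro tendsto_diff tendsto_const LIMSEQ_Suc[OF lim_const_over_n])
    then have "(\<lambda>k. ennreal (y - y\<^sup>2 / real (Suc k))) \<longlonglongrightarrow> ennreal y"
      by (intro tendsto_ennrealI) simp
    then have "ennreal y = liminf (\<lambda>k. ennreal (y - y\<^sup>2 / real (Suc k)))"
      using lim_imp_Liminf[OF trivial_limit_sequentially] by metis
    also have "\<dots> \<le> liminf (\<lambda>k. ennreal (\<phi> k y))"
    proof (rule Liminf_mono)
      obtain N :: nat where N: "y < real N" using reals_Archimedean2 by blast
      show "\<forall>\<^sub>F k in sequentially. ennreal (y - y\<^sup>2 / real (Suc k)) \<le> ennreal (\<phi> k y)"
        using eventually_ge_at_top[of N]
      proof eventually_elim
        case (elim k)
        define c where "c = real (Suc k)"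
        have c: "y \<le> c" "0 < c" using N elim by (auto simp: c_def)
        then have "y / c - (y / c)\<^sup>2 \<le> ln (1 + y / c)"
          using x by (intro ln_one_plus_pos_lower_bound) auto
        then have "c * (y / c - (y / c)\<^sup>2) \<le> c * ln (1 + y / c)" using c by (intro mult_left_mono) auto
        also have "c * (y / c - (y / c)\<^sup>2) = y - y\<^sup>2 / c" using c by (simp add: field_simps power2_eq_square)
        finally show ?case unfolding \<phi>_def c_def by (rule ennreal_leI)
      qed
    qed
    finally show ?thesis using x by simp
  qed
  have "(\<integral>\<^sup>+\<omega>\<in>A. ennreal (dprice a t \<omega>) \<partial>M) \<le> (\<integral>\<^sup>+\<omega>. liminf (\<lambda>k. ennreal (\<phi> k (dprice a t \<omega>)) * indicator A \<omega>) \<partial>M)"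
  proof (rule nn_integral_mono)
    fix \<omega> assume "\<omega> \<in> space M"
    then have "0 < dprice a t \<omega>" using assms by (intro dprice_pos) auto
    from lower[OF refl this]
    show "ennreal (dprice a t \<omega>) * indicator A \<omega> \<le> liminf (\<lambda>k. ennreal (\<phi> k (dprice a t \<omega>)) * indicator A \<omega>)"
      by (cases "\<omega> \<in> A") simp_all
  qed
  also have "\<dots> \<le> liminf (\<lambda>k. \<integral>\<^sup>+\<omega>\<in>A. ennreal (\<phi> k (dprice a t \<omega>)) \<partial>M)"
    by (rule nn_integral_liminf) measurable
  also have "\<dots> \<le> liminf (\<lambda>k. emeasure M A)"
  proof (intro Liminf_mono always_eventually allI)
    fix k
    have "\<phi> k 1 \<le> real (Suc k) * (1 / real (Suc k))"
      unfolding \<phi>_def by (intro mult_left_mono ln_add_one_self_le_self) auto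
    then have "ennreal (\<phi> k 1) * emeasure M A \<le> 1 * emeasure M A"
      by (intro mult_right_mono) (auto simp: ennreal_le_1)
    moreover have "(\<integral>\<^sup>+\<omega>\<in>A. ennreal (\<phi> k (dprice a t \<omega>)) \<partial>M) \<le> ennreal (\<phi> k 1) * emeasure M A"
      unfolding \<phi>_def by (rule log_utility_mean[OF assms(1-3) _ fin]) simp
    ultimately show "(\<integral>\<^sup>+\<omega>\<in>A. ennreal (\<phi> k (dprice a t \<omega>)) \<partial>M) \<le> emeasure M A" by simp
  qed
  also have "\<dots> = emeasure M A" by (simp add: Liminf_const)
  finally show ?thesis .
qed

text \<open>After Tonelli the hypothesis is applied at one fixed time after another, so bounds that
  hold almost surely for each \<open>s\<close> separately suffice. The weight \<open>w\<close> is
  known at time \<open>a\<close> and passes through the conditional expectation.\<close>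

lemma vol_deviation_energy:
  assumes "0 \<le> a" "a < t" and w: "w \<in> borel_measurable (F a)" and U: "U \<in> borel_measurable (F a)"
    and le: "\<And>s. a < s \<Longrightarrow> s \<le> t \<Longrightarrow> AE \<omega> in M. nn_cond_exp M (F a) (\<lambda>\<omega>. ennreal (\<bar>\<delta> s \<omega> - \<delta> a \<omega>\<bar>\<^sup>2)) \<omega> \<le> U \<omega>"
  shows "(\<integral>\<^sup>+\<omega>. energy a t (\<lambda>r. vol t r \<omega> - \<delta> a \<omega>) * w \<omega> \<partial>M) \<le> ennreal (t - a) * (\<integral>\<^sup>+\<omega>. U \<omega> * w \<omega> \<partial>M)"
proof -
  interpret Fa: finite_measure_subalgebra M "F a"
    using subalgebra_F[OF assms(1)] by unfold_locales
  interpret LM: pair_sigma_finite lborel M ..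
  have t: "0 \<le> t" using assms by simp
  note [measurable] = w U F_imp_M[OF assms(1) w]
  have [measurable]: "\<delta> s \<in> borel_measurable M" if "0 \<le> s" for s using F_imp_M[OF that \<delta>_F[OF that]] .
  have da [measurable]: "\<delta> a \<in> borel_measurable M" using assms by simp
  note [measurable] = vol_joint[OF t]
  have "(\<lambda>x. (snd x, fst x)) \<in> borel \<Otimes>\<^sub>M M \<rightarrow>\<^sub>M M \<Otimes>\<^sub>M (borel :: real measure)" by measurable
  from measurable_compose[OF this vol_joint[OF t]]
  have [measurable]: "(\<lambda>x. vol t (fst x) (snd x)) \<in> borel_measurable (borel \<Otimes>\<^sub>M M)" by simp
  define f where "f r \<omega> = ennreal ((vol t r \<omega> - \<delta> a \<omega>)\<^sup>2) * indicator {a<..t} r * w \<omega>" for r \<omega>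
  have [measurable]: "case_prod f \<in> borel_measurable (lborel \<Otimes>\<^sub>M M)"
    unfolding f_def case_prod_beta' by measurable
  have "(\<integral>\<^sup>+\<omega>. energy a t (\<lambda>r. vol t r \<omega> - \<delta> a \<omega>) * w \<omega> \<partial>M) = (\<integral>\<^sup>+\<omega>. (\<integral>\<^sup>+r. f r \<omega> \<partial>lborel) \<partial>M)"
  proof (rule nn_integral_cong)
    fix \<omega> assume \<omega>: "\<omega> \<in> space M"
    have [measurable]: "(\<lambda>r. vol t r \<omega>) \<in> borel_measurable borel" using section_borel[OF vol_joint[OF t] \<omega>] .
    show "energy a t (\<lambda>r. vol t r \<omega> - \<delta> a \<omega>) * w \<omega> = (\<integral>\<^sup>+r. f r \<omega> \<partial>lborel)"
      unfolding energy_def f_def by (subst nn_integral_multc[symmetric]) auto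
  qed
  also have "\<dots> = (\<integral>\<^sup>+r. (\<integral>\<^sup>+\<omega>. f r \<omega> \<partial>M) \<partial>lborel)"
    by (rule LM.Fubini') measurable
  also have "\<dots> \<le> (\<integral>\<^sup>+r. (\<integral>\<^sup>+\<omega>. U \<omega> * w \<omega> \<partial>M) * indicator {a<..t} r \<partial>lborel)"
  proof (rule nn_integral_mono)
    fix r
    show "(\<integral>\<^sup>+\<omega>. f r \<omega> \<partial>M) \<le> (\<integral>\<^sup>+\<omega>. U \<omega> * w \<omega> \<partial>M) * indicator {a<..t} r"
    proof (cases "a < r \<and> r \<le> t")
      case True
      then have r: "0 \<le> r" using assms by simp
      have "(\<integral>\<^sup>+\<omega>. f r \<omega> \<partial>M) = (\<integral>\<^sup>+\<omega>. w \<omega> * ennreal (\<bar>\<delta> r \<omega> - \<delta> a \<omega>\<bar>\<^sup>2) \<partial>M)"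
        using True r by (intro nn_integral_cong) (simp add: f_def vol_def mult.commute)
      also have "\<dots> = (\<integral>\<^sup>+\<omega>. w \<omega> * nn_cond_exp M (F a) (\<lambda>\<omega>. ennreal (\<bar>\<delta> r \<omega> - \<delta> a \<omega>\<bar>\<^sup>2)) \<omega> \<partial>M)"
        using r by (intro Fa.nn_cond_exp_intg[symmetric]) measurable
      also have "\<dots> \<le> (\<integral>\<^sup>+\<omega>. U \<omega> * w \<omega> \<partial>M)"
      proof (rule nn_integral_mono_AE)
        show "AE \<omega> in M. w \<omega> * nn_cond_exp M (F a) (\<lambda>\<omega>. ennreal (\<bar>\<delta> r \<omega> - \<delta> a \<omega>\<bar>\<^sup>2)) \<omega> \<le> U \<omega> * w \<omega>"
          using le[OF conjunct1[OF True] conjunct2[OF True]] by eventually_elim (simp add: mult.commute[of "U _"] mult_left_mono)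
      qed
      finally show ?thesis using True by simp
    next
      case False
      then have "f r \<omega> = 0" for \<omega> by (auto simp: f_def)
      then show ?thesis by simp
    qed
  qed
  also have "\<dots> = ennreal (t - a) * (\<integral>\<^sup>+\<omega>. U \<omega> * w \<omega> \<partial>M)"
    using assms by (subst nn_integral_cmult_indicator) (auto simp: mult.commute)
  finally show ?thesis .
qed

end

section \<open>Conditional expectation of the call payoff\<close>

context price_model
begin

lemma vol_energy_le:
  assumes "0 \<le> a" "a < t" "\<omega> \<in> space M"
  shows "energy a t (\<lambda>r. vol t r \<omega>) \<le> 2 * energy a t (\<lambda>r. vol t r \<omega> - \<delta> a \<omega>) + 2 * ennreal ((\<delta> a \<omega>)\<^sup>2 * (t - a))"
proof -
  have t: "0 \<le> t" using assms by simp
  have [measurable]: "(\<lambda>r. vol t r \<omega>) \<in> borel_measurable borel" using section_borel[OF vol_joint[OF t] assms(3)] .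
  have "energy a t (\<lambda>r. vol t r \<omega>) \<le> 2 * energy a t (\<lambda>r. vol t r \<omega> - \<delta> a \<omega>) + 2 * energy a t (\<lambda>_. \<delta> a \<omega>)"
  proof (rule energy_le_sum)
    fix r show "(vol t r \<omega>)\<^sup>2 \<le> 2 * (vol t r \<omega> - \<delta> a \<omega>)\<^sup>2 + 2 * (\<delta> a \<omega>)\<^sup>2"
      using power2_add_le[of "vol t r \<omega> - \<delta> a \<omega>" "\<delta> a \<omega>"] by simp
  qed measurable
  also have "energy a t (\<lambda>_. \<delta> a \<omega>) = ennreal ((\<delta> a \<omega>)\<^sup>2 * (t - a))"
    unfolding energy_def using assms by (subst nn_integral_cmult_indicator) (auto simp: ennreal_mult)
  finally show ?thesis .
qed

definition log_err :: "real \<Rightarrow> real \<Rightarrow> 'a \<Rightarrow> real" where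
  "log_err a t \<omega> = \<bar>ln (dprice a t \<omega>) - \<delta> a \<omega> * (W t \<omega> - W a \<omega>)\<bar>"

text \<open>Testing against all sets of \<open>F a\<close> converts the integrated bound on the
  logarithm into a conditional one. The level \<open>l\<close> stays free, to be balanced against
  \<open>U\<close>.\<close>

lemma log_err_cond_exp:
  assumes "0 \<le> a" "a < t" and U: "U \<in> borel_measurable (F a)"
    and le: "\<And>s. a < s \<Longrightarrow> s \<le> t \<Longrightarrow> AE \<omega> in M. nn_cond_exp M (F a) (\<lambda>\<omega>. ennreal (\<bar>\<delta> s \<omega> - \<delta> a \<omega>\<bar>\<^sup>2)) \<omega> \<le> U \<omega>"
    and l: "l \<in> borel_measurable (F a)" and l_pos: "\<And>\<omega>. \<omega> \<in> space M \<Longrightarrow> 0 < l \<omega>"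
  shows "AE \<omega> in M. nn_cond_exp M (F a) (\<lambda>\<omega>. ennreal (log_err a t \<omega>)) \<omega> \<le>
    ennreal (l \<omega>) + 20 * (ennreal (t - a) * (U \<omega> * (ennreal (1 / l \<omega>) + 2)) + 2 * ennreal ((\<delta> a \<omega>)\<^sup>2 * (t - a)))"
    (is "AE \<omega> in M. _ \<le> ?g \<omega>")
proof -
  interpret Fa: finite_measure_subalgebra M "F a"
    using subalgebra_F[OF assms(1)] by unfold_locales
  have t: "0 \<le> t" using assms by simp
  have daF [measurable]: "\<delta> a \<in> borel_measurable (F a)" using \<delta>_F assms by simp
  note [measurable] = U l F_imp_M[OF assms(1) U] F_imp_M[OF assms(1) l] F_imp_M[OF assms(1) daF]
  have [measurable]: "dprice a t \<in> borel_measurable M" using assms by (intro dprice_M) auto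
  have [measurable]: "W t \<in> borel_measurable M" "W a \<in> borel_measurable M" using t assms by auto
  have [measurable]: "(\<lambda>\<omega>. energy a t (\<lambda>r. vol t r \<omega> - \<delta> a \<omega>)) \<in> borel_measurable M"
  proof -
    note [measurable] = vol_joint[OF t]
    show ?thesis by (rule energy_measurable) measurable
  qed
  have "AE \<omega> in M. \<omega> \<in> space M \<longrightarrow> nn_cond_exp M (F a) (\<lambda>\<omega>. ennreal (log_err a t \<omega>)) \<omega> \<le> ?g \<omega>"
  proof (rule Fa.nn_cond_exp_le_on)
    show "(\<lambda>\<omega>. ennreal (log_err a t \<omega>)) \<in> borel_measurable M" unfolding log_err_def by measurable
    show "?g \<in> borel_measurable (F a)" by measurable
    show "space M \<in> sets (F a)" using subalgebra_F[OF assms(1)] by (metis sets.top subalgebra_def)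
    show "emeasure M (space M) < top" by (simp add: emeasure_space_1)
    fix A assume A: "A \<in> sets (F a)"
    note [measurable] = A sets_F_M[OF assms(1) A]
    \<comment> \<open>The weight \<open>1 / l\<close> comes from the comparison with
      \<open>\<delta> a\<close>, the \<open>2\<close> from splitting the full energy of
      \<open>\<delta>\<close> around \<open>\<delta> a\<close>; the constant part of that splitting
      goes into \<open>d\<close>.\<close>
    define w where "w \<omega> = (ennreal (1 / l \<omega>) + 2) * indicator A \<omega>" for \<omega>
    have wF [measurable]: "w \<in> borel_measurable (F a)" unfolding w_def by measurable
    note [measurable] = F_imp_M[OF assms(1) wF]
    define d where "d \<omega> = 2 * ennreal ((\<delta> a \<omega>)\<^sup>2 * (t - a)) * indicator A \<omega>" for \<omega>
    have [measurable]: "d \<in> borel_measurable M" unfolding d_def by measurable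
    have "(\<integral>\<^sup>+\<omega>\<in>A. ennreal (log_err a t \<omega>) \<partial>M) \<le> (\<integral>\<^sup>+\<omega>\<in>A. ennreal (l \<omega>) \<partial>M) +
      20 * (\<integral>\<^sup>+\<omega>\<in>A. (ennreal (1 / l \<omega>) * energy a t (\<lambda>r. vol t r \<omega> - \<delta> a \<omega>) + energy a t (\<lambda>r. vol t r \<omega>)) \<partial>M)"
      unfolding log_err_def by (rule log_price_bound[OF assms(1,2) A daF l l_pos])
    also have "(\<integral>\<^sup>+\<omega>\<in>A. (ennreal (1 / l \<omega>) * energy a t (\<lambda>r. vol t r \<omega> - \<delta> a \<omega>) + energy a t (\<lambda>r. vol t r \<omega>)) \<partial>M)
      \<le> (\<integral>\<^sup>+\<omega>. energy a t (\<lambda>r. vol t r \<omega> - \<delta> a \<omega>) * w \<omega> + d \<omega> \<partial>M)"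
    proof (rule nn_integral_mono)
      fix \<omega> assume \<omega>: "\<omega> \<in> space M"
      show "(ennreal (1 / l \<omega>) * energy a t (\<lambda>r. vol t r \<omega> - \<delta> a \<omega>) + energy a t (\<lambda>r. vol t r \<omega>)) * indicator A \<omega>
        \<le> energy a t (\<lambda>r. vol t r \<omega> - \<delta> a \<omega>) * w \<omega> + d \<omega>"
        using add_left_mono[OF vol_energy_le[OF assms(1,2) \<omega>], of "ennreal (1 / l \<omega>) * energy a t (\<lambda>r. vol t r \<omega> - \<delta> a \<omega>)"]
        by (auto simp: w_def d_def indicator_def algebra_simps)
    qed
    also have "\<dots> = (\<integral>\<^sup>+\<omega>. energy a t (\<lambda>r. vol t r \<omega> - \<delta> a \<omega>) * w \<omega> \<partial>M) + (\<integral>\<^sup>+\<omega>. d \<omega> \<partial>M)"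
      by (rule nn_integral_add) measurable
    also have "\<dots> \<le> ennreal (t - a) * (\<integral>\<^sup>+\<omega>. U \<omega> * w \<omega> \<partial>M) + (\<integral>\<^sup>+\<omega>. d \<omega> \<partial>M)"
      by (intro add_right_mono vol_deviation_energy assms wF)
    also have "\<dots> = (\<integral>\<^sup>+\<omega>. ennreal (t - a) * (U \<omega> * w \<omega>) + d \<omega> \<partial>M)"
      by (simp add: nn_integral_add nn_integral_cmult)
    finally have "(\<integral>\<^sup>+\<omega>\<in>A. ennreal (log_err a t \<omega>) \<partial>M) \<le> (\<integral>\<^sup>+\<omega>\<in>A. ennreal (l \<omega>) \<partial>M) +
      20 * (\<integral>\<^sup>+\<omega>. ennreal (t - a) * (U \<omega> * w \<omega>) + d \<omega> \<partial>M)"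
      by (simp add: add_left_mono mult_left_mono)
    also have "\<dots> = (\<integral>\<^sup>+\<omega>. ennreal (l \<omega>) * indicator A \<omega> + 20 * (ennreal (t - a) * (U \<omega> * w \<omega>) + d \<omega>) \<partial>M)"
      by (simp add: nn_integral_add nn_integral_cmult)
    also have "\<dots> = (\<integral>\<^sup>+\<omega>\<in>A. ?g \<omega> \<partial>M)"
      by (intro nn_integral_cong) (simp add: w_def d_def indicator_def)
    finally show "(\<integral>\<^sup>+\<omega>\<in>A. ennreal (log_err a t \<omega>) \<partial>M) \<le> (\<integral>\<^sup>+\<omega>\<in>A. ?g \<omega> \<partial>M)" .
  qed
  then show ?thesis using AE_space by eventually_elim simp
qed

text \<open>The mean bound requires a finite integral of the energy of \<open>\<delta>\<close>. That
  is available on the sets where \<open>U\<close> and \<open>\<delta> a\<close> are bounded by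
  \<open>k\<close>, and these exhaust the set where \<open>U\<close> is finite.\<close>

lemma dprice_cond_exp:
  assumes "0 \<le> a" "a < t" and U: "U \<in> borel_measurable (F a)"
    and le: "\<And>s. a < s \<Longrightarrow> s \<le> t \<Longrightarrow> AE \<omega> in M. nn_cond_exp M (F a) (\<lambda>\<omega>. ennreal (\<bar>\<delta> s \<omega> - \<delta> a \<omega>\<bar>\<^sup>2)) \<omega> \<le> U \<omega>"
  shows "AE \<omega> in M. U \<omega> < top \<longrightarrow> nn_cond_exp M (F a) (\<lambda>\<omega>. ennreal (dprice a t \<omega>)) \<omega> \<le> 1"
proof -
  interpret Fa: finite_measure_subalgebra M "F a"
    using subalgebra_F[OF assms(1)] by unfold_locales
  have t: "0 \<le> t" using assms by simp
  have daF [measurable]: "\<delta> a \<in> borel_measurable (F a)" using \<delta>_F assms by simp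
  note [measurable] = U F_imp_M[OF assms(1) U] F_imp_M[OF assms(1) daF]
  have [measurable]: "(\<lambda>\<omega>. energy a t (\<lambda>r. vol t r \<omega> - \<delta> a \<omega>)) \<in> borel_measurable M"
  proof -
    note [measurable] = vol_joint[OF t]
    show ?thesis by (rule energy_measurable) measurable
  qed
  have sp: "space (F a) = space M" using subalgebra_F[OF assms(1)] by (simp add: subalgebra_def)
  define G where "G k = {\<omega> \<in> space (F a). U \<omega> \<le> of_nat k \<and> \<bar>\<delta> a \<omega>\<bar> \<le> real k}" for k :: nat
  have GF [measurable]: "G k \<in> sets (F a)" for k unfolding G_def by measurable
  have "AE \<omega> in M. \<omega> \<in> G k \<longrightarrow> nn_cond_exp M (F a) (\<lambda>\<omega>. ennreal (dprice a t \<omega>)) \<omega> \<le> 1" for k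
  proof (rule Fa.nn_cond_exp_le_on)
    show "(\<lambda>\<omega>. ennreal (dprice a t \<omega>)) \<in> borel_measurable M" using assms by (intro measurable_compose[OF dprice_M measurable_ennreal]) auto
    show "emeasure M (space M) < top" by (simp add: emeasure_space_1)
    fix A assume A: "A \<in> sets (F a)" "A \<subseteq> G k"
    note [measurable] = A(1) sets_F_M[OF assms(1) A(1)]
    have "(\<integral>\<^sup>+\<omega>\<in>A. energy a t (\<lambda>r. vol t r \<omega>) \<partial>M) \<le>
      (\<integral>\<^sup>+\<omega>. 2 * (energy a t (\<lambda>r. vol t r \<omega> - \<delta> a \<omega>) * indicator A \<omega>) + 2 * ennreal ((real k)\<^sup>2 * (t - a)) \<partial>M)"
    proof (rule nn_integral_mono)
      fix \<omega> assume \<omega>: "\<omega> \<in> space M"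
      show "energy a t (\<lambda>r. vol t r \<omega>) * indicator A \<omega> \<le> 2 * (energy a t (\<lambda>r. vol t r \<omega> - \<delta> a \<omega>) * indicator A \<omega>) + 2 * ennreal ((real k)\<^sup>2 * (t - a))"
      proof (cases "\<omega> \<in> A")
        case True
        then have "\<bar>\<delta> a \<omega>\<bar> \<le> real k" using A(2) by (auto simp: G_def)
        then have "(\<delta> a \<omega>)\<^sup>2 \<le> (real k)\<^sup>2" by (simp add: abs_le_square_iff[symmetric])
        then have "ennreal ((\<delta> a \<omega>)\<^sup>2 * (t - a)) \<le> ennreal ((real k)\<^sup>2 * (t - a))"
          using assms by (intro ennreal_leI mult_right_mono) auto
        then have "2 * energy a t (\<lambda>r. vol t r \<omega> - \<delta> a \<omega>) + 2 * ennreal ((\<delta> a \<omega>)\<^sup>2 * (t - a)) \<le>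
            2 * energy a t (\<lambda>r. vol t r \<omega> - \<delta> a \<omega>) + 2 * ennreal ((real k)\<^sup>2 * (t - a))"
          by (intro add_left_mono mult_left_mono) auto
        then show ?thesis using order_trans[OF vol_energy_le[OF assms(1,2) \<omega>]] True by simp
      qed simp
    qed
    also have "\<dots> = 2 * (\<integral>\<^sup>+\<omega>. energy a t (\<lambda>r. vol t r \<omega> - \<delta> a \<omega>) * indicator A \<omega> \<partial>M) + 2 * ennreal ((real k)\<^sup>2 * (t - a))"
      by (simp add: nn_integral_add nn_integral_cmult emeasure_space_1)
    also have "\<dots> \<le> 2 * (ennreal (t - a) * (\<integral>\<^sup>+\<omega>. U \<omega> * indicator A \<omega> \<partial>M)) + 2 * ennreal ((real k)\<^sup>2 * (t - a))"
      using A(1) by (intro add_right_mono mult_left_mono vol_deviation_energy assms) auto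
    also have "\<dots> \<le> 2 * (ennreal (t - a) * (\<integral>\<^sup>+\<omega>. of_nat k \<partial>M)) + 2 * ennreal ((real k)\<^sup>2 * (t - a))"
      using A(2) by (intro add_right_mono mult_left_mono nn_integral_mono) (auto simp: G_def indicator_def)
    also have "\<dots> < top"
      by (simp add: emeasure_space_1 ennreal_mult_less_top of_nat_less_top)
    finally have "(\<integral>\<^sup>+\<omega>\<in>A. ennreal (dprice a t \<omega>) \<partial>M) \<le> emeasure M A"
      by (intro dprice_mean[OF assms(1,2) A(1)])
    then show "(\<integral>\<^sup>+\<omega>\<in>A. ennreal (dprice a t \<omega>) \<partial>M) \<le> (\<integral>\<^sup>+\<omega>\<in>A. 1 \<partial>M)" by simp
  qed simp_all
  then have "AE \<omega> in M. \<forall>k. \<omega> \<in> G k \<longrightarrow> nn_cond_exp M (F a) (\<lambda>\<omega>. ennreal (dprice a t \<omega>)) \<omega> \<le> 1"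
    unfolding AE_all_countable by blast
  then show ?thesis using AE_space
  proof eventually_elim
    case (elim \<omega>)
    show ?case
    proof
      assume "U \<omega> < top"
      then obtain n1 :: nat where n1: "U \<omega> < of_nat n1" using ennreal_Ex_less_of_nat by blast
      obtain n2 :: nat where n2: "\<bar>\<delta> a \<omega>\<bar> < real n2" using reals_Archimedean2 by blast
      have "U \<omega> \<le> of_nat (max n1 n2)"
        using n1 by (intro order_trans[OF less_imp_le[OF n1]]) simp
      then have "\<omega> \<in> G (max n1 n2)" using n2 elim(2) sp by (simp add: G_def)
      then show "nn_cond_exp M (F a) (\<lambda>\<omega>. ennreal (dprice a t \<omega>)) \<omega> \<le> 1" using elim(1) by blast
    qed
  qed
qed

lemma rate_nonneg: "0 \<le> a \<Longrightarrow> a < t \<Longrightarrow> 0 \<le> rate a t"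
proof -
  assume a: "0 \<le> a" "a < t"
  obtain \<omega> where "\<omega> \<in> space M" using not_empty by blast
  then interpret P: positive_path a t "\<lambda>u. S u \<omega>" "rate a" "\<lambda>u. drift u \<omega>" by (intro positive_path a)
  show ?thesis using P.R_mono[of a t] P.R_a a by simp
qed

text \<open>Used with \<open>\<delta> a\<close> and with \<open>- \<delta> a\<close>; the equality
  of the two values makes the lower and the upper estimate of the call meet.\<close>

lemma gaussian_cond_exp:
  assumes "0 \<le> a" "a < t" and Y: "Y \<in> borel_measurable (F a)"
  shows "AE \<omega> in M. nn_cond_exp M (F a) (\<lambda>\<omega>. ennreal (max (Y \<omega> * (W t \<omega> - W a \<omega>)) 0)) \<omega> =
    ennreal (\<bar>Y \<omega>\<bar> * sqrt (t - a) / sqrt (2 * pi))"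
proof -
  interpret Fa: finite_measure_subalgebra M "F a"
    using subalgebra_F[OF assms(1)] by unfold_locales
  note [measurable] = Y F_imp_M[OF assms(1) Y]
  have [measurable]: "W t \<in> borel_measurable M" "W a \<in> borel_measurable M" using assms by auto
  have "AE \<omega> in M. ennreal (\<bar>Y \<omega>\<bar> * sqrt (t - a) / sqrt (2 * pi)) = nn_cond_exp M (F a) (\<lambda>\<omega>. ennreal (max (Y \<omega> * (W t \<omega> - W a \<omega>)) 0)) \<omega>"
  proof (rule Fa.nn_cond_exp_charact)
    fix A assume "A \<in> sets (F a)"
    then show "(\<integral>\<^sup>+\<omega>\<in>A. ennreal (max (Y \<omega> * (W t \<omega> - W a \<omega>)) 0) \<partial>M) =
        (\<integral>\<^sup>+\<omega>\<in>A. ennreal (\<bar>Y \<omega>\<bar> * sqrt (t - a) / sqrt (2 * pi)) \<partial>M)"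
      by (rule nn_integral_pos_part_increment[OF assms])
  qed measurable
  then show ?thesis by eventually_elim simp
qed

text \<open>The estimates live in \<open>ennreal\<close>, so every term stands on the side where it
  is nonnegative; the passage to real numbers needs \<open>U\<close> finite, whence the
  quantification over \<open>u\<close>. After discounting, the strike relative to \<open>S a\<close>
  is \<open>exp (- rate a t)\<close> instead of 1, which costs at most
  \<open>rate a t\<close>.\<close>

lemma call_cond_exp:
  assumes "0 \<le> a" "a < t" and U: "U \<in> borel_measurable (F a)"
    and le: "\<And>s. a < s \<Longrightarrow> s \<le> t \<Longrightarrow> AE \<omega> in M. nn_cond_exp M (F a) (\<lambda>\<omega>. ennreal (\<bar>\<delta> s \<omega> - \<delta> a \<omega>\<bar>\<^sup>2)) \<omega> \<le> U \<omega>"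
    and "0 < c"
  shows "AE \<omega> in M. \<forall>u l. U \<omega> = ennreal u \<and> 0 \<le> u \<and> l = sqrt (t - a) * (sqrt u + c) \<longrightarrow>
    \<bar>enn2real (nn_cond_exp M (F a) (\<lambda>\<omega>. ennreal (max (dprice a t \<omega> - exp (- rate a t)) 0)) \<omega>) - \<bar>\<delta> a \<omega>\<bar> * sqrt (t - a) / sqrt (2 * pi)\<bar>
    \<le> l + 20 * ((t - a) * (u * (1 / l + 2)) + 2 * ((\<delta> a \<omega>)\<^sup>2 * (t - a))) + rate a t"
proof -
  interpret Fa: finite_measure_subalgebra M "F a"
    using subalgebra_F[OF assms(1)] by unfold_locales
  have t: "0 \<le> t" using assms by simp
  have daF [measurable]: "\<delta> a \<in> borel_measurable (F a)" using \<delta>_F assms by simp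
  note [measurable] = U F_imp_M[OF assms(1) U] F_imp_M[OF assms(1) daF]
  have [measurable]: "dprice a t \<in> borel_measurable M" using assms by (intro dprice_M) auto
  have [measurable]: "W t \<in> borel_measurable M" "W a \<in> borel_measurable M" using t assms by auto
  have [measurable]: "log_err a t \<in> borel_measurable M" unfolding log_err_def by measurable
  let ?E = "nn_cond_exp M (F a)"
  define B where "B \<omega> = W t \<omega> - W a \<omega>" for \<omega>
  have [measurable]: "B \<in> borel_measurable M" unfolding B_def by measurable
  define C where "C \<omega> = max (dprice a t \<omega> - exp (- rate a t)) 0" for \<omega>
  have [measurable]: "C \<in> borel_measurable M" unfolding C_def by measurable
  \<comment> \<open>Balances the two error terms \<open>l\<close> and
    \<open>(t - a) * U / l\<close>; \<open>c > 0\<close> keeps \<open>l\<close> positive where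
    \<open>U\<close> is 0.\<close>
  define l where "l \<omega> = sqrt (t - a) * (sqrt (enn2real (U \<omega>)) + c)" for \<omega>
  have lF: "l \<in> borel_measurable (F a)" unfolding l_def by measurable
  have l_pos: "0 < l \<omega>" for \<omega> unfolding l_def using assms by (intro mult_pos_pos add_nonneg_pos) auto
  have R: "0 \<le> rate a t" using rate_nonneg[OF assms(1,2)] .
  have R1: "1 - rate a t \<le> exp (- rate a t)" "exp (- rate a t) \<le> 1"
    using exp_ge_add_one_self[of "- rate a t"] R by auto
  have ln_le: "ln x \<le> x - 1" if "0 < x" for x :: real using that by (rule ln_le_minus_one)
  \<comment> \<open>The lower estimate: \<open>\<delta> a * B \<le> ln X + log_err\<close>, and
    \<open>ln X \<le> X - 1 \<le> X - exp (- rate a t)\<close>, with \<open>X\<close> the discounted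
    relative price.\<close>
  have ae1: "AE \<omega> in M. ?E (\<lambda>\<omega>. ennreal (max (\<delta> a \<omega> * B \<omega>) 0)) \<omega> \<le> ?E (\<lambda>\<omega>. ennreal (C \<omega>) + ennreal (log_err a t \<omega>)) \<omega>"
  proof (rule Fa.nn_cond_exp_mono)
    show "AE \<omega> in M. ennreal (max (\<delta> a \<omega> * B \<omega>) 0) \<le> ennreal (C \<omega>) + ennreal (log_err a t \<omega>)"
    proof (rule AE_I2)
      fix \<omega> assume "\<omega> \<in> space M"
      then have X: "0 < dprice a t \<omega>" using assms by (intro dprice_pos) auto
      have "\<delta> a \<omega> * B \<omega> \<le> ln (dprice a t \<omega>) + log_err a t \<omega>" unfolding log_err_def B_def by simp
      moreover have "ln (dprice a t \<omega>) \<le> C \<omega>" using ln_le[OF X] R1 unfolding C_def by linarith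
      moreover have "0 \<le> C \<omega>" "0 \<le> log_err a t \<omega>" by (simp_all add: C_def log_err_def)
      ultimately have "max (\<delta> a \<omega> * B \<omega>) 0 \<le> C \<omega> + log_err a t \<omega>" by simp
      then show "ennreal (max (\<delta> a \<omega> * B \<omega>) 0) \<le> ennreal (C \<omega>) + ennreal (log_err a t \<omega>)"
        using \<open>0 \<le> C \<omega>\<close> \<open>0 \<le> log_err a t \<omega>\<close> by (simp add: ennreal_leI flip: ennreal_plus)
    qed
  qed measurable
  \<comment> \<open>The upper estimate, by put-call parity: if \<open>X \<ge> 1\<close>, the payoff
    is at most \<open>X - 1\<close> plus the rate; otherwise \<open>1 - X \<le> - ln X\<close> makes
    up for the 1. That 1 is later matched by the conditional mean of \<open>X\<close>, which is at
    most 1.\<close>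
  have ae2: "AE \<omega> in M. ?E (\<lambda>\<omega>. ennreal (C \<omega>) + 1) \<omega> \<le>
      ?E (\<lambda>\<omega>. (ennreal (dprice a t \<omega>) + ennreal (max (- \<delta> a \<omega> * B \<omega>) 0)) + (ennreal (log_err a t \<omega>) + ennreal (rate a t))) \<omega>"
  proof (rule Fa.nn_cond_exp_mono)
    show "AE \<omega> in M. ennreal (C \<omega>) + 1 \<le> (ennreal (dprice a t \<omega>) + ennreal (max (- \<delta> a \<omega> * B \<omega>) 0)) + (ennreal (log_err a t \<omega>) + ennreal (rate a t))"
    proof (rule AE_I2)
      fix \<omega> assume "\<omega> \<in> space M"
      then have X: "0 < dprice a t \<omega>" using assms by (intro dprice_pos) auto
      have "- ln (dprice a t \<omega>) \<le> - \<delta> a \<omega> * B \<omega> + log_err a t \<omega>" unfolding log_err_def B_def by simp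
      moreover have "- \<delta> a \<omega> * B \<omega> \<le> max (- \<delta> a \<omega> * B \<omega>) 0" by simp
      moreover have "1 - dprice a t \<omega> \<le> - ln (dprice a t \<omega>)" using ln_le[OF X] by simp
      moreover have nn: "0 \<le> C \<omega>" "0 \<le> log_err a t \<omega>" "0 \<le> max (- \<delta> a \<omega> * B \<omega>) 0" by (simp_all add: C_def log_err_def)
      moreover have "C \<omega> \<le> max (dprice a t \<omega> - 1) 0 + rate a t" using R1 R unfolding C_def by (auto simp: max_def)
      ultimately have "C \<omega> + 1 \<le> (dprice a t \<omega> + max (- \<delta> a \<omega> * B \<omega>) 0) + (log_err a t \<omega> + rate a t)"
        using X by (cases "1 \<le> dprice a t \<omega>") auto
      then have "ennreal (C \<omega> + 1) \<le> ennreal ((dprice a t \<omega> + max (- \<delta> a \<omega> * B \<omega>) 0) + (log_err a t \<omega> + rate a t))" by (rule ennreal_leI)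
      then show "ennreal (C \<omega>) + 1 \<le> (ennreal (dprice a t \<omega>) + ennreal (max (- \<delta> a \<omega> * B \<omega>) 0)) + (ennreal (log_err a t \<omega>) + ennreal (rate a t))"
        using nn X R by (simp add: ennreal_plus del: max.absorb1 max.absorb2)
    qed
  qed measurable
  have s1: "AE \<omega> in M. ?E (\<lambda>\<omega>. ennreal (C \<omega>)) \<omega> + ?E (\<lambda>\<omega>. ennreal (log_err a t \<omega>)) \<omega> = ?E (\<lambda>\<omega>. ennreal (C \<omega>) + ennreal (log_err a t \<omega>)) \<omega>"
    by (rule Fa.nn_cond_exp_sum) measurable
  have s2: "AE \<omega> in M. ?E (\<lambda>\<omega>. ennreal (C \<omega>)) \<omega> + ?E (\<lambda>\<omega>. 1) \<omega> = ?E (\<lambda>\<omega>. ennreal (C \<omega>) + 1) \<omega>"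
    by (rule Fa.nn_cond_exp_sum) measurable
  have s3: "AE \<omega> in M. ?E (\<lambda>\<omega>. ennreal (dprice a t \<omega>) + ennreal (max (- \<delta> a \<omega> * B \<omega>) 0)) \<omega> + ?E (\<lambda>\<omega>. ennreal (log_err a t \<omega>) + ennreal (rate a t)) \<omega>
    = ?E (\<lambda>\<omega>. (ennreal (dprice a t \<omega>) + ennreal (max (- \<delta> a \<omega> * B \<omega>) 0)) + (ennreal (log_err a t \<omega>) + ennreal (rate a t))) \<omega>"
    by (rule Fa.nn_cond_exp_sum) measurable
  have s4: "AE \<omega> in M. ?E (\<lambda>\<omega>. ennreal (dprice a t \<omega>)) \<omega> + ?E (\<lambda>\<omega>. ennreal (max (- \<delta> a \<omega> * B \<omega>) 0)) \<omega> = ?E (\<lambda>\<omega>. ennreal (dprice a t \<omega>) + ennreal (max (- \<delta> a \<omega> * B \<omega>) 0)) \<omega>"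
    by (rule Fa.nn_cond_exp_sum) measurable
  have s5: "AE \<omega> in M. ?E (\<lambda>\<omega>. ennreal (log_err a t \<omega>)) \<omega> + ?E (\<lambda>\<omega>. ennreal (rate a t)) \<omega> = ?E (\<lambda>\<omega>. ennreal (log_err a t \<omega>) + ennreal (rate a t)) \<omega>"
    by (rule Fa.nn_cond_exp_sum) measurable
  have c1: "AE \<omega> in M. 1 = ?E (\<lambda>_. 1) \<omega>" by (rule Fa.nn_cond_exp_F_meas) simp
  have c2: "AE \<omega> in M. ennreal (rate a t) = ?E (\<lambda>_. ennreal (rate a t)) \<omega>" by (rule Fa.nn_cond_exp_F_meas) simp
  have g1: "AE \<omega> in M. ?E (\<lambda>\<omega>. ennreal (max (\<delta> a \<omega> * B \<omega>) 0)) \<omega> = ennreal (\<bar>\<delta> a \<omega>\<bar> * sqrt (t - a) / sqrt (2 * pi))"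
    unfolding B_def by (rule gaussian_cond_exp[OF assms(1,2) daF])
  have g2: "AE \<omega> in M. ?E (\<lambda>\<omega>. ennreal (max (- \<delta> a \<omega> * B \<omega>) 0)) \<omega> = ennreal (\<bar>\<delta> a \<omega>\<bar> * sqrt (t - a) / sqrt (2 * pi))"
    using gaussian_cond_exp[OF assms(1,2), of "\<lambda>\<omega>. - \<delta> a \<omega>"] unfolding B_def by simp
  have e1: "AE \<omega> in M. ?E (\<lambda>\<omega>. ennreal (log_err a t \<omega>)) \<omega> \<le>
    ennreal (l \<omega>) + 20 * (ennreal (t - a) * (U \<omega> * (ennreal (1 / l \<omega>) + 2)) + 2 * ennreal ((\<delta> a \<omega>)\<^sup>2 * (t - a)))"
    by (rule log_err_cond_exp[OF assms(1-3) le lF l_pos])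
  have e2: "AE \<omega> in M. U \<omega> < top \<longrightarrow> ?E (\<lambda>\<omega>. ennreal (dprice a t \<omega>)) \<omega> \<le> 1"
    by (rule dprice_cond_exp[OF assms(1-3) le])
  show ?thesis
    using ae1 ae2 s1 s2 s3 s4 s5 c1 c2 g1 g2 e1 e2
  proof eventually_elim
    case (elim \<omega>)
    show ?case
    proof (intro allI impI)
      fix u l' assume u: "U \<omega> = ennreal u \<and> 0 \<le> u \<and> l' = sqrt (t - a) * (sqrt u + c)"
      then have l': "l \<omega> = l'" by (simp add: l_def)
      have lp: "0 < l'" using l_pos[of \<omega>] l' by simp
      define p where "p = \<bar>\<delta> a \<omega>\<bar> * sqrt (t - a) / sqrt (2 * pi)"
      have p: "0 \<le> p" using assms by (simp add: p_def)
      define b where "b = l' + 20 * ((t - a) * (u * (1 / l' + 2)) + 2 * ((\<delta> a \<omega>)\<^sup>2 * (t - a)))"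
      have nn: "0 \<le> u * (1 / l' + 2)" "0 \<le> t - a" using u lp assms by auto
      have b0: "0 \<le> b" unfolding b_def using nn lp by (intro add_nonneg_nonneg mult_nonneg_nonneg[OF _ nn(1)] mult_nonneg_nonneg) auto
      have "?E (\<lambda>\<omega>. ennreal (log_err a t \<omega>)) \<omega> \<le> ennreal l' + 20 * (ennreal (t - a) * (ennreal u * (ennreal (1 / l') + 2)) + 2 * ennreal ((\<delta> a \<omega>)\<^sup>2 * (t - a)))"
        using elim(12) u l' by simp
      also have "\<dots> = ennreal b"
      proof -
        have "ennreal (1 / l') + 2 = ennreal (1 / l' + 2)" using lp by (simp add: ennreal_plus)
        then show ?thesis unfolding b_def using nn lp u
          by (simp add: ennreal_plus ennreal_mult add_nonneg_nonneg mult_nonneg_nonneg)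
      qed
      finally have err: "?E (\<lambda>\<omega>. ennreal (log_err a t \<omega>)) \<omega> \<le> ennreal b" .
      have X: "?E (\<lambda>\<omega>. ennreal (dprice a t \<omega>)) \<omega> \<le> 1" using elim(13) u by simp
      let ?c = "?E (\<lambda>\<omega>. ennreal (C \<omega>)) \<omega>"
      have lower: "ennreal p \<le> ?c + ennreal b"
        using elim(1,3,10) err by (metis p_def add_left_mono order_trans)
      have "?c + 1 \<le> (?E (\<lambda>\<omega>. ennreal (dprice a t \<omega>)) \<omega> + ennreal p) + (?E (\<lambda>\<omega>. ennreal (log_err a t \<omega>)) \<omega> + ennreal (rate a t))"
        using elim(2) elim(4)[symmetric] elim(5)[symmetric] elim(6)[symmetric] elim(7)[symmetric] elim(8)[symmetric] elim(9)[symmetric] elim(11)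
        by (simp add: p_def)
      also have "\<dots> \<le> (1 + ennreal p) + (ennreal b + ennreal (rate a t))"
        by (intro add_mono X err order_refl)
      also have "\<dots> = ennreal (p + b + rate a t) + 1"
        using p b0 R by (simp add: ennreal_plus ac_simps)
      finally have upper: "?c + 1 \<le> ennreal (p + b + rate a t) + 1" .
      have "?c \<le> ?c + 1" by simp
      then have "?c < top" using upper by (rule le_less_trans[OF order_trans]) simp
      then obtain z where z: "?c = ennreal z" "0 \<le> z" by (cases ?c) auto
      have "ennreal (z + 1) \<le> ennreal (p + b + rate a t + 1)"
        using upper p b0 R z by (simp add: ennreal_plus)
      then have "z \<le> p + b + rate a t" using p b0 R by (subst (asm) ennreal_le_iff) auto
      moreover have "p \<le> z + b" using lower b0 z by (simp flip: ennreal_plus)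
      ultimately have "\<bar>z - p\<bar> \<le> b + rate a t" using R by linarith
      then show "\<bar>enn2real (?E (\<lambda>\<omega>. ennreal (max (dprice a t \<omega> - exp (- rate a t)) 0)) \<omega>) - \<bar>\<delta> a \<omega>\<bar> * sqrt (t - a) / sqrt (2 * pi)\<bar>
        \<le> l' + 20 * ((t - a) * (u * (1 / l' + 2)) + 2 * ((\<delta> a \<omega>)\<^sup>2 * (t - a))) + rate a t"
        using z unfolding C_def[symmetric] p_def b_def by simp
    qed
  qed
qed

end

section \<open>The short-time limit\<close>

text \<open>Countability of the subfamily pays twice: its supremum is measurable with respect to
  \<open>N\<close>, and off one null set all its members coincide with the versions \<open>g\<close>
  that converge, so that the suprema over shrinking windows tend to 0.\<close>

lemma as_tendsto_at_right_majorant: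
  fixes Y :: "real \<Rightarrow> 'a \<Rightarrow> ennreal"
  assumes "prob_space M" and sub: "subalgebra M N" and Y: "\<And>s. Y s \<in> borel_measurable N"
    and lim: "as_tendsto_at_right M Y (\<lambda>_. 0) a"
  shows "\<exists>U :: nat \<Rightarrow> 'a \<Rightarrow> ennreal. (\<forall>n. U n \<in> borel_measurable N) \<and>
    (\<forall>n s. a < s \<and> s \<le> a + 1 / real (Suc n) \<longrightarrow> (AE \<omega> in M. Y s \<omega> \<le> U n \<omega>)) \<and>
    (AE \<omega> in M. (\<lambda>n. U n \<omega>) \<longlonglongrightarrow> 0)"
proof -
  obtain g where g: "\<forall>t>a. AE \<omega> in M. g t \<omega> = Y t \<omega>"
    "AE \<omega> in M. ((\<lambda>t. g t \<omega>) \<longlongrightarrow> 0) (at_right a)"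
    using lim unfolding as_tendsto_at_right_def by blast
  have YM: "Y s \<in> borel_measurable M" for s using measurable_from_subalg[OF sub Y] .
  have "\<forall>n. \<exists>D. countable D \<and> D \<subseteq> {a<..a + 1 / real (Suc n)} \<and>
      (\<forall>s\<in>{a<..a + 1 / real (Suc n)}. AE \<omega> in M. Y s \<omega> \<le> (SUP d\<in>D. Y d \<omega>))"
    by (intro allI ess_sup_family[OF assms(1) YM])
  from choice[OF this] obtain D where "\<forall>n. countable (D n) \<and> D n \<subseteq> {a<..a + 1 / real (Suc n)} \<and>
      (\<forall>s\<in>{a<..a + 1 / real (Suc n)}. AE \<omega> in M. Y s \<omega> \<le> (SUP d\<in>D n. Y d \<omega>))" ..
  then have D: "\<And>n. countable (D n)" "\<And>n. D n \<subseteq> {a<..a + 1 / real (Suc n)}"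
      "\<And>n s. s \<in> {a<..a + 1 / real (Suc n)} \<Longrightarrow> AE \<omega> in M. Y s \<omega> \<le> (SUP d\<in>D n. Y d \<omega>)"
    by blast+
  define U where "U n \<omega> = (SUP d\<in>D n. Y d \<omega>)" for n \<omega>
  have "U n \<in> borel_measurable N" for n
    unfolding U_def using D(1) Y by (intro borel_measurable_SUP) auto
  moreover have "AE \<omega> in M. Y s \<omega> \<le> U n \<omega>" if "a < s \<and> s \<le> a + 1 / real (Suc n)" for n s
    unfolding U_def using D(3)[of s n] that by auto
  moreover have "AE \<omega> in M. (\<lambda>n. U n \<omega>) \<longlonglongrightarrow> 0"
  proof -
    have "AE \<omega> in M. \<forall>d\<in>D n. g d \<omega> = Y d \<omega>" for n
      using D(1,2)[of n] g(1) by (subst AE_ball_countable) auto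
    then have "AE \<omega> in M. \<forall>n. \<forall>d\<in>D n. g d \<omega> = Y d \<omega>" unfolding AE_all_countable by blast
    then show ?thesis using g(2)
    proof eventually_elim
      case (elim \<omega>)
      show ?case
      proof (rule order_tendstoI)
        fix c :: ennreal assume "0 < c"
        then obtain z where z: "0 < z" "z < c" using dense by blast
        have "\<forall>\<^sub>F t in at_right a. g t \<omega> < z" using elim(2) z(1) by (rule order_tendstoD)
        then obtain b where b: "a < b" "\<And>t. a < t \<Longrightarrow> t < b \<Longrightarrow> g t \<omega> < z"
          by (auto simp: eventually_at_right_field)
        have "(\<lambda>n. 1 / real (Suc n)) \<longlonglongrightarrow> 0" by (rule LIMSEQ_Suc[OF lim_1_over_n])
        then have "\<forall>\<^sub>F n in sequentially. 1 / real (Suc n) < b - a" using b(1) by (intro order_tendstoD) auto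
        then show "\<forall>\<^sub>F n in sequentially. U n \<omega> < c"
        proof eventually_elim
          case (elim n)
          have "U n \<omega> \<le> z"
            unfolding U_def
          proof (rule SUP_least)
            fix d assume d: "d \<in> D n"
            then have "a < d" "d < b" using D(2)[of n] elim by auto
            then have "g d \<omega> < z" by (rule b(2))
            then show "Y d \<omega> \<le> z" using \<open>\<forall>n. \<forall>d\<in>D n. g d \<omega> = Y d \<omega>\<close> d by (metis less_imp_le)
          qed
          then show ?case using z(2) by (rule le_less_trans)
        qed
      qed simp
    qed
  qed
  ultimately show ?thesis by blast
qed

text \<open>Here \<open>h\<close> is \<open>t - a\<close>, and \<open>l\<close> is the balanced
  level with \<open>c = h\<close>. Then \<open>l / sqrt h = sqrt u + h\<close>, and the critical
  term becomes \<open>u / (sqrt u + h) \<le> sqrt u\<close>. For fixed \<open>d\<close> and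
  \<open>\<rho>\<close> the right-hand side tends to 0 with \<open>u\<close> and
  \<open>h\<close>.\<close>

lemma normalized_error_bound:
  fixes h u d R \<rho> l :: real
  assumes "0 < h" "0 \<le> u" "R \<le> \<rho> * h" and l: "l = sqrt h * (sqrt u + h)"
  shows "(l + 20 * (h * (u * (1 / l + 2)) + 2 * (d\<^sup>2 * h)) + R) / sqrt h
    \<le> sqrt u + h + 20 * (sqrt u + 2 * u * sqrt h + 2 * d\<^sup>2 * sqrt h) + \<rho> * sqrt h"
proof -
  define k where "k = sqrt h"
  have k: "0 < k" "h = k * k" using assms by (simp_all add: k_def)
  define v where "v = sqrt u"
  have v: "0 \<le> v" "u = v * v" using assms by (simp_all add: v_def)
  have l': "l = k * (v + h)" unfolding l k_def v_def ..
  have vh: "0 < v + h" using v(1) assms(1) by linarith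
  have hk: "h * y / k = k * y" for y by (subst k(2)) (use k(1) in simp)
  have 1: "l / k = v + h" unfolding l' using k(1) by simp
  have 2: "h * (u * (1 / l + 2)) / k = u / (v + h) + 2 * u * k"
  proof -
    have "h * (u * (1 / l + 2)) / k = k * u / l + 2 * u * k" unfolding hk by (simp add: algebra_simps)
    also have "k * u / l = u / (v + h)" unfolding l' using k(1) by simp
    finally show ?thesis .
  qed
  have 3: "u / (v + h) \<le> v"
  proof -
    have "v * v \<le> v * (v + h)" using v(1) assms(1) by (intro mult_left_mono) auto
    then show ?thesis by (subst v(2)) (use vh in \<open>simp add: divide_le_eq\<close>)
  qed
  have 4: "2 * (d\<^sup>2 * h) / k = 2 * d\<^sup>2 * k"
    using hk[of "2 * d\<^sup>2"] by (simp add: mult_ac)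
  have 5: "R / k \<le> \<rho> * k"
    using divide_right_mono[OF assms(3), of k] k(1) hk[of \<rho>] by (simp add: mult.commute)
  have "(l + 20 * (h * (u * (1 / l + 2)) + 2 * (d\<^sup>2 * h)) + R) / k =
    l / k + 20 * (h * (u * (1 / l + 2)) / k + 2 * (d\<^sup>2 * h) / k) + R / k"
    by (simp add: add_divide_distrib)
  also have "\<dots> \<le> (v + h) + 20 * (v + 2 * u * k + 2 * d\<^sup>2 * k) + \<rho> * k"
    unfolding 1 2 4 using 3 5 by simp
  finally show ?thesis by (simp add: k_def v_def)
qed

section \<open>Normalised call prices\<close>

context price_model
begin

text \<open>\<open>S t - S a = S a * exp (rate a t) * (X - exp (- rate a t))\<close> with
  \<open>X\<close> the discounted relative price. The first two factors are known at time
  \<open>a\<close>, and the discount factor of the call cancels the exponential.\<close>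

lemma call_price_eq:
  assumes "0 \<le> a" "a < t"
  shows "AE \<omega> in M. call_price M F \<rho> S a t (S a) \<omega> =
    S a \<omega> * enn2real (nn_cond_exp M (F a) (\<lambda>\<omega>. ennreal (max (dprice a t \<omega> - exp (- rate a t)) 0)) \<omega>)"
proof -
  interpret Fa: finite_measure_subalgebra M "F a"
    using subalgebra_F[OF assms(1)] by unfold_locales
  let ?E = "nn_cond_exp M (F a)"
  let ?C = "\<lambda>\<omega>. max (dprice a t \<omega> - exp (- rate a t)) 0"
  have [measurable]: "S a \<in> borel_measurable (F a)" using S_F assms by simp
  have [measurable]: "dprice a t \<in> borel_measurable M" using assms by (intro dprice_M) auto
  have [measurable]: "S a \<in> borel_measurable M" "S t \<in> borel_measurable M" using assms by auto
  have "AE \<omega> in M. ?E (\<lambda>\<omega>. ennreal (max (S t \<omega> - S a \<omega>) 0)) \<omega> = ?E (\<lambda>\<omega>. ennreal (S a \<omega> * exp (rate a t)) * ennreal (?C \<omega>)) \<omega>"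
  proof (rule Fa.nn_cond_exp_cong)
    show "AE \<omega> in M. ennreal (max (S t \<omega> - S a \<omega>) 0) = ennreal (S a \<omega> * exp (rate a t)) * ennreal (?C \<omega>)"
    proof (rule AE_I2)
      fix \<omega> assume \<omega>: "\<omega> \<in> space M"
      have Sa: "0 < S a \<omega>" using S_positive[OF assms(1) \<omega>] .
      have "S t \<omega> - S a \<omega> = (S a \<omega> * exp (rate a t)) * (dprice a t \<omega> - exp (- rate a t))"
        using Sa by (simp add: dprice_def right_diff_distrib exp_minus field_simps)
      then have "max (S t \<omega> - S a \<omega>) 0 = (S a \<omega> * exp (rate a t)) * ?C \<omega>"
        using Sa by (simp add: max_mult_distrib_left)
      then show "ennreal (max (S t \<omega> - S a \<omega>) 0) = ennreal (S a \<omega> * exp (rate a t)) * ennreal (?C \<omega>)"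
        using Sa by (simp add: ennreal_mult)
    qed
  qed measurable
  moreover have "AE \<omega> in M. ennreal (S a \<omega> * exp (rate a t)) * ?E (\<lambda>\<omega>. ennreal (?C \<omega>)) \<omega> = ?E (\<lambda>\<omega>. ennreal (S a \<omega> * exp (rate a t)) * ennreal (?C \<omega>)) \<omega>"
    by (rule Fa.nn_cond_exp_prod) measurable
  moreover have "AE \<omega> in M. 0 = ?E (\<lambda>\<omega>. 0) \<omega>" by (rule Fa.nn_cond_exp_F_meas) simp
  ultimately show ?thesis using AE_space
  proof eventually_elim
    case (elim \<omega>)
    have Sa: "0 < S a \<omega>" using S_positive[OF assms(1) elim(4)] .
    \<comment> \<open>\<open>real_cond_exp\<close> is a difference of two nonnegative conditional
      expectations; the payoff has no negative part, so only the first one remains.\<close>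
    have "ennreal (- max (S t \<omega>' - S a \<omega>') 0) = 0" for \<omega>' by (simp add: ennreal_neg)
    then have "real_cond_exp M (F a) (\<lambda>\<omega>. max (S t \<omega> - S a \<omega>) 0) \<omega> =
      enn2real (ennreal (S a \<omega> * exp (rate a t)) * ?E (\<lambda>\<omega>. ennreal (?C \<omega>)) \<omega>)"
      unfolding real_cond_exp_def using elim(1) elim(2)[symmetric] elim(3)[symmetric] by simp
    also have "\<dots> = S a \<omega> * exp (rate a t) * enn2real (?E (\<lambda>\<omega>. ennreal (?C \<omega>)) \<omega>)"
      using Sa by (simp add: enn2real_mult)
    finally show ?case
      by (simp add: call_price_def rate_def[symmetric] exp_minus)
  qed
qed

lemma rate_le:
  assumes "0 \<le> a" "a < t" and K: "\<And>s. 0 \<le> s \<Longrightarrow> \<rho> s \<le> K"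
  shows "rate a t \<le> K * (t - a)"
proof -
  have "rate a t = integral {a..t} \<rho>" unfolding rate_def by (rule set_integral_continuous(1)[OF r_continuous assms(1)])
  also have "\<dots> \<le> integral {a..t} (\<lambda>_. K)"
    using assms by (intro integral_le set_integral_continuous(2)[OF r_continuous]) auto
  finally show ?thesis using assms by (simp add: mult.commute)
qed

lemma normalized_call_price_bound:
  assumes "0 \<le> a" "a < t" and U: "U \<in> borel_measurable (F a)"
    and le: "\<And>s. a < s \<Longrightarrow> s \<le> t \<Longrightarrow> AE \<omega> in M. nn_cond_exp M (F a) (\<lambda>\<omega>. ennreal (\<bar>\<delta> s \<omega> - \<delta> a \<omega>\<bar>\<^sup>2)) \<omega> \<le> U \<omega>"
    and K: "\<And>s. 0 \<le> s \<Longrightarrow> \<rho> s \<le> K"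
  shows "AE \<omega> in M. \<forall>u\<ge>0. U \<omega> = ennreal u \<longrightarrow>
    \<bar>1 / sqrt (t - a) * call_price M F \<rho> S a t (S a) \<omega> - S a \<omega> / sqrt (2 * pi) * \<bar>\<delta> a \<omega>\<bar>\<bar> \<le>
    S a \<omega> * (sqrt u + (t - a) + 20 * (sqrt u + 2 * u * sqrt (t - a) + 2 * (\<delta> a \<omega>)\<^sup>2 * sqrt (t - a)) + K * sqrt (t - a))"
proof -
  \<comment> \<open>The free constant \<open>c\<close> in the level is taken to be
    \<open>t - a\<close>: it is positive and still vanishes after division of the level by
    \<open>sqrt (t - a)\<close>.\<close>
  have "0 < t - a" using assms by simp
  have *: "AE \<omega> in M. \<forall>u l. U \<omega> = ennreal u \<and> 0 \<le> u \<and> l = sqrt (t - a) * (sqrt u + (t - a)) \<longrightarrow>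
    \<bar>enn2real (nn_cond_exp M (F a) (\<lambda>\<omega>. ennreal (max (dprice a t \<omega> - exp (- rate a t)) 0)) \<omega>) - \<bar>\<delta> a \<omega>\<bar> * sqrt (t - a) / sqrt (2 * pi)\<bar>
    \<le> l + 20 * ((t - a) * (u * (1 / l + 2)) + 2 * ((\<delta> a \<omega>)\<^sup>2 * (t - a))) + rate a t"
    by (rule call_cond_exp[OF assms(1-3) le \<open>0 < t - a\<close>])
  from call_price_eq[OF assms(1,2)] * AE_space show ?thesis
  proof eventually_elim
    case (elim \<omega>)
    have Sa: "0 < S a \<omega>" using S_positive[OF assms(1) elim(3)] .
    define k where "k = sqrt (t - a)"
    have k: "0 < k" using assms by (simp add: k_def)
    define c where "c = enn2real (nn_cond_exp M (F a) (\<lambda>\<omega>. ennreal (max (dprice a t \<omega> - exp (- rate a t)) 0)) \<omega>)"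
    show ?case
    proof (intro allI impI)
      fix u assume u: "0 \<le> u" "U \<omega> = ennreal u"
      define l where "l = k * (sqrt u + (t - a))"
      define b where "b = l + 20 * ((t - a) * (u * (1 / l + 2)) + 2 * ((\<delta> a \<omega>)\<^sup>2 * (t - a))) + rate a t"
      have "\<bar>c - \<bar>\<delta> a \<omega>\<bar> * k / sqrt (2 * pi)\<bar> \<le> b"
        using elim(2)[rule_format, of u l] u by (simp add: c_def k_def l_def b_def)
      then have "\<bar>c - \<bar>\<delta> a \<omega>\<bar> * k / sqrt (2 * pi)\<bar> / k \<le> b / k" using k by (intro divide_right_mono) auto
      also have "b / k \<le> sqrt u + (t - a) + 20 * (sqrt u + 2 * u * k + 2 * (\<delta> a \<omega>)\<^sup>2 * k) + K * k"
        unfolding b_def k_def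
        using assms u rate_le[OF assms(1,2) K] by (intro normalized_error_bound) (auto simp: l_def k_def)
      finally have le: "\<bar>c - \<bar>\<delta> a \<omega>\<bar> * k / sqrt (2 * pi)\<bar> / k \<le> sqrt u + (t - a) + 20 * (sqrt u + 2 * u * k + 2 * (\<delta> a \<omega>)\<^sup>2 * k) + K * k" .
      have "1 / k * (S a \<omega> * c) - S a \<omega> / sqrt (2 * pi) * \<bar>\<delta> a \<omega>\<bar> = S a \<omega> * ((c - \<bar>\<delta> a \<omega>\<bar> * k / sqrt (2 * pi)) / k)"
        using k by (simp add: diff_divide_distrib right_diff_distrib)
      then have "\<bar>1 / k * (S a \<omega> * c) - S a \<omega> / sqrt (2 * pi) * \<bar>\<delta> a \<omega>\<bar>\<bar> = S a \<omega> * (\<bar>c - \<bar>\<delta> a \<omega>\<bar> * k / sqrt (2 * pi)\<bar> / k)"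
        using k Sa by (simp add: abs_mult)
      also have "\<dots> \<le> S a \<omega> * (sqrt u + (t - a) + 20 * (sqrt u + 2 * u * k + 2 * (\<delta> a \<omega>)\<^sup>2 * k) + K * k)"
        using le Sa by (intro mult_left_mono) auto
      finally show "\<bar>1 / sqrt (t - a) * call_price M F \<rho> S a t (S a) \<omega> - S a \<omega> / sqrt (2 * pi) * \<bar>\<delta> a \<omega>\<bar>\<bar> \<le>
        S a \<omega> * (sqrt u + (t - a) + 20 * (sqrt u + 2 * u * sqrt (t - a) + 2 * (\<delta> a \<omega>)\<^sup>2 * sqrt (t - a)) + K * sqrt (t - a))"
        using elim(1) unfolding c_def k_def by simp
    qed
  qed
qed

end

text \<open>This index selects, for \<open>t\<close> close to \<open>a\<close>, a majorant whose
  window of length \<open>1 / Suc n\<close> contains \<open>t\<close>; it grows without bound as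
  \<open>t\<close> decreases to \<open>a\<close>.\<close>

lemma filterlim_floor_inverse_at_right:
  "filterlim (\<lambda>t. nat \<lfloor>1 / (t - a)\<rfloor> - 1) sequentially (at_right (a::real))"
  unfolding filterlim_at_top
proof
  fix N :: nat
  have "\<forall>\<^sub>F t in at_right a. t < a + 1 / (real N + 1)"
    by (intro eventually_at_right_real[THEN eventually_mono, of a "a + 1 / (real N + 1)"]) auto
  then show "\<forall>\<^sub>F t in at_right a. N \<le> nat \<lfloor>1 / (t - a)\<rfloor> - 1"
    using eventually_at_right_less[of a]
  proof eventually_elim
    case (elim t)
    then have "real N + 1 \<le> 1 / (t - a)" by (simp add: field_simps)
    then have "int (Suc N) \<le> \<lfloor>1 / (t - a)\<rfloor>" by (simp add: le_floor_iff)
    then show ?case by linarith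
  qed
qed

theorem proposition3p3:
  fixes M :: "'a measure" and F :: "real \<Rightarrow> 'a measure"
    and W S \<delta> :: "real \<Rightarrow> 'a \<Rightarrow> real" and r :: "real \<Rightarrow> real"
    and t0 T \<epsilon> :: real
  assumes brownian: "standard_brownian_motion M F W"
    and r_continuous: "continuous_on {0..} r"
    and r_positive: "\<And>t. 0 \<le> t \<Longrightarrow> 0 < r t"
    and r_bounded: "bounded (r ` {0..})"
    and \<delta>_adapted: "adapted F \<delta>"
    and S_adapted: "adapted F S"
    and S_continuous: "\<And>\<omega>. \<omega> \<in> space M \<Longrightarrow> continuous_on {0..} (\<lambda>t. S t \<omega>)"
    and S_positive: "\<And>t \<omega>. 0 \<le> t \<Longrightarrow> \<omega> \<in> space M \<Longrightarrow> 0 < S t \<omega>"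
    and S_equation: "\<And>t. 0 \<le> t \<Longrightarrow>
          \<exists>I. has_ito_integral M F W (\<lambda>s \<omega>. S s \<omega> * \<delta> s \<omega>) t I \<and>
              (AE \<omega> in M. S t \<omega> = S 0 \<omega> + (LBINT s:{0..t}. r s * S s \<omega>) + I \<omega>)"
    and t0: "0 \<le> t0"
    and A: "as_tendsto_at_right M
              (\<lambda>t. nn_cond_exp M (F t0) (\<lambda>\<omega>. ennreal (\<bar>\<delta> t \<omega> - \<delta> t0 \<omega>\<bar>\<^sup>2))) (\<lambda>_. 0) t0"
    and T: "t0 < T"
    and I: "AE \<omega> in M.
              nn_cond_exp M (F t0) (\<lambda>\<omega>. ennreal (exp (1/2 * (LBINT s:{t0..T}. (\<delta> s \<omega>)\<^sup>2)))) \<omega> < \<infinity>"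
    and \<epsilon>: "0 < \<epsilon>"
    and N: "AE \<omega> in M. \<forall>t\<in>{t0..T}. \<epsilon> \<le> \<delta> t \<omega>"
  shows "as_tendsto_at_right M
           (\<lambda>t \<omega>. 1 / sqrt (t - t0) * call_price M F r S t0 t (S t0) \<omega>)
           (\<lambda>\<omega>. S t0 \<omega> / sqrt (2 * pi) * \<delta> t0 \<omega>) t0"
proof -
  interpret price_model M F W S \<delta> r
    using brownian r_continuous r_positive \<delta>_adapted S_adapted S_continuous S_positive S_equation
    by (intro price_model.intro price_model_axioms.intro) auto
  obtain K where "\<forall>x\<in>r ` {0..}. norm x \<le> K"
    using r_bounded unfolding bounded_iff by blast
  then have K: "r s \<le> K" if "0 \<le> s" for s
    using that abs_ge_self[of "r s"] by (force intro: order_trans)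
  obtain U :: "nat \<Rightarrow> 'a \<Rightarrow> ennreal" where U: "\<And>n. U n \<in> borel_measurable (F t0)"
    "\<And>n s. t0 < s \<Longrightarrow> s \<le> t0 + 1 / real (Suc n) \<Longrightarrow>
      AE \<omega> in M. nn_cond_exp M (F t0) (\<lambda>\<omega>. ennreal (\<bar>\<delta> s \<omega> - \<delta> t0 \<omega>\<bar>\<^sup>2)) \<omega> \<le> U n \<omega>"
    "AE \<omega> in M. (\<lambda>n. U n \<omega>) \<longlonglongrightarrow> 0"
    using as_tendsto_at_right_majorant[OF prob_space_axioms subalgebra_F[OF t0] _ A] by auto
  define f where "f t \<omega> = 1 / sqrt (t - t0) * call_price M F r S t0 t (S t0) \<omega>" for t \<omega>
  define lim where "lim \<omega> = S t0 \<omega> / sqrt (2 * pi) * \<delta> t0 \<omega>" for \<omega>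
  define n where "n t = nat \<lfloor>1 / (t - t0)\<rfloor> - 1" for t
  define u where "u t \<omega> = enn2real (U (n t) \<omega>)" for t \<omega>
  define \<Psi> where "\<Psi> t \<omega> = S t0 \<omega> * (sqrt (u t \<omega>) + (t - t0) + 20 * (sqrt (u t \<omega>) + 2 * u t \<omega> * sqrt (t - t0)
      + 2 * (\<delta> t0 \<omega>)\<^sup>2 * sqrt (t - t0)) + K * sqrt (t - t0))" for t \<omega>
  \<comment> \<open>A version of \<open>f t\<close>: it departs from \<open>f t\<close> only where
    the error bound fails although the majorant is finite, which happens on a null set for each
    \<open>t\<close>, and takes the limit value there. So the bound holds for all \<open>t\<close>
    near \<open>t0\<close> at once on every path along which the majorants tend to 0.\<close>
  define g where "g t \<omega> = (if t \<le> t0 + 1 \<and> U (n t) \<omega> < top \<and> \<not> \<bar>f t \<omega> - lim \<omega>\<bar> \<le> \<Psi> t \<omega> then lim \<omega> else f t \<omega>)" for t \<omega>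
  \<comment> \<open>The symmetric Gaussian law produces \<open>\<bar>\<delta> t0\<bar>\<close>; the
    lower bound \<open>\<epsilon>\<close> at time \<open>t0\<close> removes the absolute
    value.\<close>
  have abs: "AE \<omega> in M. \<bar>\<delta> t0 \<omega>\<bar> = \<delta> t0 \<omega>"
    using N by eventually_elim (use T \<epsilon> in force)
  have "AE \<omega> in M. g t \<omega> = f t \<omega>" if t: "t0 < t" for t
  proof (cases "t \<le> t0 + 1")
    case True
    \<comment> \<open>For \<open>t \<le> t0 + 1\<close> the floor is at least 1, so the subtraction
      on natural numbers is exact and \<open>Suc (n t)\<close> is the floor itself.\<close>
    have le: "t \<le> t0 + 1 / real (Suc (n t))"
    proof -
      have "1 \<le> 1 / (t - t0)" using True t by simp
      then have "1 \<le> \<lfloor>1 / (t - t0)\<rfloor>" by simp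
      then have "real (Suc (n t)) \<le> 1 / (t - t0)" unfolding n_def by linarith
      then show ?thesis using t by (simp add: field_simps del: of_nat_Suc)
    qed
    have "AE \<omega> in M. \<forall>u\<ge>0. U (n t) \<omega> = ennreal u \<longrightarrow>
      \<bar>1 / sqrt (t - t0) * call_price M F r S t0 t (S t0) \<omega> - S t0 \<omega> / sqrt (2 * pi) * \<bar>\<delta> t0 \<omega>\<bar>\<bar> \<le>
      S t0 \<omega> * (sqrt u + (t - t0) + 20 * (sqrt u + 2 * u * sqrt (t - t0) + 2 * (\<delta> t0 \<omega>)\<^sup>2 * sqrt (t - t0)) + K * sqrt (t - t0))"
      by (rule normalized_call_price_bound[OF t0 t U(1) U(2) K]) (use le in auto)
    then show ?thesis using abs
    proof eventually_elim
      case (elim \<omega>)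
      have "\<bar>f t \<omega> - lim \<omega>\<bar> \<le> \<Psi> t \<omega>" if fin: "U (n t) \<omega> < top"
      proof -
        have u: "0 \<le> u t \<omega>" "U (n t) \<omega> = ennreal (u t \<omega>)"
          using fin by (simp_all add: u_def)
        show ?thesis
          using elim(1)[rule_format, OF u] unfolding elim(2) f_def lim_def \<Psi>_def .
      qed
      then show ?case unfolding g_def by meson
    qed
  qed (simp add: g_def)
  moreover have "AE \<omega> in M. ((\<lambda>t. g t \<omega>) \<longlongrightarrow> lim \<omega>) (at_right t0)"
    using U(3)
  proof eventually_elim
    case (elim \<omega>)
    have Un: "((\<lambda>t. U (n t) \<omega>) \<longlongrightarrow> 0) (at_right t0)"
      using filterlim_compose[OF elim filterlim_floor_inverse_at_right[of t0]] unfolding n_def .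
    then have u0: "((\<lambda>t. u t \<omega>) \<longlongrightarrow> 0) (at_right t0)"
      unfolding u_def using tendsto_enn2real[of "\<lambda>t. U (n t) \<omega>" 0 "at_right t0"] by simp
    have h: "((\<lambda>t. t - t0) \<longlongrightarrow> t0 - t0) (at_right t0)" by (intro tendsto_intros)
    have "((\<lambda>t. \<Psi> t \<omega>) \<longlongrightarrow> S t0 \<omega> * (sqrt 0 + (t0 - t0) + 20 * (sqrt 0 + 2 * 0 * sqrt (t0 - t0)
      + 2 * (\<delta> t0 \<omega>)\<^sup>2 * sqrt (t0 - t0)) + K * sqrt (t0 - t0))) (at_right t0)"
      unfolding \<Psi>_def by (intro tendsto_intros u0 h)
    then have \<Psi>0: "((\<lambda>t. \<Psi> t \<omega>) \<longlongrightarrow> 0) (at_right t0)" by simp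
    have "\<forall>\<^sub>F t in at_right t0. norm (g t \<omega> - lim \<omega>) \<le> \<bar>\<Psi> t \<omega>\<bar>"
    proof -
      have "\<forall>\<^sub>F t in at_right t0. U (n t) \<omega> < top" using Un by (rule order_tendstoD) simp
      moreover have "\<forall>\<^sub>F t in at_right t0. t \<in> {t0<..<t0 + 1}" by (rule eventually_at_right_real) simp
      ultimately show ?thesis
      proof eventually_elim
        case (elim t)
        show ?case unfolding g_def using elim abs_ge_self[of "\<Psi> t \<omega>"]
          by (cases "\<bar>f t \<omega> - lim \<omega>\<bar> \<le> \<Psi> t \<omega>") simp_all
      qed
    qed
    from Lim_null_comparison[OF this tendsto_rabs_zero[OF \<Psi>0]] show ?case by (simp add: LIM_zero_iff)
  qed
  ultimately show ?thesis
    unfolding as_tendsto_at_right_def f_def lim_def by (intro exI[of _ g]) (simp add: f_def lim_def)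
qed

end
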